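(* Let $\varrho(N)$, $N\ge1$, be a sequence of probability measures on $\hat U(N)$ such that for every finite $r\in\mathbb{N}$ one has $$\lim_{N\to\infty}N\left(\frac1N\log S^{U(N)}_{\varrho(N)}(u_1,\dots,u_r,1^{N-r})-\sum_{i=1}^r\Psi(u_i)\right)=\sum_{i=1}^r\Phi(u_i),$$ where $\Psi,\Phi$ are analytic functions in a complex neighborhood of $1$ and the convergence is uniform in a complex neighborhood of $1^r$. Then for every $k\in\mathbb{N}$ we have $$\lim_{N\to\infty}N\left(\frac1N\sum_{\lambda\in\hat U(N)}\varrho(N)[\lambda]\sum_{i=1}^N\left(\frac{\lambda_i+N-i}{N}\right)^k-\mathbf{m}_k\right)=\mathbf{m}'_k,$$ where $$\mathbf{m}_k=\sum_{m=0}^{k}\frac{k!}{m!\,(m+1)!\,(k-m)!}\left.\frac{d^m}{dx^m}\left(x^k(\Psi'(x))^{k-m}\right)\right|_{x=1},$$ $$\mathbf{m}'_k=\sum_{m=0}^{k-1}\frac{k!}{m!\,(m+1)!\,(k-m-1)!}\left.\frac{d^m}{dx^m}\left(x^k\left(\Phi'(x)-\frac{1}{2x}\right)(\Psi'(x))^{k-m-1}\right)\right|_{x=1}.$$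
   Context: $\mathbb{N}=\{1,2,\dots\}$; $1^m$ denotes $m$ ones $(1,\dots,1)$. $\hat U(N)$ is the set of signatures of length $N$: $N$-tuples of integers $\lambda=(\lambda_1\ge\lambda_2\ge\dots\ge\lambda_N)$. For $\lambda\in\hat U(N)$ the (rational) Schur function is $$\boldsymbol{\chi}^{\lambda}(u_1,\dots,u_N)=\frac{\det\left(u_i^{\lambda_j+N-j}\right)_{i,j=1}^N}{\prod_{1\le i<j\le N}(u_i-u_j)},$$ a symmetric Laurent polynomial. For a probability measure $\varrho$ on $\hat U(N)$ the Schur generating function is the symmetric Laurent power series $$S^{U(N)}_{\varrho}(u_1,\dots,u_N)=\sum_{\lambda\in\hat U(N)}\varrho(\lambda)\frac{\boldsymbol{\chi}^{\lambda}(u_1,\dots,u_N)}{\boldsymbol{\chi}^{\lambda}(1^N)}.$$ The hypothesis implicitly includes that this series converges near $1^N$, and that the logarithm (the branch equal to $0$ at $u=1$) is well defined there. *)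

theory Defs
  imports
    "HOL-Complex_Analysis.Complex_Analysis"
    "HOL-Probability.Probability_Mass_Function"
    "Jordan_Normal_Form.Determinant"
begin

definition signatures :: "nat \<Rightarrow> int list set" where
  "signatures N = {l. length l = N \<and> sorted_wrt (\<ge>) l}"

text \<open>
  Variables are indexed from 0, so the exponent \<open>\<lambda>\<^sub>j + N - j\<close> with \<open>j = 1, \<dots>, N\<close> becomes
  \<open>l ! j + N - 1 - j\<close> with \<open>j < N\<close>.  Only the coordinates \<open>u i\<close> with \<open>i < length l\<close> matter.
\<close>

definition schur_ratio :: "int list \<Rightarrow> (nat \<Rightarrow> complex) \<Rightarrow> complex" where
  "schur_ratio l u = (let N = length l in
     Determinant.det (mat N N (\<lambda>(i, j). u i powi (l ! j + int N - 1 - int j))) /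
     (\<Prod>i<N. \<Prod>j\<in>{i<..<N}. u i - u j))"

text \<open>
  The quotient is a Laurent polynomial.  Where coordinates coincide, its value is
  recovered as the limit along points with pairwise distinct coordinates (the quotient itself
  would be \<open>0 / 0\<close> there).
\<close>

definition schur :: "int list \<Rightarrow> (nat \<Rightarrow> complex) \<Rightarrow> complex" where
  "schur l u = Lim (at u within {v. inj_on v {..<length l}}) (schur_ratio l)"

definition sgf_term :: "int list pmf \<Rightarrow> (nat \<Rightarrow> complex) \<Rightarrow> int list \<Rightarrow> complex" where
  "sgf_term p u l = of_real (pmf p l) * (schur l u / schur l (\<lambda>_. 1))"

definition sgf :: "nat \<Rightarrow> int list pmf \<Rightarrow> (nat \<Rightarrow> complex) \<Rightarrow> complex" where
  "sgf N p u = (\<Sum>\<^sub>\<infinity>l\<in>signatures N. sgf_term p u l)"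

text \<open>
  The open polydisc of radius \<open>e\<close> about \<open>1\<^sup>r\<close>, each point \<open>(u\<^sub>0, \<dots>, u\<^bsub>r-1\<^esub>)\<close> being padded
  with ones.  Thus for \<open>N \<ge> r\<close> the first \<open>N\<close> coordinates of a point of \<open>polydisc1 r e\<close> are
  \<open>(u\<^sub>0, \<dots>, u\<^bsub>r-1\<^esub>, 1\<^sup>N\<^sup>-\<^sup>r)\<close>.
\<close>

definition polydisc1 :: "nat \<Rightarrow> real \<Rightarrow> (nat \<Rightarrow> complex) set" where
  "polydisc1 r e = {u. (\<forall>i<r. dist (u i) 1 < e) \<and> (\<forall>i\<ge>r. u i = 1)}"

text \<open>
  \<open>L\<close> is the branch of \<open>log f\<close> on \<open>U\<close> that vanishes at \<open>(1, 1, \<dots>)\<close>; it is unique if \<open>U\<close> is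
  connected.  An infinite sum that does not converge has the value \<open>0\<close>, so for \<open>f = sgf N p\<close> the
  equation with \<open>exp\<close> also forces the series to converge on \<open>U\<close>.
\<close>

definition log_branch ::
  "(nat \<Rightarrow> complex) set \<Rightarrow> ((nat \<Rightarrow> complex) \<Rightarrow> complex) \<Rightarrow> ((nat \<Rightarrow> complex) \<Rightarrow> complex) \<Rightarrow> bool" where
  "log_branch U f L \<longleftrightarrow>
     continuous_on U L \<and> L (\<lambda>_. 1) = 0 \<and> (\<forall>u\<in>U. exp (L u) = f u)"

definition power_sum :: "nat \<Rightarrow> nat \<Rightarrow> int list \<Rightarrow> real" where
  "power_sum N k l = (\<Sum>i<N. ((of_int (l ! i) + real N - 1 - real i) / real N) ^ k)"

definition moment :: "(complex \<Rightarrow> complex) \<Rightarrow> nat \<Rightarrow> complex" where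
  "moment \<Psi> k = (\<Sum>m=0..k.
     fact k / (fact m * fact (m + 1) * fact (k - m)) *
     (deriv ^^ m) (\<lambda>x. x ^ k * deriv \<Psi> x ^ (k - m)) 1)"

definition moment' :: "(complex \<Rightarrow> complex) \<Rightarrow> (complex \<Rightarrow> complex) \<Rightarrow> nat \<Rightarrow> complex" where
  "moment' \<Psi> \<Phi> k = (\<Sum>m=0..k - 1.
     fact k / (fact m * fact (m + 1) * fact (k - m - 1)) *
     (deriv ^^ m) (\<lambda>x. x ^ k * (deriv \<Phi> x - 1 / (2 * x)) * deriv \<Psi> x ^ (k - m - 1)) 1)"

end

theory Submission
  imports Defs "HOL-Combinatorics.Stirling"
begin

text \<open>
  The reason for the theorem is an exact formula for the expected power sums, in which the number
  of variables and the size of every term are visible.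

  \<^bold>\<open>Exact formula.\<close>  Put \<open>\<ell>\<^sub>j = \<lambda>\<^sub>j + N - j\<close> and let \<open>V\<close> be the Vandermonde product.  The alternant
  \<open>det (u\<^sub>i\<^sup>\<ell>\<^sup>j)\<close> is an eigenfunction of \<open>\<Sum>\<^sub>i (u\<^sub>i \<partial>\<^sub>i)\<^sup>k\<close> with eigenvalue \<open>p\<^sub>k = \<Sum>\<^sub>j \<ell>\<^sub>j\<^sup>k\<close>, so a Schur
  function \<open>\<chi>\<close> satisfies \<open>V\<^sup>-\<^sup>1 \<Sum>\<^sub>i (u\<^sub>i \<partial>\<^sub>i)\<^sup>k (V \<chi>) = p\<^sub>k \<chi>\<close>.  With \<open>(u \<partial>)\<^sup>k = \<Sum>\<^sub>m S(k,m) u\<^sup>m \<partial>\<^sup>m\<close> (Stirling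
  numbers) and the Leibniz rule, the left side becomes a combination of the sums
  \<open>\<Sum>\<^sub>i u\<^sub>i\<^sup>m \<partial>\<^sub>i\<^sup>m\<^sup>-\<^sup>s \<chi> / \<Prod>\<^sub>j (u\<^sub>i - u\<^sub>j)\<close>, with \<open>i\<close> in a set \<open>K\<close> of \<open>s + 1\<close> variables and \<open>j\<close> in \<open>K\<close> minus \<open>i\<close>.
  As \<open>\<chi>\<close> is symmetric, such a sum has a limit at \<open>u = 1\<close> that does not depend on \<open>K\<close>; it is the coefficient of
  \<open>t\<^sup>s\<close> of the numerators along a line, and involves only the restriction of \<open>\<chi>\<close> to \<open>s + 1\<close> variables.
  Since there are \<open>N choose (s + 1)\<close> sets \<open>K\<close>, this gives \<open>power_sum_eq_confluent_expansion\<close>.  The limit is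
  computed by polarization: a symmetric Laurent polynomial is a combination of products
  \<open>\<Prod>\<^sub>i g(u\<^sub>i)\<close>, and for a product the sum over \<open>K\<close> is a divided difference of the single function
  \<open>u\<^sup>m g\<^sup>(\<^sup>m\<^sup>-\<^sup>s\<^sup>) / g\<close>.

  \<^bold>\<open>Averaging.\<close>  By the branching rule Schur functions have nonnegative coefficients.  Their
  values on a polyannulus are therefore bounded by the values at its real corners, and a Schur
  generating function that converges pointwise on a polydisc converges normally on a smaller one.
  So the exact formula holds with the generating function in place of \<open>\<chi>\<close> and the expected power
  sum in place of \<open>p\<^sub>k\<close> (\<open>expected_power_sum\<close>).

  \<^bold>\<open>Asymptotics.\<close>  If the generating function is \<open>exp L\<close> with \<open>L = N \<Sum>\<^sub>i \<Psi>(u\<^sub>i) + \<Sum>\<^sub>i \<Phi>(u\<^sub>i) + o(1)\<close>, then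
  uniformly \<open>N\<^sup>-\<^sup>a exp(- L) \<partial>\<^sub>i\<^sup>a exp L = \<Psi>'\<^sup>a + N\<^sup>-\<^sup>1 (a \<Psi>'\<^sup>a\<^sup>-\<^sup>1 \<Phi>' + (a choose 2) \<Psi>'\<^sup>a\<^sup>-\<^sup>2 \<Psi>'') + o(N\<^sup>-\<^sup>1)\<close>
  (\<open>uniform_exp_derivative_expansion\<close>), and the confluent coefficients inherit this expansion
  (\<open>confluent_coeff_asymptotics\<close>).  The term with indices \<open>m\<close> and \<open>s\<close> has order
  \<open>N\<^sup>s\<^sup>+\<^sup>1 N\<^sup>m\<^sup>-\<^sup>s = N\<^sup>m\<^sup>+\<^sup>1\<close>, so only \<open>m = k\<close> and \<open>m = k - 1\<close> count.  The coefficient of \<open>N\<^sup>k\<^sup>+\<^sup>1\<close> is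
  \<open>\<^bold>m\<^sub>k\<close>.  At order \<open>N\<^sup>k\<close> there are three corrections besides the one with \<open>\<Phi>'\<close>: the term
  with \<open>\<Psi>''\<close>, the second coefficient of the binomial \<open>N choose (s + 1)\<close>, and the terms with \<open>m = k - 1\<close>.
  They telescope to the summand \<open>- 1 / (2 x)\<close> (\<open>moment'_identity\<close>).
\<close>

section \<open>Alternants and the branching rule\<close>

definition alternant :: "nat \<Rightarrow> (nat \<Rightarrow> int) \<Rightarrow> (nat \<Rightarrow> complex) \<Rightarrow> complex" where
  "alternant N e u = Determinant.det (mat N N (\<lambda>(i, j). u i powi e j))"

definition vandermonde :: "nat \<Rightarrow> (nat \<Rightarrow> complex) \<Rightarrow> complex" where
  "vandermonde N u = (\<Prod>i<N. \<Prod>j\<in>{i<..<N}. u i - u j)"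

lemma alternant_Leibniz:
  "alternant N e u = (\<Sum>p | p permutes {0..<N}. signof p * (\<Prod>i = 0..<N. u i powi e (p i)))"
proof -
  have "mat N N (\<lambda>(i, j). u i powi e j) \<in> carrier_mat N N" by simp
  from det_def'[OF this] show ?thesis unfolding alternant_def
    by (auto intro!: sum.cong arg_cong2[of _ _ _ _ "(*)"] prod.cong dest: permutes_in_image)
qed

lemma det_columnwise_sum:
  fixes f :: "nat \<Rightarrow> nat \<Rightarrow> 'b \<Rightarrow> 'a :: comm_ring_1"
  assumes "\<And>j. j < n \<Longrightarrow> finite (B j)"
  shows "Determinant.det (mat n n (\<lambda>(i, j). \<Sum>b\<in>B j. f i j b)) =
    (\<Sum>P\<in>PiE {..<n} B. Determinant.det (mat n n (\<lambda>(i, j). f i j (P j))))"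
proof -
  have col: "Determinant.det (mat n n (\<lambda>(i, j). g i j)) =
    (\<Sum>p | p permutes {0..<n}. signof p * (\<Prod>j<n. g (p j) j))" for g :: "nat \<Rightarrow> nat \<Rightarrow> 'a"
    by (subst det_col[of _ n]) (auto intro!: sum.cong arg_cong2[of _ _ _ _ "(*)"] prod.cong dest: permutes_in_image)
  show ?thesis
    unfolding col
    by (subst sum.swap) (intro sum.cong refl, subst prod_sum_PiE, auto simp: assms sum_distrib_left)
qed

lemma det_columnwise_factor:
  fixes f :: "nat \<Rightarrow> nat \<Rightarrow> 'a :: comm_ring_1"
  shows "Determinant.det (mat n n (\<lambda>(i, j). c i * d j * f i j)) =
    (\<Prod>i<n. c i) * (\<Prod>j<n. d j) * Determinant.det (mat n n (\<lambda>(i, j). f i j))"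
proof -
  have *: "Determinant.det (mat n n (\<lambda>(i, j). g i j)) =
    (\<Sum>p | p permutes {0..<n}. signof p * (\<Prod>i = 0..<n. g i (p i)))" for g :: "nat \<Rightarrow> nat \<Rightarrow> 'a"
    by (subst det_def'[of _ n])
      (auto intro!: sum.cong arg_cong2[of _ _ _ _ "(*)"] prod.cong dest: permutes_in_image)
  have "(\<Prod>i = 0..<n. d (p i)) = (\<Prod>j<n. d j)" if "p permutes {0..<n}" for p
    using prod.permute[OF that, of d] by (simp add: comp_def atLeast0LessThan)
  then show ?thesis
    unfolding * sum_distrib_left
    by (intro sum.cong refl) (auto simp: prod.distrib atLeast0LessThan mult_ac)
qed

text \<open>
  Subtracting from each column a multiple of the next one, so as to clear the last row, and
  dividing row \<open>i\<close> by \<open>u i - u n\<close> leaves geometric sums; expanding these gives alternants in one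
  variable less, all with nonnegative coefficients.
\<close>

lemma alternant_branching:
  assumes dec: "\<And>j. j < n \<Longrightarrow> e (Suc j) < e j" and nz: "\<And>i. i \<le> n \<Longrightarrow> u i \<noteq> 0"
  shows "alternant (Suc n) e u = u n powi e n * (\<Prod>i<n. u i - u n) *
    (\<Sum>P\<in>PiE {..<n} (\<lambda>j. {..<nat (e j - e (Suc j))}).
      (\<Prod>j<n. u n ^ (nat (e j - e (Suc j)) - Suc (P j))) * alternant n (\<lambda>j. e (Suc j) + int (P j)) u)"
proof -
  define d where "d j = nat (e j - e (Suc j))" for j
  have ej: "e j = e (Suc j) + int (d j)" if "j < n" for j using dec[OF that] by (simp add: d_def)
  define M where "M = mat (Suc n) (Suc n) (\<lambda>(i, j). u i powi e j)"
  define B where "B = mat (Suc n) (Suc n) (\<lambda>(i, j). if i = j then 1 else if i = Suc j then - (u n ^ d j) else 0)"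
  have cM: "M \<in> carrier_mat (Suc n) (Suc n)" and cB: "B \<in> carrier_mat (Suc n) (Suc n)"
    by (auto simp: M_def B_def)
  have "Determinant.det B = prod_list (diag_mat B)"
    by (rule det_lower_triangular[OF _ cB]) (auto simp: B_def)
  also have "diag_mat B = map (\<lambda>_. 1) [0..<Suc n]"
    unfolding diag_mat_def using cB by (auto simp: B_def)
  also have "prod_list \<dots> = 1" by (simp add: map_replicate_const del: upt_Suc)
  finally have detB: "Determinant.det B = 1" .
  define C where "C = M * B"
  have cC: "C \<in> carrier_mat (Suc n) (Suc n)" using cM cB by (simp add: C_def)
  have C_eq: "C $$ (i, j) = (if j = n then u i powi e n else u i powi e j - u n ^ d j * u i powi e (Suc j))"
    if "i \<le> n" "j \<le> n" for i j
  proof -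
    have "C $$ (i, j) = (\<Sum>k = 0..<Suc n. M $$ (i, k) * B $$ (k, j))"
      using that cM cB unfolding C_def by (simp add: scalar_prod_def)
    also have "\<dots> = (\<Sum>k\<in>{0..<Suc n}. (if k = j then u i powi e j else 0) +
        (if k = Suc j then - (u n ^ d j) * u i powi e (Suc j) else 0))"
      using that by (intro sum.cong refl) (auto simp: M_def B_def)
    also have "\<dots> = u i powi e j + (if j = n then 0 else - (u n ^ d j) * u i powi e (Suc j))"
      using that by (simp add: sum.distrib)
    finally show ?thesis by auto
  qed
  have geo: "u i powi e j - u n ^ d j * u i powi e (Suc j) =
      (u i - u n) * (\<Sum>p<d j. u n ^ (d j - Suc p) * u i powi (e (Suc j) + int p))"
    if "i \<le> n" "j < n" for i j
  proof -
    have ui: "u i \<noteq> 0" using nz that by auto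
    have "u i powi e j = u i powi e (Suc j) * u i ^ d j"
      using ej[OF that(2)] ui by (simp add: power_int_add)
    then have "u i powi e j - u n ^ d j * u i powi e (Suc j) = u i powi e (Suc j) * (u i ^ d j - u n ^ d j)"
      by (simp add: algebra_simps)
    also have "u i ^ d j - u n ^ d j = (u i - u n) * (\<Sum>p<d j. u n ^ (d j - Suc p) * u i ^ p)"
      by (rule power_diff_sumr2)
    finally show ?thesis using ui
      by (simp add: sum_distrib_left power_int_add mult_ac)
  qed
  have "alternant (Suc n) e u = Determinant.det C"
    unfolding alternant_def C_def using det_mult[OF cM cB] detB by (simp add: M_def)
  also have "\<dots> = (\<Sum>j<Suc n. C $$ (n, j) * cofactor C n j)"
    by (rule laplace_expansion_row[OF cC]) simp
  also have "\<dots> = u n powi e n * cofactor C n n"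
  proof -
    have "C $$ (n, j) = 0" if "j < n" for j
      using that C_eq[of n j] geo[of n j] by simp
    then show ?thesis using C_eq[of n n] by simp
  qed
  also have "cofactor C n n = Determinant.det (mat n n (\<lambda>(i, j).
      (u i - u n) * 1 * (\<Sum>p<d j. u n ^ (d j - Suc p) * u i powi (e (Suc j) + int p))))"
  proof -
    have "mat_delete C n n = mat n n (\<lambda>(i, j).
      (u i - u n) * 1 * (\<Sum>p<d j. u n ^ (d j - Suc p) * u i powi (e (Suc j) + int p)))"
      using cC C_eq geo unfolding mat_delete_def by (intro eq_matI) auto
    then show ?thesis unfolding cofactor_def by simp
  qed
  also have "\<dots> = (\<Prod>i<n. u i - u n) * Determinant.det (mat n n (\<lambda>(i, j).
      \<Sum>p<d j. u n ^ (d j - Suc p) * u i powi (e (Suc j) + int p)))"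
    by (subst det_columnwise_factor) simp
  also have "Determinant.det (mat n n (\<lambda>(i, j). \<Sum>p<d j. u n ^ (d j - Suc p) * u i powi (e (Suc j) + int p)))
    = (\<Sum>P\<in>PiE {..<n} (\<lambda>j. {..<d j}). Determinant.det (mat n n (\<lambda>(i, j). 
        1 * u n ^ (d j - Suc (P j)) * u i powi (e (Suc j) + int (P j)))))"
    by (subst det_columnwise_sum) auto
  also have "\<dots> = (\<Sum>P\<in>PiE {..<n} (\<lambda>j. {..<d j}).
      (\<Prod>j<n. u n ^ (d j - Suc (P j))) * alternant n (\<lambda>j. e (Suc j) + int (P j)) u)"
    unfolding alternant_def by (subst det_columnwise_factor) simp
  finally show ?thesis by (simp add: d_def mult_ac)
qed

lemma vandermonde_Suc: "vandermonde (Suc n) u = vandermonde n u * (\<Prod>i<n. u i - u n)"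
proof -
  have "{i<..<Suc n} = insert n {i<..<n}" if "i < n" for i using that by auto
  then have "(\<Prod>j\<in>{i<..<Suc n}. u i - u j) = (\<Prod>j\<in>{i<..<n}. u i - u j) * (u i - u n)" if "i < n" for i
    using that by simp
  moreover have "{n<..<Suc n} = {}" by auto
  ultimately show ?thesis unfolding vandermonde_def by (simp add: prod.distrib)
qed

lemma vandermonde_nonzero: "inj_on u {..<N} \<Longrightarrow> vandermonde N u \<noteq> 0"
  unfolding vandermonde_def by (force simp: inj_on_def)

lemma alternant_staircase:
  assumes "\<And>i. i < N \<Longrightarrow> u i \<noteq> 0"
  shows "alternant N (\<lambda>j. int N - 1 - int j) u = vandermonde N u"
  using assms
proof (induction N)
  case 0
  then show ?case by (simp add: alternant_def vandermonde_def)
next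
  case (Suc n)
  have PiE1: "PiE {..<n} (\<lambda>j. {..<1::nat}) = {\<lambda>j\<in>{..<n}. 0}"
    by (auto simp: PiE_def extensional_def Pi_def fun_eq_iff)
  have "alternant (Suc n) (\<lambda>j. int (Suc n) - 1 - int j) u =
    (\<Prod>i<n. u i - u n) * alternant n (\<lambda>j. int (Suc n) - 1 - int (Suc j) + int ((\<lambda>j\<in>{..<n}. 0) j)) u"
    using PiE1 Suc.prems by (subst alternant_branching) simp_all
  also have "alternant n (\<lambda>j. int (Suc n) - 1 - int (Suc j) + int ((\<lambda>j\<in>{..<n}. 0) j)) u =
      alternant n (\<lambda>j. int n - 1 - int j) u"
    unfolding alternant_def by (intro arg_cong[of _ _ Determinant.det] eq_matI) (auto simp: algebra_simps)
  finally show ?case using Suc by (simp add: vandermonde_Suc mult_ac)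
qed

lemma alternant_permute:
  assumes "\<sigma> permutes {..<N}"
  shows "alternant N e (\<lambda>i. u (\<sigma> i)) = signof \<sigma> * alternant N e u"
proof -
  have "alternant N e (\<lambda>i. u (\<sigma> i)) =
    Determinant.det (mat N N (\<lambda>(i, j). mat N N (\<lambda>(i, j). u i powi e j) $$ (\<sigma> i, j)))"
    unfolding alternant_def using permutes_in_image[OF assms]
    by (intro arg_cong[of _ _ Determinant.det] eq_matI) auto
  also have "\<dots> = signof \<sigma> * alternant N e u"
    unfolding alternant_def by (rule det_permute_rows) (use assms in \<open>auto simp: atLeast0LessThan\<close>)
  finally show ?thesis .
qed

text \<open>
  The Vandermonde product is itself an alternant, so its antisymmetry is that of a determinant.
\<close>

lemma vandermonde_permute:
  assumes "\<sigma> permutes {..<N}" and "\<And>i. i < N \<Longrightarrow> u i \<noteq> 0"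
  shows "vandermonde N (\<lambda>i. u (\<sigma> i)) = signof \<sigma> * vandermonde N u"
  using alternant_permute[OF assms(1), of "\<lambda>j. int N - 1 - int j" u] assms permutes_in_image[OF assms(1)]
  by (simp add: alternant_staircase)

section \<open>Schur functions as positive Laurent polynomials\<close>

text \<open>
  Finite sums of monomials with positive coefficients, as functions.  An inductive predicate
  avoids choosing an index set for the monomials; functions rather than formal polynomials are
  used because only values and derivatives matter.
\<close>

inductive laurent_pos :: "nat \<Rightarrow> ((nat \<Rightarrow> complex) \<Rightarrow> complex) \<Rightarrow> bool" for N where
  monomial: "c > 0 \<Longrightarrow> laurent_pos N (\<lambda>u. of_real c * (\<Prod>i<N. u i powi w i))"
| add: "laurent_pos N f \<Longrightarrow> laurent_pos N g \<Longrightarrow> laurent_pos N (\<lambda>u. f u + g u)"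

lemma laurent_pos_sum:
  assumes "finite I" "I \<noteq> {}" "\<And>i. i \<in> I \<Longrightarrow> laurent_pos N (f i)"
  shows "laurent_pos N (\<lambda>u. \<Sum>i\<in>I. f i u)"
  using assms by (induction I rule: finite_ne_induct) (auto intro: laurent_pos.add)

lemma laurent_pos_scale: "laurent_pos N f \<Longrightarrow> c > 0 \<Longrightarrow> laurent_pos N (\<lambda>u. of_real c * f u)"
proof (induction rule: laurent_pos.induct)
  case (monomial b w)
  then show ?case using laurent_pos.monomial[of "c * b" N w] by (simp add: mult.assoc)
qed (auto simp: distrib_left intro: laurent_pos.add)

lemma laurent_pos_permute:
  assumes "laurent_pos N f" and \<sigma>: "\<sigma> permutes {..<N}"
  shows "laurent_pos N (\<lambda>u. f (\<lambda>i. u (\<sigma> i)))"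
  using assms(1)
proof (induction rule: laurent_pos.induct)
  case (monomial c w)
  have "(\<Prod>i<N. u (\<sigma> i) powi w i) = (\<Prod>i<N. u i powi w (Hilbert_Choice.inv \<sigma> i))" for u :: "nat \<Rightarrow> complex"
    using prod.permute[OF \<sigma>, of "\<lambda>i. u i powi w (Hilbert_Choice.inv \<sigma> i)"] permutes_inverses(2)[OF \<sigma>]
    by (simp add: comp_def)
  then show ?case using laurent_pos.monomial[OF monomial, of N "\<lambda>i. w (Hilbert_Choice.inv \<sigma> i)"] by simp
qed (auto intro: laurent_pos.add)

lemma laurent_pos_Suc:
  "laurent_pos n f \<Longrightarrow> laurent_pos (Suc n) (\<lambda>u. u n powi k * f u)"
proof (induction rule: laurent_pos.induct)
  case (monomial c w)
  have "(\<Prod>i<n. u i powi (w(n := k)) i) = (\<Prod>i<n. u i powi w i)" for u :: "nat \<Rightarrow> complex"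
    by (intro prod.cong) auto
  then show ?case using laurent_pos.monomial[OF monomial, of "Suc n" "w(n := k)"]
    by (simp add: mult_ac)
qed (auto simp: distrib_left intro: laurent_pos.add)

lemma laurent_pos_at_1:
  "laurent_pos N f \<Longrightarrow> \<exists>c>0. f (\<lambda>_. 1) = complex_of_real c"
proof (induction rule: laurent_pos.induct)
  case (add f g)
  then obtain a b where "a > 0" "f (\<lambda>_. 1) = complex_of_real a" "b > 0" "g (\<lambda>_. 1) = complex_of_real b"
    by blast
  then show ?case by (intro exI[of _ "a + b"]) auto
qed auto

text \<open>
  Induction over the number of variables: the exponents produced by the branching rule interlace with
  the given ones and are again strictly decreasing, and the factors \<open>u\<^sub>i - u\<^sub>n\<close> complete the
  Vandermonde product.
\<close>

lemma alternant_eq_vandermonde_mult: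
  assumes "\<And>j. Suc j < N \<Longrightarrow> e (Suc j) < e j"
  shows "\<exists>f. laurent_pos N f \<and>
    (\<forall>u. (\<forall>i<N. u i \<noteq> 0) \<longrightarrow> alternant N e u = vandermonde N u * f u)"
  using assms
proof (induction N arbitrary: e)
  case 0
  show ?case using laurent_pos.monomial[of 1 0 "\<lambda>_. 0"]
    by (intro exI[of _ "\<lambda>_. 1"]) (simp add: alternant_def vandermonde_def)
next
  case (Suc n)
  define d where "d j = nat (e j - e (Suc j))" for j
  define I where "I = PiE {..<n} (\<lambda>j. {..<d j})"
  have d: "d j > 0" if "j < n" for j using Suc.prems that by (simp add: d_def)
  have I: "finite I" "I \<noteq> {}"
    using d by (auto simp: I_def finite_PiE PiE_eq_empty_iff lessThan_empty_iff)
  have "\<exists>f. laurent_pos n f \<and> (\<forall>u. (\<forall>i<n. u i \<noteq> 0) \<longrightarrow>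
      alternant n (\<lambda>j. e (Suc j) + int (P j)) u = vandermonde n u * f u)" if "P \<in> I" for P
  proof (rule Suc.IH)
    fix j assume j: "Suc j < n"
    then have "P (Suc j) < d (Suc j)" using that by (auto simp: I_def PiE_def Pi_def)
    then show "e (Suc (Suc j)) + int (P (Suc j)) < e (Suc j) + int (P j)"
      by (simp add: d_def)
  qed
  then obtain f where f: "\<And>P. P \<in> I \<Longrightarrow> laurent_pos n (f P)"
    "\<And>P u. P \<in> I \<Longrightarrow> (\<And>i. i < n \<Longrightarrow> u i \<noteq> 0) \<Longrightarrow>
      alternant n (\<lambda>j. e (Suc j) + int (P j)) u = vandermonde n u * f P u"
    by metis
  define w where "w P = e n + int (\<Sum>j<n. d j - Suc (P j))" for P
  show ?case
  proof (intro exI conjI allI impI)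
    show "laurent_pos (Suc n) (\<lambda>u. \<Sum>P\<in>I. u n powi w P * f P u)"
      by (intro laurent_pos_sum laurent_pos_Suc I f)
    fix u :: "nat \<Rightarrow> complex" assume u: "\<forall>i<Suc n. u i \<noteq> 0"
    have pw: "u n powi w P = u n powi e n * (\<Prod>j<n. u n ^ (d j - Suc (P j)))" for P
      using u by (simp add: w_def power_int_add power_sum del: of_nat_sum)
    have "alternant (Suc n) e u = u n powi e n * (\<Prod>i<n. u i - u n) *
      (\<Sum>P\<in>I. (\<Prod>j<n. u n ^ (d j - Suc (P j))) * alternant n (\<lambda>j. e (Suc j) + int (P j)) u)"
      unfolding I_def d_def using Suc.prems u by (intro alternant_branching) auto
    also have "(\<Sum>P\<in>I. (\<Prod>j<n. u n ^ (d j - Suc (P j))) * alternant n (\<lambda>j. e (Suc j) + int (P j)) u) =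
      (\<Sum>P\<in>I. (\<Prod>j<n. u n ^ (d j - Suc (P j))) * (vandermonde n u * f P u))"
      using f(2) u by (intro sum.cong refl) auto
    finally show "alternant (Suc n) e u = vandermonde (Suc n) u * (\<Sum>P\<in>I. u n powi w P * f P u)"
      by (simp add: pw vandermonde_Suc sum_distrib_left mult_ac)
  qed
qed

text \<open>
  Ryser's formula for the permanent.  After expanding the products on the right, a map \<open>g\<close> of the
  indices is counted with the alternating sum over the sets \<open>S\<close> that contain its image, which
  vanishes unless \<open>g\<close> is onto.
\<close>

lemma permanent_eq_alternating_sum:
  fixes a :: "nat \<Rightarrow> nat \<Rightarrow> 'a :: comm_ring_1"
  shows "(\<Sum>\<sigma> | \<sigma> permutes {..<N}. \<Prod>i<N. a i (\<sigma> i)) =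
    (\<Sum>S\<in>Pow {..<N}. (-1) ^ (N - card S) * (\<Prod>i<N. \<Sum>j\<in>S. a i j))"
proof -
  define F where "F = PiE {..<N} (\<lambda>_. {..<N})"
  have finF: "finite F" by (simp add: F_def finite_PiE)
  have inner: "(\<Sum>S | S \<in> Pow {..<N} \<and> g \<in> PiE {..<N} (\<lambda>_. S). (-1) ^ (N - card S)) =
      (if g ` {..<N} = {..<N} then 1 else 0 :: 'a)" if "g \<in> F" for g
  proof -
    have sub: "g ` {..<N} \<subseteq> {..<N}" using that by (auto simp: F_def PiE_def Pi_def)
    have "(\<Sum>S | S \<in> Pow {..<N} \<and> g \<in> PiE {..<N} (\<lambda>_. S). (-1) ^ (N - card S)) =
        (\<Sum>T\<in>Pow ({..<N} - g ` {..<N}). (-1 :: 'a) ^ card T)"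
      using sub that
      by (intro sum.reindex_bij_witness[where i = "\<lambda>T. {..<N} - T" and j = "\<lambda>S. {..<N} - S"])
        (auto simp: F_def PiE_def Pi_def card_Diff_subset finite_subset)
    also have "\<dots> = (\<Prod>x\<in>{..<N} - g ` {..<N}. -1 + 1)"
      by (subst prod_add) auto
    also have "\<dots> = (if g ` {..<N} = {..<N} then 1 else 0)"
      using sub by (cases "g ` {..<N} = {..<N}") (auto simp: power_0_left)
    finally show ?thesis .
  qed
  have "(\<Sum>S\<in>Pow {..<N}. (-1) ^ (N - card S) * (\<Prod>i<N. \<Sum>j\<in>S. a i j)) =
    (\<Sum>S\<in>Pow {..<N}. \<Sum>g\<in>PiE {..<N} (\<lambda>_. S). (-1) ^ (N - card S) * (\<Prod>i<N. a i (g i)))"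
    by (intro sum.cong refl, subst prod_sum_PiE) (auto simp: sum_distrib_left finite_subset)
  also have "\<dots> = (\<Sum>S\<in>Pow {..<N}. \<Sum>g\<in>{g \<in> F. g \<in> PiE {..<N} (\<lambda>_. S)}. (-1) ^ (N - card S) * (\<Prod>i<N. a i (g i)))"
    by (intro sum.cong refl) (auto simp: F_def PiE_def Pi_def subset_iff)
  also have "\<dots> = (\<Sum>g\<in>F. \<Sum>S | S \<in> Pow {..<N} \<and> g \<in> PiE {..<N} (\<lambda>_. S). (-1) ^ (N - card S) * (\<Prod>i<N. a i (g i)))"
    by (rule sum.swap_restrict) (auto simp: finF)
  also have "\<dots> = (\<Sum>g\<in>F. (if g ` {..<N} = {..<N} then 1 else 0) * (\<Prod>i<N. a i (g i)))"
    by (intro sum.cong refl) (simp only: sum_distrib_right[symmetric] inner)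
  also have "\<dots> = (\<Sum>g | g \<in> F \<and> g ` {..<N} = {..<N}. \<Prod>i<N. a i (g i))"
    by (simp add: sum.inter_filter[OF finF] if_distrib[of "\<lambda>x. x * _"] cong: if_cong)
  also have "\<dots> = (\<Sum>\<sigma> | \<sigma> permutes {..<N}. \<Prod>i<N. a i (\<sigma> i))"
  proof (rule sum.reindex_bij_witness[where j = "\<lambda>g i. if i < N then g i else i" and i = "\<lambda>\<sigma>. restrict \<sigma> {..<N}"])
    fix g assume g: "g \<in> {g \<in> F. g ` {..<N} = {..<N}}"
    then show "restrict (\<lambda>i. if i < N then g i else i) {..<N} = g"
      by (auto simp: F_def PiE_def extensional_def fun_eq_iff)
    have "inj_on g {..<N}" using g by (intro eq_card_imp_inj_on) auto
    then have "bij_betw g {..<N} {..<N}" using g by (auto simp: bij_betw_def)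
    then have "bij_betw (\<lambda>i. if i < N then g i else i) {..<N} {..<N}"
      by (rule bij_betw_cong[THEN iffD1, rotated]) auto
    then show "(\<lambda>i. if i < N then g i else i) \<in> {\<sigma>. \<sigma> permutes {..<N}}"
      unfolding mem_Collect_eq by (rule bij_imp_permutes) (simp split: if_splits)
  next
    fix \<sigma> assume s: "\<sigma> \<in> {\<sigma>. \<sigma> permutes {..<N}}"
    then show "(\<lambda>i. if i < N then restrict \<sigma> {..<N} i else i) = \<sigma>"
      by (auto simp: fun_eq_iff permutes_def)
    show "restrict \<sigma> {..<N} \<in> {g \<in> F. g ` {..<N} = {..<N}}"
      using s permutes_image[of \<sigma> "{..<N}"] permutes_in_image[of \<sigma> "{..<N}"] by (auto simp: F_def)
  qed auto
  finally show ?thesis by simp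
qed

text \<open>
  The linear span of the products \<open>\<Prod>\<^sub>i g(u\<^sub>i)\<close>.  Only \<open>g\<close> that are sums of monomials over a nonempty set
  are admitted: they do not vanish at \<open>1\<close>, and quotients by \<open>g\<close> can be formed near \<open>1\<close>.
\<close>

inductive product_span :: "nat \<Rightarrow> ((nat \<Rightarrow> complex) \<Rightarrow> complex) \<Rightarrow> bool" for N where
  product: "finite (S :: nat set) \<Longrightarrow> S \<noteq> {} \<Longrightarrow> product_span N (\<lambda>u. c * (\<Prod>i<N. \<Sum>j\<in>S. u i powi (w j :: int)))"
| add: "product_span N f \<Longrightarrow> product_span N g \<Longrightarrow> product_span N (\<lambda>u. f u + g u)"

lemma product_span_sum:
  assumes "finite I" "I \<noteq> {}" "\<And>i. i \<in> I \<Longrightarrow> product_span N (f i)"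
  shows "product_span N (\<lambda>u. \<Sum>i\<in>I. f i u)"
  using assms by (induction I rule: finite_ne_induct) (auto intro: product_span.add)

lemma product_span_scale: "product_span N f \<Longrightarrow> product_span N (\<lambda>u. c * f u)"
proof (induction rule: product_span.induct)
  case (product S b w)
  then show ?case using product_span.product[of S N "c * b" w] by (simp add: mult.assoc)
qed (auto simp: distrib_left intro: product_span.add)

text \<open>
  Symmetrizing a monomial gives a permanent, which Ryser's formula writes as a combination of
  products with the same function in every variable.
\<close>

lemma product_span_symmetrization:
  assumes "laurent_pos N f" "N \<ge> 1"
  shows "product_span N (\<lambda>u. \<Sum>\<sigma> | \<sigma> permutes {..<N}. f (\<lambda>i. u (\<sigma> i)))"
  using assms(1)
proof (induction rule: laurent_pos.induct)
  case (monomial c w)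
  define A where "A = Pow {..<N} - {{}}"
  have A: "finite A" "A \<noteq> {}" using assms(2) by (auto simp: A_def)
  have "(\<Sum>\<sigma> | \<sigma> permutes {..<N}. \<Prod>i<N. u (\<sigma> i) powi w i) =
      (\<Sum>\<sigma> | \<sigma> permutes {..<N}. \<Prod>i<N. u i powi w (\<sigma> i))" for u :: "nat \<Rightarrow> complex"
  proof -
    have "(\<Prod>i<N. u (Hilbert_Choice.inv \<sigma> i) powi w i) = (\<Prod>i<N. u i powi w (\<sigma> i))" if "\<sigma> permutes {..<N}" for \<sigma>
      using prod.permute[OF that, of "\<lambda>i. u (Hilbert_Choice.inv \<sigma> i) powi w i"] permutes_inverses(2)[OF that]
      by (simp add: comp_def)
    then show ?thesis by (subst sum_permutations_inverse) simp
  qed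
  also have "\<dots> u = (\<Sum>S\<in>A. (-1) ^ (N - card S) * (\<Prod>i<N. \<Sum>j\<in>S. u i powi w j))" for u :: "nat \<Rightarrow> complex"
    unfolding permanent_eq_alternating_sum[where N = N and a = "\<lambda>i j. u i powi w j"] A_def
    by (subst sum.remove[of "Pow {..<N}" "{}"]) (use assms(2) in \<open>auto simp: power_0_left\<close>)
  finally have "(\<lambda>u. \<Sum>\<sigma> | \<sigma> permutes {..<N}. complex_of_real c * (\<Prod>i<N. u (\<sigma> i) powi w i)) =
      (\<lambda>u. complex_of_real c * (\<Sum>S\<in>A. (-1) ^ (N - card S) * (\<Prod>i<N. \<Sum>j\<in>S. u i powi w j)))"
    by (simp only: sum_distrib_left[symmetric])
  moreover have "product_span N (\<lambda>u. complex_of_real c * (\<Sum>S\<in>A. (-1) ^ (N - card S) * (\<Prod>i<N. \<Sum>j\<in>S. u i powi w j)))"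
    using A by (intro product_span_scale product_span_sum product_span.product)
      (auto simp: A_def finite_subset)
  ultimately show ?case by simp
qed (auto simp: sum.distrib intro: product_span.add)

text \<open>
  The branching rule yields a positive Laurent polynomial \<open>f\<close> with the required quotient property.
  Its average over all permutations of the variables has the same property, since the alternant and
  the Vandermonde product change sign together, and is in addition visibly a combination of products.
\<close>

lemma schur_laurent_exists:
  assumes dec: "\<And>j. Suc j < N \<Longrightarrow> e (Suc j) < e j" and "N \<ge> 1"
  shows "\<exists>f. laurent_pos N f \<and> product_span N f \<and>
    (\<forall>u. (\<forall>i<N. u i \<noteq> 0) \<longrightarrow> alternant N e u = vandermonde N u * f u)"
proof -
  obtain f where f: "laurent_pos N f"
    "\<And>u. (\<And>i. i < N \<Longrightarrow> u i \<noteq> 0) \<Longrightarrow> alternant N e u = vandermonde N u * f u"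
    using alternant_eq_vandermonde_mult[of N e] dec by blast
  define P where "P = {\<sigma>. \<sigma> permutes {..<N}}"
  define F where "F u = of_real (1 / fact N) * (\<Sum>\<sigma>\<in>P. f (\<lambda>i. u (\<sigma> i)))" for u
  have P: "finite P" "P \<noteq> {}" "card P = fact N"
    using permutes_id[of "{..<N}"] unfolding P_def
    by (simp_all add: finite_permutations card_permutations, blast)
  show ?thesis
  proof (intro exI conjI allI impI)
    have "laurent_pos N (\<lambda>u. f (\<lambda>i. u (\<sigma> i)))" if "\<sigma> \<in> P" for \<sigma>
      using laurent_pos_permute[OF f(1)] that by (simp add: P_def)
    then show "laurent_pos N F" unfolding F_def using P
      by (intro laurent_pos_scale laurent_pos_sum) simp_all
    show "product_span N F" unfolding F_def P_def
      by (intro product_span_scale product_span_symmetrization f assms)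
    fix u :: "nat \<Rightarrow> complex" assume u: "\<forall>i<N. u i \<noteq> 0"
    have "vandermonde N u * f (\<lambda>i. u (\<sigma> i)) = alternant N e u" if "\<sigma> \<in> P" for \<sigma>
    proof -
      have s: "\<sigma> permutes {..<N}" using that by (simp add: P_def)
      have "alternant N e (\<lambda>i. u (\<sigma> i)) = vandermonde N (\<lambda>i. u (\<sigma> i)) * f (\<lambda>i. u (\<sigma> i))"
        using u permutes_in_image[OF s] by (intro f) auto
      then show ?thesis
        using u unfolding alternant_permute[OF s, of e u]
        by (subst (asm) vandermonde_permute[OF s, of u]) (auto simp: sign_def split: if_splits)
    qed
    then have "(\<Sum>\<sigma>\<in>P. vandermonde N u * f (\<lambda>i. u (\<sigma> i))) = (\<Sum>\<sigma>\<in>P. alternant N e u)"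
      by (rule sum.cong[OF refl])
    also have "\<dots> = fact N * alternant N e u"
      using P(3) by simp
    finally have "vandermonde N u * (\<Sum>\<sigma>\<in>P. f (\<lambda>i. u (\<sigma> i))) = fact N * alternant N e u"
      by (simp only: sum_distrib_left)
    then show "alternant N e u = vandermonde N u * F u"
      unfolding F_def by (simp add: mult.left_commute)
  qed
qed

section \<open>Values at confluent points and domination of the series\<close>

lemma has_sum_sum:
  fixes f :: "'i \<Rightarrow> 'a \<Rightarrow> 'b :: topological_comm_monoid_add"
  assumes "finite I" "\<And>i. i \<in> I \<Longrightarrow> (f i has_sum s i) A"
  shows "((\<lambda>x. \<Sum>i\<in>I. f i x) has_sum (\<Sum>i\<in>I. s i)) A"
  using assms by (induction I rule: finite_induct) (auto intro: has_sum_add)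

lemma tendsto_coordinate:
  "((\<lambda>v :: nat \<Rightarrow> complex. v i) \<longlongrightarrow> u i) (at u within S)"
proof -
  have "continuous_on UNIV (\<lambda>v :: nat \<Rightarrow> complex. v i)"
    by (rule continuous_on_product_coordinates)
  then have "((\<lambda>v :: nat \<Rightarrow> complex. v i) \<longlongrightarrow> u i) (at u)"
    by (simp add: continuous_on_def)
  then show ?thesis by (rule tendsto_within_subset) simp
qed

lemma laurent_pos_tendsto:
  assumes "laurent_pos N f" "\<And>i. i < N \<Longrightarrow> u i \<noteq> 0"
  shows "(f \<longlongrightarrow> f u) (at u within S)"
  using assms(1)
proof (induction rule: laurent_pos.induct)
  case (monomial c w)
  have "((\<lambda>v :: nat \<Rightarrow> complex. v i) \<longlongrightarrow> u i) (at u within S)" for i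
    by (rule tendsto_coordinate)
  then show ?case using assms(2)
    by (intro tendsto_intros) auto
qed (intro tendsto_intros)

text \<open>
  The limit that defines a Schur function at a confluent point is taken through points with distinct
  coordinates; perturbing the coordinates at different speeds shows that there are enough of them.
\<close>

lemma distinct_points_limit: "at (u :: nat \<Rightarrow> complex) within {v. inj_on v {..<N}} \<noteq> bot"
proof -
  define g where "g t = (\<lambda>i. u i + of_real t * of_nat (Suc i))" for t :: real
  have ne: "\<forall>\<^sub>F t in at_right 0. complex_of_real t \<noteq> c" for c
  proof (cases "c = 0")
    case True
    then show ?thesis by (auto simp: eventually_at_filter)
  next
    case False
    have "((\<lambda>t. complex_of_real t) \<longlongrightarrow> 0) (at_right 0)" by (auto intro!: tendsto_eq_intros)
    then show ?thesis using tendsto_imp_eventually_ne False by metis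
  qed
  \<comment> \<open>each pair of coordinates agrees for at most one value of \<open>t\<close>\<close>
  have "\<forall>\<^sub>F t in at_right 0. \<forall>i\<in>{..<N}. \<forall>j\<in>{..<N}. complex_of_real t \<noteq> (u i - u j) / (of_nat j - of_nat i)"
    by (intro eventually_ball_finite ballI ne) auto
  then have inj: "\<forall>\<^sub>F t in at_right 0. inj_on (g t) {..<N}"
  proof eventually_elim
    case (elim t)
    show ?case
    proof (rule inj_onI, rule ccontr)
      fix i j assume ij: "i \<in> {..<N}" "j \<in> {..<N}" "g t i = g t j" "i \<noteq> j"
      then have "complex_of_real t * (of_nat j - of_nat i) = u i - u j"
        by (simp add: g_def algebra_simps)
      then have "complex_of_real t = (u i - u j) / (of_nat j - of_nat i)"
        using ij(4) by (simp add: field_simps)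
      then show False using elim ij by blast
    qed
  qed
  have "continuous_on UNIV g"
    unfolding g_def by (intro continuous_on_coordinatewise_then_product continuous_intros)
  moreover have "g 0 = u" by (simp add: g_def)
  ultimately have "(g \<longlongrightarrow> u) (at_right 0)"
    by (auto simp: continuous_on_def intro: tendsto_within_subset)
  moreover have "\<forall>\<^sub>F t in at_right 0. g t \<noteq> u"
  proof -
    have "g t \<noteq> u" if "t > 0" for t
    proof
      assume "g t = u"
      from fun_cong[OF this, of 0] show False using that by (simp add: g_def)
    qed
    then show ?thesis by (auto simp: eventually_at_filter)
  qed
  ultimately have "filterlim g (at u within {v. inj_on v {..<N}}) (at_right 0)"
    using inj by (auto simp: filterlim_at elim: eventually_elim2)
  then show ?thesis
    using trivial_limit_at_right_real[of "0 :: real"] le_bot filtermap_bot_iff[of g]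
    unfolding filterlim_def by metis
qed

definition schur_exponent :: "int list \<Rightarrow> nat \<Rightarrow> int" where
  "schur_exponent l j = l ! j + int (length l) - 1 - int j"

lemma schur_exponent_decreasing:
  assumes "l \<in> signatures N" "Suc j < N"
  shows "schur_exponent l (Suc j) < schur_exponent l j"
proof -
  have "l ! j \<ge> l ! Suc j"
    using assms by (auto simp: signatures_def sorted_wrt_iff_nth_less)
  then show ?thesis by (simp add: schur_exponent_def)
qed

lemma schur_laurent:
  assumes l: "l \<in> signatures N" and "N \<ge> 1"
  shows "\<exists>f. laurent_pos N f \<and> product_span N f \<and>
    (\<forall>u. (\<forall>i<N. u i \<noteq> 0) \<longrightarrow>
      alternant N (schur_exponent l) u = vandermonde N u * f u \<and> schur l u = f u)"
proof -
  obtain f where f: "laurent_pos N f" "product_span N f"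
    and alt: "\<And>u. (\<And>i. i < N \<Longrightarrow> u i \<noteq> 0) \<Longrightarrow> alternant N (schur_exponent l) u = vandermonde N u * f u"
    using schur_laurent_exists[of N "schur_exponent l"] schur_exponent_decreasing[OF l] assms(2) by blast
  have len: "length l = N" using l by (simp add: signatures_def)
  have "schur l u = f u" if u: "\<And>i. i < N \<Longrightarrow> u i \<noteq> 0" for u
  proof -
    define D where "D = {v :: nat \<Rightarrow> complex. inj_on v {..<N}}"
    have "\<forall>\<^sub>F v in at u within D. v i \<noteq> 0" if "i < N" for i
      using tendsto_coordinate[of i u D] u[OF that] by (rule tendsto_imp_eventually_ne)
    then have "\<forall>\<^sub>F v in at u within D. \<forall>i\<in>{..<N}. v i \<noteq> 0"
      by (intro eventually_ball_finite ballI) auto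
    moreover have "\<forall>\<^sub>F v in at u within D. v \<in> D"
      by (simp add: eventually_at_filter)
    ultimately have "\<forall>\<^sub>F v in at u within D. f v = schur_ratio l v"
    proof eventually_elim
      case (elim v)
      have "schur_ratio l v = alternant N (schur_exponent l) v / vandermonde N v"
        by (simp add: schur_ratio_def alternant_def vandermonde_def schur_exponent_def len)
      then show ?case using elim alt[of v] vandermonde_nonzero[of v N] by (simp add: D_def)
    qed
    moreover have "(f \<longlongrightarrow> f u) (at u within D)"
      using f(1) u by (rule laurent_pos_tendsto)
    ultimately have "(schur_ratio l \<longlongrightarrow> f u) (at u within D)"
      by (simp add: tendsto_cong)
    then show ?thesis
      unfolding schur_def len D_def[symmetric]
      using distinct_points_limit[of u N] by (intro tendsto_Lim) (simp_all add: D_def)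
  qed
  then show ?thesis using f alt by blast
qed

lemma power_int_le_sum:
  fixes a R :: real
  assumes "1 \<le> R" "1 / R \<le> a" "a \<le> R"
  shows "a powi w \<le> R powi w + (1 / R) powi w"
proof -
  have pos: "R > 0" "a > 0" using assms by (auto intro: less_le_trans[of 0 "1 / R"])
  show ?thesis
  proof (cases "w \<ge> 0")
    case True
    then have "a powi w \<le> R powi w" using pos assms by (simp add: power_int_def power_mono)
    then show ?thesis using pos by (simp add: add_increasing2)
  next
    case False
    have "inverse a \<le> R" using assms(2) pos by (simp add: field_simps)
    then have "a powi w \<le> (1 / R) powi w"
      using False pos assms by (simp add: power_int_def power_mono inverse_eq_divide)
    then show ?thesis using pos by (simp add: add_increasing)
  qed
qed

text \<open>
  A monomial of modulus \<open>\<bar>u\<^sub>i\<bar>\<^sup>w\<close> is at most \<open>R\<^sup>w + R\<^sup>-\<^sup>w\<close>.  Multiplying out the product of these sums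
  over the variables gives the values of the monomial at the real corners, and positivity of the
  coefficients allows adding the bounds without loss.
\<close>

lemma laurent_pos_norm_le:
  assumes "laurent_pos N f" "r \<le> N" "1 \<le> R"
    and u: "\<And>i. i < r \<Longrightarrow> 1 / R \<le> norm (u i) \<and> norm (u i) \<le> R" "\<And>i. i \<ge> r \<Longrightarrow> u i = 1"
  shows "norm (f u) \<le> Re (\<Sum>S\<in>Pow {..<r}. f (\<lambda>i. if i \<in> S then of_real R else if i < r then of_real (1 / R) else 1))"
  using assms(1)
proof (induction rule: laurent_pos.induct)
  case (monomial c w)
  have restr: "(\<Prod>i<N. v i powi w i) = (\<Prod>i<r. v i powi w i)" if "\<And>i. i \<ge> r \<Longrightarrow> v i = 1" for v :: "nat \<Rightarrow> complex"
    using that assms(2) by (intro prod.mono_neutral_right) auto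
  have "norm (of_real c * (\<Prod>i<N. u i powi w i)) = c * (\<Prod>i<r. norm (u i) powi w i)"
    using monomial by (simp add: restr u(2) norm_mult prod_norm[symmetric] norm_power_int)
  also have "\<dots> \<le> c * (\<Prod>i<r. R powi w i + (1 / R) powi w i)"
    using monomial u(1) assms(3) by (intro mult_left_mono prod_mono conjI power_int_le_sum) auto
  also have "\<dots> = (\<Sum>S\<in>Pow {..<r}. c * (\<Prod>i<r. (if i \<in> S then R else 1 / R) powi w i))"
  proof -
    have "(\<Prod>i<r. (if i \<in> S then R else 1 / R) powi w i) =
        (\<Prod>i\<in>S. R powi w i) * (\<Prod>i\<in>{..<r} - S. (1 / R) powi w i)" if "S \<in> Pow {..<r}" for S
      using that by (subst prod.subset_diff[of S "{..<r}"]) (auto simp: mult.commute)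
    then show ?thesis by (simp add: prod_add sum_distrib_left)
  qed
  also have "\<dots> = Re (\<Sum>S\<in>Pow {..<r}. of_real c *
      (\<Prod>i<N. (if i \<in> S then of_real R else if i < r then of_real (1 / R) else 1) powi w i))"
  proof -
    have "of_real c * (\<Prod>i<N. (if i \<in> S then of_real R else if i < r then of_real (1 / R) else 1) powi w i)
        = complex_of_real (c * (\<Prod>i<r. (if i \<in> S then R else 1 / R) powi w i))" if "S \<in> Pow {..<r}" for S
      using that by (subst restr) (auto simp: of_real_prod of_real_power_int intro!: prod.cong)
    then show ?thesis by (simp only: Re_sum Re_complex_of_real cong: sum.cong)
  qed
  finally show ?case .
next
  case (add f g)
  then show ?case
    using norm_triangle_ineq[of "f u" "g u"] by (simp add: sum.distrib)
qed

text \<open>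
  The radius \<open>e / (2 + e)\<close> is \<open>1 - 1 / R\<close> for \<open>R = 1 + e / 2\<close>: the smaller polydisc lies in the
  polyannulus of radii \<open>1 / R\<close> and \<open>R\<close>, whose real corners lie in the given polydisc.  It does not
  depend on the measure, hence not on \<open>N\<close> in the application.
\<close>

lemma sgf_term_dominated:
  assumes "r \<le> N" "N \<ge> 1" "e > 0"
    and summ: "\<And>u. u \<in> polydisc1 r e \<Longrightarrow> sgf_term p u summable_on signatures N"
  shows "\<exists>M. M summable_on signatures N \<and>
    (\<forall>l\<in>signatures N. \<forall>u\<in>polydisc1 r (e / (2 + e)). norm (sgf_term p u l) \<le> M l)"
proof -
  define R where "R = 1 + e / 2"
  define v where "v S = (\<lambda>i. if i \<in> S then of_real R else if i < r then of_real (1 / R) else 1 :: complex)" for S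
  have R: "R > 1" "1 - 1 / R = e / (2 + e)" "e / (2 + e) < 1" "R - 1 < e" "e / (2 + e) < e"
    using assms(3) by (auto simp: R_def field_simps add_pos_pos)
  have v: "v S \<in> polydisc1 r e" if "S \<in> Pow {..<r}" for S
  proof -
    have "dist (complex_of_real R) 1 < e" "dist (complex_of_real (1 / R)) 1 < e"
    proof -
      have "dist (complex_of_real a) 1 = \<bar>a - 1\<bar>" for a
        by (metis dist_of_real dist_real_def of_real_1)
      then show "dist (complex_of_real R) 1 < e" "dist (complex_of_real (1 / R)) 1 < e"
        using R by (auto simp: abs_if simp del: of_real_divide)
    qed
    then show ?thesis using that by (auto simp: polydisc1_def v_def)
  qed
  define M where "M l = (\<Sum>S\<in>Pow {..<r}. norm (sgf_term p (v S) l))" for l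
  show ?thesis
  proof (intro exI conjI ballI)
    have "(\<lambda>l. norm (sgf_term p (v S) l)) summable_on signatures N" if "S \<in> Pow {..<r}" for S
      using summ[OF v[OF that]] by (simp add: summable_on_iff_abs_summable_on_complex)
    then show "M summable_on signatures N"
      unfolding M_def by (intro has_sum_imp_summable[OF has_sum_sum[OF _ has_sum_infsum]]) auto
    fix l u assume l: "l \<in> signatures N" and u: "u \<in> polydisc1 r (e / (2 + e))"
    obtain f where f: "laurent_pos N f" "\<And>u. (\<And>i. i < N \<Longrightarrow> u i \<noteq> 0) \<Longrightarrow> schur l u = f u"
      using schur_laurent[OF l assms(2)] by metis
    have nu: "1 / R \<le> norm (u i) \<and> norm (u i) \<le> R" if "i < r" for i
    proof -
      have "dist (u i) 1 < 1 - 1 / R" using u that R by (auto simp: polydisc1_def)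
      then have a: "norm (u i - 1) < 1 - 1 / R" by (simp add: dist_norm)
      have "(R - 1) / R \<le> R - 1" using R(1) by (simp add: divide_le_eq)
      then have "1 - 1 / R \<le> R - 1" using R(1) by (simp add: diff_divide_distrib)
      then show ?thesis
        using a norm_triangle_ineq2[of 1 "1 - u i"] norm_triangle_ineq2[of "u i" 1]
          norm_minus_commute[of 1 "u i"] by auto
    qed
    have u1: "u i = 1" if "i \<ge> r" for i using u that by (simp add: polydisc1_def)
    have unz: "u i \<noteq> 0" for i using nu[of i] u1[of i] R(1)
      by (cases "i < r") (auto simp: divide_le_eq)
    have vnz: "v S i \<noteq> 0" for S i using R(1) by (auto simp: v_def)
    have "norm (schur l u) \<le> Re (\<Sum>S\<in>Pow {..<r}. schur l (v S))"
      using laurent_pos_norm_le[OF f(1) assms(1) _ nu u1] R(1) f(2)[OF unz] f(2)[OF vnz]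
      by (simp add: v_def)
    also have "\<dots> \<le> (\<Sum>S\<in>Pow {..<r}. norm (schur l (v S)))"
      by (intro order_trans[OF complex_Re_le_cmod] norm_sum)
    finally have "norm (schur l u) \<le> (\<Sum>S\<in>Pow {..<r}. norm (schur l (v S)))" .
    then have "pmf p l / norm (schur l (\<lambda>_. 1)) * norm (schur l u) \<le>
        pmf p l / norm (schur l (\<lambda>_. 1)) * (\<Sum>S\<in>Pow {..<r}. norm (schur l (v S)))"
      by (intro mult_left_mono) auto
    then show "norm (sgf_term p u l) \<le> M l"
      by (simp add: sgf_term_def M_def norm_mult norm_divide sum_distrib_left)
  qed
qed

section \<open>Divided differences at equally spaced nodes\<close>

text \<open>
  This is the leading coefficient in Lagrange interpolation of \<open>x\<^sup>q\<close> at the nodes: the difference of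
  the interpolation polynomial and \<open>x\<^sup>q\<close> has degree at most \<open>s\<close> and \<open>s + 1\<close> roots, so it is \<open>0\<close>.
\<close>

lemma lagrange_power_sum:
  fixes c :: "'i \<Rightarrow> complex"
  assumes K: "finite K" "card K = Suc s" and inj: "inj_on c K" and q: "q \<le> s"
  shows "(\<Sum>i\<in>K. c i ^ q / (\<Prod>j\<in>K - {i}. c i - c j)) = (if q = s then 1 else 0)"
proof -
  define L where "L i = (\<Prod>j\<in>K - {i}. [:- c j, 1:])" for i
  define b where "b i = c i ^ q / (\<Prod>j\<in>K - {i}. c i - c j)" for i
  define P where "P = (\<Sum>i\<in>K. Polynomial.smult (b i) (L i)) - Polynomial.monom 1 q"
  have card: "card (K - {i}) = s" if "i \<in> K" for i using K that by simp
  have degL: "Polynomial.degree (L i) = s" if "i \<in> K" for i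
    using card[OF that] unfolding L_def by (subst degree_prod_eq_sum_degree) auto
  have coeffL: "Polynomial.coeff (L i) s = 1" if "i \<in> K" for i
  proof -
    have "lead_coeff (L i) = 1" unfolding L_def by (simp add: lead_coeff_prod)
    then show ?thesis using degL[OF that] by simp
  qed
  have root: "poly P (c k) = 0" if k: "k \<in> K" for k
  proof -
    have "poly (L i) (c k) = 0" if "i \<in> K" "i \<noteq> k" for i
      using that k K unfolding L_def by (auto simp: poly_prod intro!: prod_zero)
    then have "poly (\<Sum>i\<in>K. Polynomial.smult (b i) (L i)) (c k) = b k * poly (L k) (c k)"
      using K k by (simp add: poly_sum sum.remove[of K k])
    also have "poly (L k) (c k) = (\<Prod>j\<in>K - {k}. c k - c j)"
      unfolding L_def by (simp add: poly_prod)
    also have "b k * \<dots> = c k ^ q"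
    proof -
      have "(\<Prod>j\<in>K - {k}. c k - c j) \<noteq> 0"
        using K inj k by (auto simp: prod_zero_iff inj_on_def)
      then show ?thesis by (simp add: b_def)
    qed
    finally show ?thesis by (simp add: P_def poly_monom)
  qed
  have degP: "Polynomial.degree P \<le> s"
    unfolding P_def using q degL
    by (intro degree_diff_le degree_sum_le order_trans[OF degree_smult_le] order_trans[OF degree_monom_le] K) auto
  have "P = 0"
  proof (rule ccontr)
    assume "P \<noteq> 0"
    then have "card {x. poly P x = 0} \<le> Polynomial.degree P" "finite {x. poly P x = 0}"
      by (rule card_poly_roots_bound, rule poly_roots_finite)
    moreover have "c ` K \<subseteq> {x. poly P x = 0}" using root by auto
    ultimately have "card (c ` K) \<le> s" using degP card_mono by (meson le_trans)
    then show False using card_image[OF inj] K by simp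
  qed
  then have "Polynomial.coeff P s = 0" by simp
  then show ?thesis unfolding P_def using coeffL
    by (simp add: coeff_sum b_def cong: sum.cong split: if_splits)
qed

text \<open>
  The divided difference of \<open>h\<close> at the nodes \<open>1 + i t\<close> with \<open>i\<close> in \<open>K\<close>, multiplied by \<open>t\<^sup>s\<close>, where
  \<open>K\<close> has \<open>s + 1\<close> elements.
\<close>

definition node_sum :: "nat set \<Rightarrow> (complex \<Rightarrow> complex) \<Rightarrow> complex \<Rightarrow> complex" where
  "node_sum K h t = (\<Sum>i\<in>K. h (1 + t * of_nat i) / (\<Prod>j\<in>K - {i}. of_nat i - of_nat j))"

lemma node_in_ball:
  assumes "t \<in> ball 0 d" "i \<le> n" "d * real n \<le> \<rho>" "\<rho> > 0"
  shows "1 + t * of_nat i \<in> ball (1 :: complex) \<rho>"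
proof (cases "i = 0")
  case False
  have "norm t * real i < d * real i" using assms False by (simp add: dist_norm)
  also have "d * real i \<le> d * real n"
    using assms(1,2) le_less_trans[OF norm_ge_zero[of t], of d] by (intro mult_left_mono) (auto simp: dist_norm)
  finally show ?thesis using assms(3) by (simp add: dist_norm norm_mult)
qed (use assms in simp)

lemma node_holomorphic:
  assumes h: "h holomorphic_on ball 1 \<rho>" and "i \<le> n" "d * real n \<le> \<rho>" "\<rho> > 0"
  shows "(\<lambda>t. h (1 + t * of_nat i)) holomorphic_on ball 0 d"
proof -
  have "(h \<circ> (\<lambda>t. 1 + t * of_nat i)) holomorphic_on ball 0 d"
    using node_in_ball[OF _ assms(2-4)]
    by (intro holomorphic_on_compose_gen[OF _ h] holomorphic_intros) auto
  then show ?thesis by (simp add: comp_def)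
qed

lemma node_sum_holomorphic:
  assumes h: "h holomorphic_on ball 1 \<rho>" and "K \<subseteq> {..n}" "d * real n \<le> \<rho>" "\<rho> > 0"
  shows "node_sum K h holomorphic_on ball 0 d"
  unfolding node_sum_def using assms(2)
  by (intro holomorphic_on_sum holomorphic_on_divide node_holomorphic[OF h _ assms(3,4)] holomorphic_intros)
    (auto dest: finite_subset[OF assms(2)])

lemma higher_deriv_sum:
  assumes "finite K" "\<And>i. i \<in> K \<Longrightarrow> f i holomorphic_on S" "open S" "z \<in> S"
  shows "(deriv ^^ n) (\<lambda>w. \<Sum>i\<in>K. f i w) z = (\<Sum>i\<in>K. (deriv ^^ n) (f i) z)"
  using assms(1,2)
proof (induction K rule: finite_induct)
  case empty
  then show ?case using higher_deriv_const[of n "0 :: complex"] by (simp add: fun_eq_iff)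
next
  case (insert i K)
  then show ?case
    by (simp add: higher_deriv_add[OF _ _ assms(3,4)] holomorphic_on_sum)
qed

lemma higher_deriv_node:
  assumes h: "h holomorphic_on ball 1 \<rho>" and "\<rho> > 0"
  shows "(deriv ^^ q) (\<lambda>t. h (1 + t * of_nat i)) 0 = of_nat i ^ q * (deriv ^^ q) h 1"
  using higher_deriv_compose_linear'[of h "ball 1 \<rho>" "ball 0 (\<rho> / (real i + 1))" 0 "of_nat i" 1 q] assms
    node_in_ball[of _ "\<rho> / (real i + 1)" i i \<rho>]
  by (simp add: add.commute mult.commute field_simps)

lemma node_sum_deriv:
  assumes h: "h holomorphic_on ball 1 \<rho>" and "\<rho> > 0" and K: "finite K" "card K = Suc s" and "q \<le> s"
  shows "(deriv ^^ q) (node_sum K h) 0 = (if q = s then (deriv ^^ s) h 1 else 0)"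
proof -
  define n where "n = Max K"
  define d where "d = \<rho> / (real n + 1)"
  have d: "d > 0" "d * real n \<le> \<rho>" using assms by (auto simp: d_def field_simps)
  have hol: "(\<lambda>t. h (1 + t * of_nat i)) holomorphic_on ball 0 d" if "i \<in> K" for i
    by (rule node_holomorphic[OF h _ d(2) assms(2)]) (use K that in \<open>simp add: n_def\<close>)
  define p where "p i = (\<Prod>j\<in>K - {i}. complex_of_nat i - of_nat j)" for i
  have "(deriv ^^ q) (node_sum K h) 0 = (\<Sum>i\<in>K. (deriv ^^ q) (\<lambda>t. inverse (p i) * h (1 + t * of_nat i)) 0)"
    unfolding node_sum_def p_def[symmetric] divide_inverse mult.commute[of "h _"]
    by (rule higher_deriv_sum[where S = "ball 0 d"]) (use hol d K in \<open>auto intro!: holomorphic_intros\<close>)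
  also have "\<dots> = (\<Sum>i\<in>K. inverse (p i) * (of_nat i ^ q * (deriv ^^ q) h 1))"
    by (intro sum.cong refl, subst higher_deriv_cmult[where A = "ball 0 d"])
      (use hol d higher_deriv_node[OF h assms(2)] in auto)
  also have "\<dots> = (\<Sum>i\<in>K. of_nat i ^ q / p i) * (deriv ^^ q) h 1"
    by (simp add: sum_distrib_right sum_distrib_left divide_inverse mult_ac)
  also have "(\<Sum>i\<in>K. of_nat i ^ q / p i) = (if q = s then 1 else 0)"
    unfolding p_def by (rule lagrange_power_sum) (use assms in \<open>auto simp: inj_on_def\<close>)
  finally show ?thesis by simp
qed

lemma tendsto_quotient_power:
  assumes "F analytic_on {0}" and van: "\<And>q. q < s \<Longrightarrow> (deriv ^^ q) F 0 = 0"
  shows "((\<lambda>t. F t / t ^ s) \<longlongrightarrow> (deriv ^^ s) F 0 / fact s) (at 0)"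
proof -
  define G where "G = fps_expansion F 0"
  have F: "F has_fps_expansion G"
    unfolding G_def using assms(1) by (rule analytic_at_imp_has_fps_expansion_0)
  have nth: "fps_nth G q = (deriv ^^ q) F 0 / fact q" for q by (simp add: G_def fps_expansion_def)
  show ?thesis
  proof (cases "G = 0")
    case True
    then have "\<forall>\<^sub>F t in nhds 0. F t = 0" using F has_fps_expansion_0_iff by metis
    then have "\<forall>\<^sub>F t in at 0. F t / t ^ s = 0"
      by (auto simp: eventually_at_filter elim: eventually_mono)
    moreover have "(deriv ^^ s) F 0 / fact s = 0" using nth[of s] True by simp
    ultimately show ?thesis by (simp add: tendsto_eventually)
  next
    case False
    have "s \<le> subdegree G" using False van by (intro subdegree_geI) (auto simp: nth)
    then have "(\<lambda>t. if t = 0 then fps_nth G s else F t / t ^ s) has_fps_expansion fps_shift s G"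
      using F by (intro has_fps_expansion_shift) auto
    then have "isCont (\<lambda>t. if t = 0 then fps_nth G s else F t / t ^ s) 0"
      using has_fps_expansion_imp_continuous[of _ "fps_shift s G" UNIV] by simp
    then have "((\<lambda>t. if t = 0 then fps_nth G s else F t / t ^ s) \<longlongrightarrow> fps_nth G s) (at 0)"
      by (simp add: isCont_def)
    then show ?thesis unfolding nth[of s]
      by (rule Lim_transform_eventually) (auto simp: eventually_at_filter)
  qed
qed

section \<open>Powers of the Euler operator\<close>

definition euler_op :: "(complex \<Rightarrow> complex) \<Rightarrow> complex \<Rightarrow> complex" where
  "euler_op f = (\<lambda>z. z * deriv f z)"

lemma euler_op_power:
  assumes "f holomorphic_on A" "open A" "z \<in> A"
  shows "(euler_op ^^ k) f z = (\<Sum>m\<le>k. of_nat (Stirling k m) * z ^ m * (deriv ^^ m) f z)"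
  using assms(3)
proof (induction k arbitrary: z)
  case (Suc k)
  have hol: "(deriv ^^ m) f holomorphic_on A" for m
    using assms by (intro holomorphic_higher_deriv)
  have der: "((deriv ^^ m) f has_field_derivative (deriv ^^ Suc m) f z) (at z)" for m
    using hol[of m] assms(2) Suc.prems by (auto intro: holomorphic_derivI)
  have "((\<lambda>z. \<Sum>m\<le>k. of_nat (Stirling k m) * z ^ m * (deriv ^^ m) f z) has_field_derivative
      (\<Sum>m\<le>k. of_nat (Stirling k m) * (of_nat m * z ^ (m - 1)) * (deriv ^^ m) f z +
        of_nat (Stirling k m) * z ^ m * (deriv ^^ Suc m) f z)) (at z)"
    by (rule derivative_eq_intros der refl | simp add: algebra_simps)+
  then have "deriv (\<lambda>z. \<Sum>m\<le>k. of_nat (Stirling k m) * z ^ m * (deriv ^^ m) f z) z =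
      (\<Sum>m\<le>k. of_nat (Stirling k m) * (of_nat m * z ^ (m - 1)) * (deriv ^^ m) f z +
        of_nat (Stirling k m) * z ^ m * (deriv ^^ Suc m) f z)"
    by (rule DERIV_imp_deriv)
  moreover have "deriv ((euler_op ^^ k) f) z = deriv (\<lambda>z. \<Sum>m\<le>k. of_nat (Stirling k m) * z ^ m * (deriv ^^ m) f z) z"
    using eventually_nhds_in_open[OF assms(2) Suc.prems]
    by (intro deriv_cong_ev refl) (auto elim!: eventually_mono simp: Suc.IH)
  ultimately have "(euler_op ^^ Suc k) f z =
      z * (\<Sum>m\<le>k. of_nat (Stirling k m) * (of_nat m * z ^ (m - 1)) * (deriv ^^ m) f z +
        of_nat (Stirling k m) * z ^ m * (deriv ^^ Suc m) f z)"
    by (simp add: euler_op_def)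
  also have "\<dots> = (\<Sum>m\<le>k. of_nat m * of_nat (Stirling k m) * z ^ m * (deriv ^^ m) f z) +
        (\<Sum>m\<le>k. of_nat (Stirling k m) * z ^ Suc m * (deriv ^^ Suc m) f z)"
  proof -
    have "z * (of_nat (Stirling k m) * (of_nat m * z ^ (m - 1)) * (deriv ^^ m) f z +
        of_nat (Stirling k m) * z ^ m * (deriv ^^ Suc m) f z) =
      of_nat m * of_nat (Stirling k m) * z ^ m * (deriv ^^ m) f z +
        of_nat (Stirling k m) * z ^ Suc m * (deriv ^^ Suc m) f z" for m
      by (cases m) (simp_all add: algebra_simps)
    then show ?thesis by (simp only: sum_distrib_left sum.distrib[symmetric])
  qed
  also have "(\<Sum>m\<le>k. of_nat m * of_nat (Stirling k m) * z ^ m * (deriv ^^ m) f z) =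
      (\<Sum>m\<le>Suc k. of_nat m * of_nat (Stirling k m) * z ^ m * (deriv ^^ m) f z)"
    by simp
  also have "(\<Sum>m\<le>k. of_nat (Stirling k m) * z ^ Suc m * (deriv ^^ Suc m) f z) =
      (\<Sum>m\<le>Suc k. (if m = 0 then 0 else of_nat (Stirling k (m - 1)) * z ^ m * (deriv ^^ m) f z))"
    by (subst sum.atMost_Suc_shift) simp
  also have "(\<Sum>m\<le>Suc k. of_nat m * of_nat (Stirling k m) * z ^ m * (deriv ^^ m) f z) + \<dots> =
      (\<Sum>m\<le>Suc k. of_nat (Stirling (Suc k) m) * z ^ m * (deriv ^^ m) f z)"
    unfolding sum.distrib[symmetric]
  proof (intro sum.cong refl)
    fix m show "of_nat m * of_nat (Stirling k m) * z ^ m * (deriv ^^ m) f z +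
         (if m = 0 then 0 else of_nat (Stirling k (m - 1)) * z ^ m * (deriv ^^ m) f z) =
         of_nat (Stirling (Suc k) m) * z ^ m * (deriv ^^ m) f z"
      by (cases m) (auto simp: algebra_simps)
  qed
  finally show ?case .
qed simp

lemma Stirling_Suc_self: "Stirling (Suc n) n = Suc n choose 2"
proof (induction n)
  case (Suc n)
  have "Stirling (Suc (Suc n)) (Suc n) = Suc n * Stirling (Suc n) (Suc n) + Stirling (Suc n) n" by simp
  then show ?case using Suc.IH by (simp add: numeral_2_eq_2)
qed (simp add: numeral_2_eq_2)

text \<open>
  The shape in which all expansions of a power of the Euler operator appear: \<open>m\<close> is the order of
  differentiation in the normally ordered operator and \<open>s\<close> the number of derivatives that fall on
  the Vandermonde product.
\<close>

definition stirling_sum :: "nat \<Rightarrow> (nat \<Rightarrow> nat \<Rightarrow> complex) \<Rightarrow> complex" where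
  "stirling_sum k X = (\<Sum>m\<le>k. of_nat (Stirling k m) * (\<Sum>s\<le>m. fact m / fact (m - s) * X m s))"

lemma stirling_sum_cong:
  "(\<And>m s. s \<le> m \<Longrightarrow> m \<le> k \<Longrightarrow> X m s = Y m s) \<Longrightarrow> stirling_sum k X = stirling_sum k Y"
  by (simp add: stirling_sum_def)

lemma stirling_sum_cmult: "c * stirling_sum k X = stirling_sum k (\<lambda>m s. c * X m s)"
  by (simp add: stirling_sum_def sum_distrib_left mult_ac)

lemma stirling_sum_add: "stirling_sum k X + stirling_sum k Y = stirling_sum k (\<lambda>m s. X m s + Y m s)"
  by (simp add: stirling_sum_def distrib_left sum.distrib)

lemma stirling_sum_sum: "(\<Sum>i\<in>A. stirling_sum k (X i)) = stirling_sum k (\<lambda>m s. \<Sum>i\<in>A. X i m s)"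
  by (induction A rule: infinite_finite_induct) (simp_all add: stirling_sum_add, simp_all add: stirling_sum_def)

lemma tendsto_stirling_sum:
  assumes "\<And>m s. s \<le> m \<Longrightarrow> m \<le> k \<Longrightarrow> (X m s \<longlongrightarrow> Y m s) F"
  shows "((\<lambda>t. stirling_sum k (\<lambda>m s. X m s t)) \<longlongrightarrow> stirling_sum k Y) F"
  unfolding stirling_sum_def by (intro tendsto_intros assms) auto

lemma has_sum_stirling_sum:
  assumes "\<And>m s. s \<le> m \<Longrightarrow> m \<le> k \<Longrightarrow> (X m s has_sum Y m s) I"
  shows "((\<lambda>l. stirling_sum k (\<lambda>m s. X m s l)) has_sum stirling_sum k Y) I"
  unfolding stirling_sum_def by (intro has_sum_sum has_sum_cmult_right assms) auto

lemma higher_deriv_prod_linear: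
  fixes c :: "'i \<Rightarrow> complex"
  assumes "finite J"
  shows "(deriv ^^ s) (\<lambda>z. \<Prod>j\<in>J. z - c j) z =
    fact s * (\<Sum>I | I \<subseteq> J \<and> card I = s. \<Prod>j\<in>J - I. z - c j)"
  using assms
proof (induction J arbitrary: s rule: finite_induct)
  case empty
  have "{I :: 'i set. I = {} \<and> card I = s} = (if s = 0 then {{}} else {})" by auto
  then show ?case using higher_deriv_const[of s "1 :: complex"] by (simp add: fun_eq_iff)
next
  case (insert x J)
  let ?w = "\<lambda>z. \<Prod>j\<in>J. z - c j"
  have hol: "?w holomorphic_on UNIV" by (intro holomorphic_intros)
  have fin: "finite {I. I \<subseteq> J \<and> card I = n}" for n
    using insert.hyps by (simp add: finite_subset[of _ "Pow J"] Collect_mono_iff)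
  have lin: "(deriv ^^ i) (\<lambda>z. z - c x) z = (if i = 0 then z - c x else if i = 1 then 1 else 0)" for i
  proof -
    have "(deriv ^^ i) (\<lambda>z. z - c x) z = (deriv ^^ i) (\<lambda>z. z) z - (deriv ^^ i) (\<lambda>z. c x) z"
      by (rule higher_deriv_diff[where S = UNIV]) (auto intro!: holomorphic_intros)
    then show ?thesis by (auto simp: higher_deriv_ident[unfolded id_def])
  qed
  have out: "(\<Sum>I | I \<subseteq> J \<and> card I = s. \<Prod>j\<in>insert x J - I. z - c j) =
      (z - c x) * (\<Sum>I | I \<subseteq> J \<and> card I = s. \<Prod>j\<in>J - I. z - c j)" for s
  proof -
    have "(\<Prod>j\<in>insert x J - I. z - c j) = (z - c x) * (\<Prod>j\<in>J - I. z - c j)" if "I \<subseteq> J" for I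
    proof -
      have "insert x J - I = insert x (J - I)" using that insert.hyps by auto
      then show ?thesis using insert.hyps by simp
    qed
    then show ?thesis by (simp add: sum_distrib_left)
  qed
  show ?case
  proof (cases s)
    case 0
    have "{I. I \<subseteq> A \<and> card I = 0} = {{}}" if "finite A" for A :: "'i set"
      using that by (auto simp: card_eq_0_iff dest: finite_subset)
    then show ?thesis using 0 insert.hyps by simp
  next
    case (Suc n)
    have split: "{I. I \<subseteq> insert x J \<and> card I = Suc n} =
        {I. I \<subseteq> J \<and> card I = Suc n} \<union> insert x ` {I. I \<subseteq> J \<and> card I = n}" (is "?L = ?R")
    proof
      show "?L \<subseteq> ?R"
      proof
        fix I assume I: "I \<in> ?L"
        then have finI: "finite I" using insert.hyps finite_subset by blast
        show "I \<in> ?R"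
        proof (cases "x \<in> I")
          case True
          then have "I = insert x (I - {x})" "I - {x} \<subseteq> J" "card (I - {x}) = n"
            using I finI by auto
          then show ?thesis by blast
        qed (use I in auto)
      qed
      show "?R \<subseteq> ?L"
        using insert.hyps finite_subset[of _ J] by (auto simp: card_insert_if)
    qed
    have "(deriv ^^ s) (\<lambda>z. \<Prod>j\<in>insert x J. z - c j) z = (deriv ^^ s) (\<lambda>z. (z - c x) * ?w z) z"
      using insert.hyps by simp
    also have "\<dots> = (\<Sum>i = 0..s. of_nat (s choose i) * (deriv ^^ i) (\<lambda>z. z - c x) z * (deriv ^^ (s - i)) ?w z)"
      by (rule higher_deriv_mult[where S = UNIV]) (auto intro!: holomorphic_intros)
    also have "\<dots> = (\<Sum>i\<in>{0, 1}. of_nat (s choose i) * (deriv ^^ i) (\<lambda>z. z - c x) z * (deriv ^^ (s - i)) ?w z)"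
      using Suc by (intro sum.mono_neutral_right) (auto simp: lin)
    also have "\<dots> = (z - c x) * (deriv ^^ Suc n) ?w z + of_nat (Suc n) * (deriv ^^ n) ?w z"
      by (simp add: lin Suc del: funpow.simps)
    also have "\<dots> = fact (Suc n) * ((\<Sum>I | I \<subseteq> J \<and> card I = Suc n. \<Prod>j\<in>insert x J - I. z - c j) +
        (\<Sum>I | I \<subseteq> J \<and> card I = n. \<Prod>j\<in>J - I. z - c j))"
      unfolding insert.IH out by (simp add: algebra_simps)
    also have "(\<Sum>I | I \<subseteq> J \<and> card I = n. \<Prod>j\<in>J - I. z - c j) =
        (\<Sum>I\<in>insert x ` {I. I \<subseteq> J \<and> card I = n}. \<Prod>j\<in>insert x J - I. z - c j)"
    proof (subst sum.reindex)
      show "inj_on (insert x) {I. I \<subseteq> J \<and> card I = n}"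
        using insert.hyps by (auto simp: inj_on_def)
      have "insert x J - insert x I = J - I" if "I \<subseteq> J" for I using insert.hyps that by auto
      then show "(\<Sum>I | I \<subseteq> J \<and> card I = n. \<Prod>j\<in>J - I. z - c j) =
          sum ((\<lambda>I. \<Prod>j\<in>insert x J - I. z - c j) \<circ> insert x) {I. I \<subseteq> J \<and> card I = n}"
        by simp
    qed
    also have "(\<Sum>I | I \<subseteq> J \<and> card I = Suc n. \<Prod>j\<in>insert x J - I. z - c j) + \<dots> =
        (\<Sum>I | I \<subseteq> insert x J \<and> card I = s. \<Prod>j\<in>insert x J - I. z - c j)"
      unfolding Suc split using insert.hyps fin by (intro sum.union_disjoint[symmetric]) auto
    finally show ?thesis by (simp add: Suc)
  qed
qed

section \<open>The Euler operators and the Vandermonde product\<close>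

definition euler_sum :: "nat \<Rightarrow> nat \<Rightarrow> ((nat \<Rightarrow> complex) \<Rightarrow> complex) \<Rightarrow> (nat \<Rightarrow> complex) \<Rightarrow> complex" where
  "euler_sum N k F u = (\<Sum>i<N. (euler_op ^^ k) (\<lambda>z. F (u(i := z))) (u i))"

lemma euler_op_power_sum_powers:
  assumes "finite P" "z \<noteq> 0"
  shows "(euler_op ^^ k) (\<lambda>z. \<Sum>p\<in>P. b p * z powi w p) z = (\<Sum>p\<in>P. of_int (w p) ^ k * (b p * z powi w p))"
  using assms(2)
proof (induction k arbitrary: z)
  case (Suc k)
  have "deriv ((euler_op ^^ k) (\<lambda>z. \<Sum>p\<in>P. b p * z powi w p)) z =
      deriv (\<lambda>z. \<Sum>p\<in>P. of_int (w p) ^ k * (b p * z powi w p)) z"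
    using t1_space_nhds[OF Suc.prems]
    by (intro deriv_cong_ev refl) (auto elim!: eventually_mono simp: Suc.IH)
  also have "\<dots> = (\<Sum>p\<in>P. of_int (w p) ^ k * (b p * (of_int (w p) * z powi (w p - 1))))"
    using Suc.prems by (intro DERIV_imp_deriv) (auto intro!: derivative_eq_intros sum.cong simp: mult_ac)
  finally have "(euler_op ^^ Suc k) (\<lambda>z. \<Sum>p\<in>P. b p * z powi w p) z =
      z * (\<Sum>p\<in>P. of_int (w p) ^ k * (b p * (of_int (w p) * z powi (w p - 1))))"
    by (simp add: euler_op_def)
  also have "\<dots> = (\<Sum>p\<in>P. of_int (w p) ^ Suc k * (b p * z powi w p))"
    unfolding sum_distrib_left using Suc.prems
    by (intro sum.cong refl) (simp add: power_int_diff)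
  finally show ?case .
qed simp

text \<open>
  Every monomial of the alternant is an eigenfunction of each Euler operator, and its exponents are
  a permutation of the given ones, so the sum of the eigenvalues is the same for all monomials.
\<close>

lemma euler_sum_alternant:
  assumes nz: "\<And>i. i < N \<Longrightarrow> u i \<noteq> 0"
  shows "euler_sum N k (alternant N e) u = (\<Sum>j<N. of_int (e j) ^ k) * alternant N e u"
proof -
  let ?P = "{p. p permutes {0..<N}}"
  have fin: "finite ?P" by (simp add: finite_permutations)
  have one: "(euler_op ^^ k) (\<lambda>z. alternant N e (u(i := z))) (u i) =
      (\<Sum>p\<in>?P. of_int (e (p i)) ^ k * (signof p * (\<Prod>j = 0..<N. u j powi e (p j))))" if i: "i < N" for i
  proof -
    define b where "b p = signof p * (\<Prod>j\<in>{0..<N} - {i}. u j powi e (p j))" for p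
    have "signof p * (\<Prod>j = 0..<N. (u(i := z)) j powi e (p j)) = b p * z powi e (p i)" for p z
      using i unfolding b_def by (subst prod.remove[of _ i]) (auto intro!: prod.cong simp: mult_ac)
    note * = this
    have "b p * u i powi e (p i) = signof p * (\<Prod>j = 0..<N. u j powi e (p j))" for p
      using *[of p "u i"] by simp
    then show ?thesis
      unfolding alternant_Leibniz * using euler_op_power_sum_powers[OF fin nz[OF i], of k b "\<lambda>p. e (p i)"] by simp
  qed
  have perm: "(\<Sum>i<N. of_int (e (p i)) ^ k) = (\<Sum>j<N. of_int (e j) ^ k :: complex)" if "p \<in> ?P" for p
    using that sum.permute[of p "{..<N}" "\<lambda>j. of_int (e j) ^ k :: complex"] by (simp add: comp_def atLeast0LessThan)
  have "euler_sum N k (alternant N e) u =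
      (\<Sum>i<N. \<Sum>p\<in>?P. of_int (e (p i)) ^ k * (signof p * (\<Prod>j = 0..<N. u j powi e (p j))))"
    unfolding euler_sum_def by (intro sum.cong refl) (simp add: one)
  also have "\<dots> = (\<Sum>p\<in>?P. (\<Sum>i<N. of_int (e (p i)) ^ k) * (signof p * (\<Prod>j = 0..<N. u j powi e (p j))))"
    by (subst sum.swap) (simp add: sum_distrib_right)
  also have "\<dots> = (\<Sum>j<N. of_int (e j) ^ k) * alternant N e u"
    unfolding alternant_Leibniz sum_distrib_left by (intro sum.cong refl) (simp add: perm)
  finally show ?thesis .
qed

lemma vandermonde_update:
  assumes "i < N"
  shows "\<exists>C. \<forall>z. vandermonde N (u(i := z)) = C * (\<Prod>j\<in>{..<N} - {i}. z - u j)"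
  using assms
proof (induction N)
  case (Suc N)
  show ?case
  proof (cases "i = N")
    case True
    have "vandermonde (Suc N) (u(i := z)) = vandermonde N u * (- 1) ^ N * (\<Prod>j\<in>{..<Suc N} - {i}. z - u j)" for z
    proof -
      have "vandermonde N (u(i := z)) = vandermonde N u"
        unfolding vandermonde_def using True by (intro prod.cong) auto
      moreover have "(\<Prod>j<N. (u(i := z)) j - (u(i := z)) N) = (\<Prod>j<N. - 1 * (z - u j))"
        using True by (intro prod.cong) auto
      moreover have "(\<Prod>j<N. - 1 * (z - u j)) = (- 1) ^ N * (\<Prod>j<N. z - u j)"
        by (simp only: prod.distrib prod_constant card_lessThan)
      moreover have "{..<Suc N} - {i} = {..<N}" using True by auto
      ultimately show ?thesis unfolding vandermonde_Suc by (simp only: mult.assoc)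
    qed
    then show ?thesis by blast
  next
    case False
    then obtain C where C: "\<And>z. vandermonde N (u(i := z)) = C * (\<Prod>j\<in>{..<N} - {i}. z - u j)"
      using Suc by (metis less_SucE)
    have i: "i < N" using False Suc.prems by simp
    have "vandermonde (Suc N) (u(i := z)) =
        C * (\<Prod>j\<in>{..<N} - {i}. u j - u N) * (\<Prod>j\<in>{..<Suc N} - {i}. z - u j)" for z
    proof -
      have "(\<Prod>j<N. (u(i := z)) j - (u(i := z)) N) = (z - u N) * (\<Prod>j\<in>{..<N} - {i}. u j - u N)"
        using i by (subst prod.remove[of _ i]) (auto intro!: prod.cong)
      moreover have "{..<Suc N} - {i} = insert N ({..<N} - {i})" using i by auto
      ultimately show ?thesis unfolding vandermonde_Suc C by simp
    qed
    then show ?thesis by blast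
  qed
qed simp

lemma sum_pairs_eq_sum_subsets:
  assumes "finite A"
  shows "(\<Sum>i\<in>A. \<Sum>I | I \<subseteq> A - {i} \<and> card I = s. G i I) =
    (\<Sum>K | K \<subseteq> A \<and> card K = Suc s. \<Sum>i\<in>K. G i (K - {i}))"
proof -
  have fin: "finite {I. I \<subseteq> B \<and> card I = n}" if "finite B" for B :: "'a set" and n
    using that by (simp add: finite_subset[of _ "Pow B"] Collect_mono_iff)
  have finK: "finite K" if "K \<subseteq> A" for K using that assms finite_subset by blast
  have compl: "card (insert i I) = Suc (card I)" "I - {i} = I" if "I \<subseteq> A - {i}" for i I
  proof -
    have "finite I" "i \<notin> I" using that finK[of I] by auto
    then show "card (insert i I) = Suc (card I)" "I - {i} = I" by auto
  qed
  have "(\<Sum>i\<in>A. \<Sum>I | I \<subseteq> A - {i} \<and> card I = s. G i I) =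
      (\<Sum>(i, I)\<in>Sigma A (\<lambda>i. {I. I \<subseteq> A - {i} \<and> card I = s}). G i I)"
    using assms fin by (intro sum.Sigma) auto
  also have "\<dots> = (\<Sum>(K, i)\<in>Sigma {K. K \<subseteq> A \<and> card K = Suc s} (\<lambda>K. K). G i (K - {i}))"
    by (rule sum.reindex_bij_witness[where j = "\<lambda>(i, I). (insert i I, i)" and i = "\<lambda>(K, i). (i, K - {i})"])
      (use finK compl in \<open>auto simp: insert_absorb\<close>)
  also have "\<dots> = (\<Sum>K | K \<subseteq> A \<and> card K = Suc s. \<Sum>i\<in>K. G i (K - {i}))"
    using fin[OF assms] finK by (intro sum.Sigma[symmetric]) auto
  finally show ?thesis .
qed

text \<open>
  As a function of \<open>u\<^sub>i\<close> alone, the Vandermonde product is a constant times \<open>\<Prod>\<^sub>j (u\<^sub>i - u\<^sub>j)\<close>.  Its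
  derivatives of order \<open>s\<close> divided by itself are sums of reciprocals over sets of \<open>s\<close> further
  variables; together with \<open>i\<close> these form the set \<open>K\<close>.
\<close>

lemma euler_sum_vandermonde_product:
  fixes u :: "nat \<Rightarrow> complex"
  assumes g: "g holomorphic_on A" "open A" and u: "\<And>i. i < N \<Longrightarrow> u i \<in> A" "\<And>i. i < N \<Longrightarrow> g (u i) \<noteq> 0"
    and inj: "inj_on u {..<N}"
  shows "euler_sum N k (\<lambda>v. vandermonde N v * (c * (\<Prod>i<N. g (v i)))) u =
    vandermonde N u * (c * (\<Prod>i<N. g (u i))) *
    stirling_sum k (\<lambda>m s. \<Sum>K | K \<subseteq> {..<N} \<and> card K = Suc s. \<Sum>i\<in>K.
      u i ^ m * (deriv ^^ (m - s)) g (u i) / g (u i) / (\<Prod>j\<in>K - {i}. u i - u j))"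
    (is "_ = ?V * _")
proof -
  define h where "h m a z = z ^ m * (deriv ^^ a) g z / g z" for m a z
  have one: "(euler_op ^^ k) (\<lambda>z. vandermonde N (u(i := z)) * (c * (\<Prod>j<N. g ((u(i := z)) j)))) (u i) =
      ?V * stirling_sum k (\<lambda>m s. \<Sum>I | I \<subseteq> {..<N} - {i} \<and> card I = s. h m (m - s) (u i) / (\<Prod>j\<in>I. u i - u j))"
    if i: "i < N" for i
  proof -
    define J where "J = {..<N} - {i}"
    define w where "w z = (\<Prod>j\<in>J. z - u j)" for z
    define D where "D = c * (\<Prod>j\<in>J. g (u j))"
    obtain C where C: "\<And>z. vandermonde N (u(i := z)) = C * w z"
      using vandermonde_update[OF i, of u] unfolding w_def J_def by blast
    have D: "c * (\<Prod>j<N. g ((u(i := z)) j)) = D * g z" for z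
      using i unfolding D_def J_def by (subst prod.remove[of _ i]) (auto intro!: prod.cong)
    have V: "?V = C * w (u i) * (D * g (u i))" using C[of "u i"] D[of "u i"] by simp
    have ui: "u i \<in> A" "g (u i) \<noteq> 0" using u i by auto
    have w0: "u i - u j \<noteq> 0" if "j \<in> J" for j
      using inj i that by (auto simp: J_def inj_on_def)
    have wh: "w holomorphic_on A" unfolding w_def by (intro holomorphic_intros)
    have wd: "(deriv ^^ s) w (u i) = fact s * (\<Sum>I | I \<subseteq> J \<and> card I = s. w (u i) / (\<Prod>j\<in>I. u i - u j))" for s
    proof -
      have "(\<Prod>j\<in>J - I. u i - u j) = w (u i) / (\<Prod>j\<in>I. u i - u j)" if "I \<subseteq> J" for I
      proof -
        have "finite I" using that finite_subset[of I J] by (simp add: J_def)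
        then have "(\<Prod>j\<in>I. u i - u j) \<noteq> 0" using w0 that by (auto simp: prod_zero_iff)
        moreover have "w (u i) = (\<Prod>j\<in>J - I. u i - u j) * (\<Prod>j\<in>I. u i - u j)"
          unfolding w_def using that by (intro prod.subset_diff) (auto simp: J_def)
        ultimately show ?thesis by simp
      qed
      moreover have "(deriv ^^ s) w (u i) = fact s * (\<Sum>I | I \<subseteq> J \<and> card I = s. \<Prod>j\<in>J - I. u i - u j)"
        unfolding w_def[abs_def] by (rule higher_deriv_prod_linear) (simp add: J_def)
      ultimately show ?thesis by simp
    qed
    have der: "(deriv ^^ m) (\<lambda>z. C * w z * (D * g z)) (u i) = ?V * (\<Sum>s\<le>m. fact m / fact (m - s) *
        (\<Sum>I | I \<subseteq> J \<and> card I = s. (deriv ^^ (m - s)) g (u i) / g (u i) / (\<Prod>j\<in>I. u i - u j)))" for m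
    proof -
      have "(deriv ^^ m) (\<lambda>z. C * w z * (D * g z)) (u i) = (deriv ^^ m) (\<lambda>z. (C * D) * (w z * g z)) (u i)"
        by (simp add: mult_ac)
      also have "\<dots> = (C * D) * (deriv ^^ m) (\<lambda>z. w z * g z) (u i)"
        using ui g wh by (intro higher_deriv_cmult[where A = A] holomorphic_intros)
      also have "(deriv ^^ m) (\<lambda>z. w z * g z) (u i) =
          (\<Sum>s = 0..m. of_nat (m choose s) * (deriv ^^ s) w (u i) * (deriv ^^ (m - s)) g (u i))"
        using ui g wh by (intro higher_deriv_mult[where S = A])
      also have "(C * D) * \<dots> = ?V * (\<Sum>s = 0..m. of_nat (m choose s) * fact s *
          (\<Sum>I | I \<subseteq> J \<and> card I = s. (deriv ^^ (m - s)) g (u i) / g (u i) / (\<Prod>j\<in>I. u i - u j)))"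
        unfolding V wd sum_distrib_left sum_distrib_right using ui(2)
        by (intro sum.cong refl) (simp add: field_simps)
      also have "\<dots> = ?V * (\<Sum>s\<le>m. fact m / fact (m - s) *
          (\<Sum>I | I \<subseteq> J \<and> card I = s. (deriv ^^ (m - s)) g (u i) / g (u i) / (\<Prod>j\<in>I. u i - u j)))"
        unfolding atLeast0AtMost
        by (intro arg_cong2[of _ _ _ _ "(*)"] sum.cong refl) (auto simp: binomial_fact)
      finally show ?thesis .
    qed
    have "(euler_op ^^ k) (\<lambda>z. vandermonde N (u(i := z)) * (c * (\<Prod>j<N. g ((u(i := z)) j)))) (u i) =
       (euler_op ^^ k) (\<lambda>z. C * w z * (D * g z)) (u i)"
      by (simp only: C D)
    also have "\<dots> = (\<Sum>m\<le>k. of_nat (Stirling k m) * u i ^ m * (deriv ^^ m) (\<lambda>z. C * w z * (D * g z)) (u i))"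
      using ui g wh by (intro euler_op_power[where A = A] holomorphic_intros)
    also have "\<dots> = ?V * stirling_sum k (\<lambda>m s. \<Sum>I | I \<subseteq> J \<and> card I = s. h m (m - s) (u i) / (\<Prod>j\<in>I. u i - u j))"
      unfolding der h_def stirling_sum_def sum_distrib_left by (intro sum.cong refl) (simp add: mult_ac)
    finally show ?thesis by (simp add: J_def)
  qed
  have "euler_sum N k (\<lambda>v. vandermonde N v * (c * (\<Prod>i<N. g (v i)))) u = ?V * stirling_sum k (\<lambda>m s.
      \<Sum>i<N. \<Sum>I | I \<subseteq> {..<N} - {i} \<and> card I = s. h m (m - s) (u i) / (\<Prod>j\<in>I. u i - u j))"
    unfolding euler_sum_def stirling_sum_sum[symmetric] sum_distrib_left by (intro sum.cong refl one) simp
  also have "\<dots> = ?V * stirling_sum k (\<lambda>m s. \<Sum>K | K \<subseteq> {..<N} \<and> card K = Suc s. \<Sum>i\<in>K.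
      h m (m - s) (u i) / (\<Prod>j\<in>K - {i}. u i - u j))"
    by (subst sum_pairs_eq_sum_subsets) auto
  finally show ?thesis unfolding h_def .
qed

section \<open>Power sums as confluent values\<close>

definition partial_deriv :: "nat \<Rightarrow> nat \<Rightarrow> ((nat \<Rightarrow> complex) \<Rightarrow> complex) \<Rightarrow> (nat \<Rightarrow> complex) \<Rightarrow> complex" where
  "partial_deriv i a f u = (deriv ^^ a) (\<lambda>z. f (u(i := z))) (u i)"

text \<open>
  The line through the point with all coordinates \<open>1\<close> along which confluent values are read off.  Its
  first \<open>s + 1\<close> coordinates are pairwise distinct for \<open>t \<noteq> 0\<close>; the remaining ones stay at \<open>1\<close>.
\<close>

definition line_point :: "nat \<Rightarrow> complex \<Rightarrow> nat \<Rightarrow> complex" where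
  "line_point s t = (\<lambda>i. if i \<le> s then 1 + t * of_nat i else 1)"

text \<open>
  The sum \<open>\<Sum>\<^sub>i u\<^sub>i\<^sup>m \<partial>\<^sub>i\<^sup>m\<^sup>-\<^sup>s f / \<Prod>\<^sub>j (u\<^sub>i - u\<^sub>j)\<close> over the first \<open>s + 1\<close> variables at the point of the line, cleared of the
  denominator \<open>t\<^sup>s\<close>.  For symmetric \<open>f\<close> it vanishes to order \<open>s\<close> at \<open>t = 0\<close>.
\<close>

definition confluent_sum :: "nat \<Rightarrow> nat \<Rightarrow> ((nat \<Rightarrow> complex) \<Rightarrow> complex) \<Rightarrow> complex \<Rightarrow> complex" where
  "confluent_sum s m f t = (\<Sum>i\<le>s. line_point s t i ^ m * partial_deriv i (m - s) f (line_point s t) /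
     (\<Prod>j\<in>{..s} - {i}. of_nat i - of_nat j))"

definition confluent_coeff :: "nat \<Rightarrow> nat \<Rightarrow> ((nat \<Rightarrow> complex) \<Rightarrow> complex) \<Rightarrow> complex" where
  "confluent_coeff s m f = (deriv ^^ s) (confluent_sum s m f) 0 / fact s"

lemma line_point_0 [simp]: "line_point s 0 = (\<lambda>_. 1)"
  by (simp add: line_point_def fun_eq_iff)

lemma line_point_ball:
  assumes "t \<in> ball 0 d" "d * real s \<le> \<rho>" "\<rho> > 0"
  shows "line_point s t i \<in> ball 1 \<rho>"
  using node_in_ball[of t d i s \<rho>] assms by (auto simp: line_point_def)

definition log_quotient :: "nat \<Rightarrow> nat \<Rightarrow> (complex \<Rightarrow> complex) \<Rightarrow> complex \<Rightarrow> complex" where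
  "log_quotient m a g z = z ^ m * (deriv ^^ a) g z / g z"

lemma confluent_sum_product:
  assumes g: "g holomorphic_on ball 1 \<rho>" "\<And>z. z \<in> ball 1 \<rho> \<Longrightarrow> g z \<noteq> 0" and "s < N"
    and t: "t \<in> ball 0 d" "d * real s \<le> \<rho>" "\<rho> > 0"
  shows "confluent_sum s m (\<lambda>v. c * (\<Prod>i<N. g (v i))) t =
    c * (\<Prod>i<N. g (line_point s t i)) * node_sum {..s} (log_quotient m (m - s) g) t"
proof -
  let ?u = "line_point s t"
  have u: "?u i \<in> ball 1 \<rho>" for i by (rule line_point_ball[OF t])
  have pd: "partial_deriv i a (\<lambda>v. c * (\<Prod>i<N. g (v i))) ?u = c * (\<Prod>i<N. g (?u i)) * ((deriv ^^ a) g (?u i) / g (?u i))"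
    if i: "i < N" for i a
  proof -
    define D where "D = c * (\<Prod>j\<in>{..<N} - {i}. g (?u j))"
    have D: "c * (\<Prod>j<N. g ((?u(i := z)) j)) = D * g z" for z
      using i unfolding D_def by (subst prod.remove[of _ i]) (auto intro!: prod.cong)
    have "partial_deriv i a (\<lambda>v. c * (\<Prod>i<N. g (v i))) ?u = (deriv ^^ a) (\<lambda>z. D * g z) (?u i)"
      unfolding partial_deriv_def D ..
    also have "\<dots> = D * (deriv ^^ a) g (?u i)"
      using g(1) u by (intro higher_deriv_cmult[where A = "ball 1 \<rho>"]) auto
    also have "\<dots> = c * (\<Prod>i<N. g (?u i)) * ((deriv ^^ a) g (?u i) / g (?u i))"
      using D[of "?u i"] g(2)[OF u[of i]] by simp
    finally show ?thesis .
  qed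
  show ?thesis
    unfolding confluent_sum_def node_sum_def sum_distrib_left
    using assms(3) by (intro sum.cong refl) (simp add: pd log_quotient_def, simp add: line_point_def)
qed

definition confluent_expansion :: "nat \<Rightarrow> nat \<Rightarrow> ((nat \<Rightarrow> complex) \<Rightarrow> complex) \<Rightarrow> complex" where
  "confluent_expansion N k f = stirling_sum k (\<lambda>m s. of_nat (N choose Suc s) * confluent_coeff s m f)"

text \<open>
  The properties that pass from products to their linear combinations.  The last one evaluates
  \<open>V\<^sup>-\<^sup>1 \<Sum>\<^sub>i (u\<^sub>i \<partial>\<^sub>i)\<^sup>k (V f)\<close> in the limit at the point with all coordinates \<open>1\<close>; the first one is
  needed to differentiate sums termwise.
\<close>

definition confluent_good :: "nat \<Rightarrow> ((nat \<Rightarrow> complex) \<Rightarrow> complex) \<Rightarrow> bool" where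
  "confluent_good N f \<longleftrightarrow>
    (\<forall>i u. (\<forall>j<N. u j \<noteq> 0) \<longrightarrow> (\<lambda>z. f (u(i := z))) holomorphic_on - {0}) \<and>
    (\<forall>s<N. \<forall>m. confluent_sum s m f analytic_on {0} \<and> (\<forall>q<s. (deriv ^^ q) (confluent_sum s m f) 0 = 0)) \<and>
    (\<forall>k. ((\<lambda>t. euler_sum N k (\<lambda>u. vandermonde N u * f u) (\<lambda>i. 1 + t * of_nat i) /
        vandermonde N (\<lambda>i. 1 + t * of_nat i)) \<longlongrightarrow> confluent_expansion N k f) (at 0))"

lemma nodes_distinct: "t \<noteq> 0 \<Longrightarrow> inj_on (\<lambda>i. 1 + t * of_nat i :: complex) A"
  by (auto simp: inj_on_def)

text \<open>
  For a product \<open>\<Prod>\<^sub>i g(u\<^sub>i)\<close> everything reduces to divided differences of the functions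
  \<open>z\<^sup>m g\<^sup>(\<^sup>a\<^sup>) / g\<close> of one variable.  Their confluent value is a derivative divided by a factorial, the same for
  every set \<open>K\<close> of nodes of a given size.
\<close>

lemma confluent_good_product:
  fixes w :: "nat \<Rightarrow> int"
  assumes S: "finite (S :: nat set)" "S \<noteq> {}"
  shows "confluent_good N (\<lambda>u. c * (\<Prod>i<N. \<Sum>j\<in>S. u i powi w j))"
proof -
  define g :: "complex \<Rightarrow> complex" where "g z = (\<Sum>j\<in>S. z powi w j)" for z
  define f where "f = (\<lambda>u. c * (\<Prod>i<N. g (u i)))"
  have g_hol: "g holomorphic_on - {0}"
    unfolding g_def by (intro holomorphic_intros) auto
  have "g 1 \<noteq> 0" using S by (simp add: g_def)
  moreover have "isCont g 1"
    using g_hol by (auto simp: holomorphic_on_imp_continuous_on continuous_on_interior interior_open open_Compl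
        intro: continuous_on_interior[OF holomorphic_on_imp_continuous_on])
  ultimately have "\<forall>\<^sub>F z in nhds 1. g z \<noteq> 0"
    by (auto simp: isCont_def tendsto_at_iff_tendsto_nhds intro: tendsto_imp_eventually_ne)
  then obtain \<rho>' where \<rho>': "\<rho>' > 0" "\<And>z. dist z 1 < \<rho>' \<Longrightarrow> g z \<noteq> 0"
    by (auto simp: eventually_nhds_metric)
  \<comment> \<open>the bound \<open>1\<close> keeps \<open>0\<close>, where negative powers are singular, outside the ball\<close>
  define \<rho> where "\<rho> = min \<rho>' 1"
  have \<rho>: "\<rho> > 0" "ball (1 :: complex) \<rho> \<subseteq> - {0}" using \<rho>' by (auto simp: \<rho>_def dist_norm)
  have g: "g holomorphic_on ball 1 \<rho>" "\<And>z. z \<in> ball 1 \<rho> \<Longrightarrow> g z \<noteq> 0"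
    using \<rho>' g_hol \<rho> by (auto simp: \<rho>_def dist_commute intro: holomorphic_on_subset)
  have lq: "log_quotient m a g holomorphic_on ball 1 \<rho>" for m a
    unfolding log_quotient_def[abs_def] using g by (intro holomorphic_intros holomorphic_higher_deriv) auto
  define d where "d = \<rho> / (real N + 1)"
  have d: "d > 0" "d * real s \<le> \<rho>" if "s \<le> N" for s
  proof -
    show "d > 0" using \<rho> by (simp add: d_def)
    have "\<rho> * real s \<le> \<rho> * (real N + 1)" using that \<rho> by (intro mult_left_mono) auto
    then show "d * real s \<le> \<rho>" by (simp add: d_def field_simps)
  qed
  have g_line: "(\<lambda>t. g (1 + t * of_nat i)) holomorphic_on ball 0 d" if "i \<le> N" for i
    by (rule node_holomorphic[OF g(1) that d(2)[OF order_refl] \<rho>(1)])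
  have f_line: "(\<lambda>t. f (line_point s t)) holomorphic_on ball 0 d" if "s < N" for s
  proof -
    have "(\<lambda>t. g (line_point s t i)) holomorphic_on ball 0 d" if "i < N" for i
      using g_line[of i] that by (cases "i \<le> s") (simp_all add: line_point_def)
    then show ?thesis unfolding f_def by (intro holomorphic_intros) auto
  qed
  have conf: "confluent_sum s m f t = f (line_point s t) * node_sum {..s} (log_quotient m (m - s) g) t"
    if "s < N" "t \<in> ball 0 d" for s m t
    unfolding f_def using d[of s] that \<rho>
    by (intro confluent_sum_product[OF g that(1), where d = d]) auto
  have node_hol: "node_sum {..s} (log_quotient m a g) holomorphic_on ball 0 d" if "s < N" for s m a
    by (rule node_sum_holomorphic[OF lq, of _ s]) (use d[of s] that \<rho> in auto)
  have conf_deriv: "(deriv ^^ q) (confluent_sum s m f) 0 =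
      (if q = s then f (\<lambda>_. 1) * (deriv ^^ s) (log_quotient m (m - s) g) 1 else 0)"
    if "s < N" "q \<le> s" for s m q
  proof -
    have "(deriv ^^ q) (confluent_sum s m f) 0 =
        (deriv ^^ q) (\<lambda>t. f (line_point s t) * node_sum {..s} (log_quotient m (m - s) g) t) 0"
    proof (rule higher_deriv_cong_ev)
      show "\<forall>\<^sub>F t in nhds 0. confluent_sum s m f t = f (line_point s t) * node_sum {..s} (log_quotient m (m - s) g) t"
        using eventually_nhds_in_open[of "ball 0 d" 0] d[of s] that conf[OF that(1)]
        by (auto elim!: eventually_mono)
    qed simp
    also have "\<dots> = (\<Sum>i = 0..q. of_nat (q choose i) * (deriv ^^ i) (\<lambda>t. f (line_point s t)) 0 *
        (deriv ^^ (q - i)) (node_sum {..s} (log_quotient m (m - s) g)) 0)"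
      using d[of s] that by (intro higher_deriv_mult[OF f_line node_hol]) auto
    also have "\<dots> = (\<Sum>i = 0..q. if i = 0 then (if q = s then f (\<lambda>_. 1) * (deriv ^^ s) (log_quotient m (m - s) g) 1 else 0) else 0)"
      using that by (intro sum.cong refl) (auto simp: node_sum_deriv[OF lq \<rho>(1)])
    finally show ?thesis by simp
  qed
  have "((\<lambda>t. euler_sum N k (\<lambda>u. vandermonde N u * f u) (\<lambda>i. 1 + t * of_nat i) /
        vandermonde N (\<lambda>i. 1 + t * of_nat i)) \<longlongrightarrow> confluent_expansion N k f) (at 0)" for k
  proof -
    define B where "B = (\<lambda>t. (c * (\<Prod>i<N. g (1 + t * of_nat i))) * stirling_sum k (\<lambda>m s.
      \<Sum>K | K \<subseteq> {..<N} \<and> card K = Suc s. node_sum K (log_quotient m (m - s) g) t / t ^ s))"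
    have "\<forall>\<^sub>F t in at 0. t \<in> ball 0 d - {0}"
      using d[of 0] eventually_at_in_open[of "ball 0 d" 0] by simp
    then have ev: "\<forall>\<^sub>F t in at 0. B t = euler_sum N k (\<lambda>u. vandermonde N u * f u) (\<lambda>i. 1 + t * of_nat i) /
        vandermonde N (\<lambda>i. 1 + t * of_nat i)"
    proof eventually_elim
      case (elim t)
      let ?u = "\<lambda>i. 1 + t * complex_of_nat i"
      have inj: "inj_on ?u {..<N}" using elim by (intro nodes_distinct) auto
      have in_ball: "?u i \<in> ball 1 \<rho>" if "i < N" for i
        using that elim d[of N] \<rho> by (intro node_in_ball[of t d i N \<rho>]) auto
      have den: "(\<Prod>j\<in>K - {i}. ?u i - ?u j) = t ^ s * (\<Prod>j\<in>K - {i}. of_nat i - of_nat j)"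
        if "K \<subseteq> {..<N}" "card K = Suc s" "i \<in> K" for K s i
      proof -
        have "finite K" using that(1) finite_subset by blast
        then have "card (K - {i}) = s" using that by simp
        moreover have "(\<Prod>j\<in>K - {i}. ?u i - ?u j) = (\<Prod>j\<in>K - {i}. t * (of_nat i - of_nat j))"
          by (simp add: algebra_simps)
        ultimately show ?thesis by (simp add: prod.distrib)
      qed
      have "(\<Sum>i\<in>K. ?u i ^ m * (deriv ^^ (m - s)) g (?u i) / g (?u i) / (\<Prod>j\<in>K - {i}. ?u i - ?u j)) =
          node_sum K (log_quotient m (m - s) g) t / t ^ s" if "K \<subseteq> {..<N}" "card K = Suc s" for K s m
        unfolding node_sum_def sum_divide_distrib using den[OF that]
        by (intro sum.cong refl) (simp add: log_quotient_def)
      then have "euler_sum N k (\<lambda>u. vandermonde N u * f u) ?u = vandermonde N ?u * B t"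
        unfolding f_def B_def using inj in_ball g
        by (subst euler_sum_vandermonde_product[where A = "ball 1 \<rho>"]) (auto simp: mult.assoc cong: stirling_sum_cong)
      then show ?case using vandermonde_nonzero[OF inj] by simp
    qed
    have "(\<lambda>t. c * (\<Prod>i<N. g (1 + t * of_nat i))) holomorphic_on ball 0 d"
      using g_line by (intro holomorphic_intros) auto
    then have "isCont (\<lambda>t. c * (\<Prod>i<N. g (1 + t * of_nat i))) 0"
      using d[of 0] by (auto intro!: continuous_on_interior[OF holomorphic_on_imp_continuous_on] simp: interior_open)
    then have limf: "((\<lambda>t. c * (\<Prod>i<N. g (1 + t * of_nat i))) \<longlongrightarrow> f (\<lambda>_. 1)) (at 0)"
      by (simp add: isCont_def f_def)
    have limn: "((\<lambda>t. node_sum K (log_quotient m (m - s) g) t / t ^ s) \<longlongrightarrow>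
        (deriv ^^ s) (log_quotient m (m - s) g) 1 / fact s) (at 0)"
      if K: "K \<subseteq> {..<N}" "card K = Suc s" for K s m
    proof -
      have fin: "finite K" using K(1) finite_subset by blast
      have "node_sum K (log_quotient m (m - s) g) holomorphic_on ball 0 d"
        by (rule node_sum_holomorphic[OF lq, of _ N]) (use d[of N] K \<rho> in auto)
      then have "node_sum K (log_quotient m (m - s) g) analytic_on {0}"
        using d[of 0] by (auto simp: analytic_at intro!: exI[of _ "ball 0 d"])
      from tendsto_quotient_power[OF this, of s] show ?thesis
        using node_sum_deriv[OF lq \<rho>(1) fin K(2)] by simp
    qed
    have "(B \<longlongrightarrow> f (\<lambda>_. 1) * stirling_sum k (\<lambda>m s.
      \<Sum>K | K \<subseteq> {..<N} \<and> card K = Suc s. (deriv ^^ s) (log_quotient m (m - s) g) 1 / fact s)) (at 0)"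
      unfolding B_def by (intro tendsto_mult tendsto_stirling_sum tendsto_sum limf limn) auto
    also have "f (\<lambda>_. 1) * stirling_sum k (\<lambda>m s.
      \<Sum>K | K \<subseteq> {..<N} \<and> card K = Suc s. (deriv ^^ s) (log_quotient m (m - s) g) 1 / fact s) = confluent_expansion N k f"
      unfolding confluent_expansion_def stirling_sum_cmult
    proof (intro stirling_sum_cong)
      fix m s
      show "f (\<lambda>_. 1) * (\<Sum>K | K \<subseteq> {..<N} \<and> card K = Suc s. (deriv ^^ s) (log_quotient m (m - s) g) 1 / fact s)
         = of_nat (N choose Suc s) * confluent_coeff s m f"
        by (cases "s < N") (simp_all add: n_subsets confluent_coeff_def conf_deriv binomial_eq_0)
    qed
    finally show ?thesis using ev by (rule Lim_transform_eventually)
  qed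
  moreover have "confluent_sum s m f analytic_on {0}" if "s < N" for s m
  proof -
    have "confluent_sum s m f holomorphic_on ball 0 d"
      using holomorphic_on_mult[OF f_line[OF that] node_hol[OF that]]
      by (rule holomorphic_transform) (use conf that in auto)
    then show ?thesis using d[of 0] by (auto simp: analytic_at intro!: exI[of _ "ball 0 d"])
  qed
  moreover have "(\<lambda>z. f (u(i := z))) holomorphic_on - {0}" if "\<forall>j<N. u j \<noteq> 0" for i u
  proof -
    have "(\<lambda>z. g ((u(i := z)) j)) holomorphic_on - {0}" for j
      using g_hol by (cases "j = i") auto
    then show ?thesis unfolding f_def by (intro holomorphic_intros) auto
  qed
  ultimately have "confluent_good N f"
    unfolding confluent_good_def using conf_deriv by auto
  then show ?thesis by (simp add: f_def g_def)
qed

lemma euler_sum_add: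
  assumes "\<And>i. i < N \<Longrightarrow> (\<lambda>z. F (u(i := z))) holomorphic_on A" "\<And>i. i < N \<Longrightarrow> (\<lambda>z. G (u(i := z))) holomorphic_on A"
    and "open A" "\<And>i. i < N \<Longrightarrow> u i \<in> A"
  shows "euler_sum N k (\<lambda>v. F v + G v) u = euler_sum N k F u + euler_sum N k G u"
  unfolding euler_sum_def sum.distrib[symmetric]
proof (intro sum.cong refl)
  fix i assume "i \<in> {..<N}"
  then have i: "i < N" by simp
  show "(euler_op ^^ k) (\<lambda>z. F (u(i := z)) + G (u(i := z))) (u i) =
      (euler_op ^^ k) (\<lambda>z. F (u(i := z))) (u i) + (euler_op ^^ k) (\<lambda>z. G (u(i := z))) (u i)"
    unfolding euler_op_power[OF holomorphic_on_add[OF assms(1)[OF i] assms(2)[OF i]] assms(3) assms(4)[OF i]]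
      euler_op_power[OF assms(1)[OF i] assms(3) assms(4)[OF i]] euler_op_power[OF assms(2)[OF i] assms(3) assms(4)[OF i]]
      higher_deriv_add[OF assms(1)[OF i] assms(2)[OF i] assms(3) assms(4)[OF i]]
    by (simp add: algebra_simps sum.distrib)
qed

lemma euler_sum_cong:
  assumes "\<And>i z. i < N \<Longrightarrow> z \<in> A \<Longrightarrow> F (u(i := z)) = G (u(i := z))"
    and "\<And>i. i < N \<Longrightarrow> (\<lambda>z. F (u(i := z))) holomorphic_on A" and "open A" "\<And>i. i < N \<Longrightarrow> u i \<in> A"
  shows "euler_sum N k F u = euler_sum N k G u"
  unfolding euler_sum_def
proof (intro sum.cong refl)
  fix i assume "i \<in> {..<N}"
  then have i: "i < N" by simp
  have G: "(\<lambda>z. G (u(i := z))) holomorphic_on A"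
    using assms(2)[OF i] by (rule holomorphic_transform) (use assms(1)[OF i] in auto)
  show "(euler_op ^^ k) (\<lambda>z. F (u(i := z))) (u i) = (euler_op ^^ k) (\<lambda>z. G (u(i := z))) (u i)"
    unfolding euler_op_power[OF assms(2)[OF i] assms(3) assms(4)[OF i]] euler_op_power[OF G assms(3) assms(4)[OF i]]
    by (intro sum.cong refl arg_cong2[of _ _ _ _ "(*)"] higher_deriv_transform_within_open[OF assms(2)[OF i] G assms(3)])
      (use assms(1)[OF i] assms(4)[OF i] in auto)
qed

lemma vandermonde_update_holomorphic: "(\<lambda>z. vandermonde N (u(i := z))) holomorphic_on A"
proof -
  have "(\<lambda>z. (u(i := z)) j) holomorphic_on A" for j by (cases "j = i") auto
  then show ?thesis unfolding vandermonde_def by (intro holomorphic_intros)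
qed

lemma nodes_nonzero: "\<forall>\<^sub>F t in nhds 0. \<forall>i\<in>{..n}. 1 + t * of_nat i \<noteq> (0 :: complex)"
proof (intro eventually_ball_finite ballI)
  fix i
  have "((\<lambda>t. 1 + t * of_nat i :: complex) \<longlongrightarrow> 1 + 0 * of_nat i) (nhds 0)"
    by (intro tendsto_intros filterlim_ident)
  then show "\<forall>\<^sub>F t in nhds 0. 1 + t * of_nat i \<noteq> (0 :: complex)"
    by (rule tendsto_imp_eventually_ne) simp
qed simp

lemma confluent_good_add:
  assumes "confluent_good N f" "confluent_good N g"
  shows "confluent_good N (\<lambda>u. f u + g u)"
proof -
  have hol: "(\<lambda>z. f (u(i := z))) holomorphic_on - {0}" "(\<lambda>z. g (u(i := z))) holomorphic_on - {0}"
    if "\<forall>j<N. u j \<noteq> 0" for i u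
    using assms that by (auto simp: confluent_good_def)
  have an: "confluent_sum s m f analytic_on {0}" "confluent_sum s m g analytic_on {0}" if "s < N" for s m
    using assms that by (auto simp: confluent_good_def)
  have add: "\<forall>\<^sub>F t in nhds 0. confluent_sum s m (\<lambda>u. f u + g u) t = confluent_sum s m f t + confluent_sum s m g t" for s m
    using nodes_nonzero[of s]
  proof eventually_elim
    case (elim t)
    then have nz: "line_point s t i \<noteq> 0" for i by (auto simp: line_point_def)
    have "partial_deriv i a (\<lambda>u. f u + g u) (line_point s t) =
        partial_deriv i a f (line_point s t) + partial_deriv i a g (line_point s t)" for i a
      unfolding partial_deriv_def using nz by (intro higher_deriv_add[OF hol]) auto
    then show ?case
      by (simp add: confluent_sum_def add_divide_distrib distrib_left sum.distrib)
  qed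
  have deriv_add: "(deriv ^^ q) (confluent_sum s m (\<lambda>u. f u + g u)) 0 =
      (deriv ^^ q) (confluent_sum s m f) 0 + (deriv ^^ q) (confluent_sum s m g) 0" if "s < N" for s m q
    using higher_deriv_cong_ev[OF add refl] higher_deriv_add_at[OF an[OF that]] by simp
  have "((\<lambda>t. euler_sum N k (\<lambda>u. vandermonde N u * (f u + g u)) (\<lambda>i. 1 + t * of_nat i) /
        vandermonde N (\<lambda>i. 1 + t * of_nat i)) \<longlongrightarrow> confluent_expansion N k (\<lambda>u. f u + g u)) (at 0)" for k
  proof -
    let ?E = "\<lambda>f t. euler_sum N k (\<lambda>u. vandermonde N u * f u) (\<lambda>i. 1 + t * of_nat i) /
        vandermonde N (\<lambda>i. 1 + t * of_nat i)"
    have "\<forall>\<^sub>F t in nhds 0. ?E f t + ?E g t = ?E (\<lambda>u. f u + g u) t"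
      using nodes_nonzero[of N]
    proof eventually_elim
      case (elim t)
      have "euler_sum N k (\<lambda>u. vandermonde N u * f u + vandermonde N u * g u) (\<lambda>i. 1 + t * of_nat i) =
          euler_sum N k (\<lambda>u. vandermonde N u * f u) (\<lambda>i. 1 + t * of_nat i) +
          euler_sum N k (\<lambda>u. vandermonde N u * g u) (\<lambda>i. 1 + t * of_nat i)"
        using elim by (intro euler_sum_add[where A = "- {0}"] holomorphic_on_mult vandermonde_update_holomorphic hol) auto
      then show ?case by (simp add: distrib_left add_divide_distrib)
    qed
    then have "\<forall>\<^sub>F t in at 0. ?E f t + ?E g t = ?E (\<lambda>u. f u + g u) t"
      by (auto simp: eventually_at_filter elim: eventually_mono)
    moreover have "((\<lambda>t. ?E f t + ?E g t) \<longlongrightarrow> confluent_expansion N k f + confluent_expansion N k g) (at 0)"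
      using assms by (intro tendsto_add) (auto simp: confluent_good_def)
    ultimately have "(?E (\<lambda>u. f u + g u) \<longlongrightarrow> confluent_expansion N k f + confluent_expansion N k g) (at 0)"
      by (rule Lim_transform_eventually[rotated])
    also have "confluent_expansion N k f + confluent_expansion N k g = confluent_expansion N k (\<lambda>u. f u + g u)"
      unfolding confluent_expansion_def stirling_sum_add
    proof (intro stirling_sum_cong)
      show "of_nat (N choose Suc s) * confluent_coeff s m f + of_nat (N choose Suc s) * confluent_coeff s m g =
          of_nat (N choose Suc s) * confluent_coeff s m (\<lambda>u. f u + g u)" for s m
        by (cases "s < N") (simp_all add: confluent_coeff_def deriv_add add_divide_distrib distrib_left binomial_eq_0)
    qed
    finally show ?thesis .
  qed
  moreover have "confluent_sum s m (\<lambda>u. f u + g u) analytic_on {0}" if "s < N" for s m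
    using analytic_at_cong[OF add refl] analytic_on_add[OF an[OF that]] by blast
  moreover have "(deriv ^^ q) (confluent_sum s m (\<lambda>u. f u + g u)) 0 = 0" if "s < N" "q < s" for s m q
    using assms that by (auto simp: deriv_add confluent_good_def)
  moreover have "(\<lambda>z. f (u(i := z)) + g (u(i := z))) holomorphic_on - {0}" if "\<forall>j<N. u j \<noteq> 0" for i u
    using hol[OF that] by (intro holomorphic_intros)
  ultimately show ?thesis unfolding confluent_good_def by blast
qed

lemma product_span_confluent_good: "product_span N f \<Longrightarrow> confluent_good N f"
  by (induction rule: product_span.induct) (auto intro: confluent_good_product confluent_good_add)

lemma tendsto_nodes: "((\<lambda>t. \<lambda>i. 1 + t * of_nat i) \<longlongrightarrow> (\<lambda>_. 1 :: complex)) (at (0 :: complex))"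
proof -
  have "continuous_on UNIV (\<lambda>t :: complex. \<lambda>i. 1 + t * of_nat i :: complex)"
    by (intro continuous_on_coordinatewise_then_product continuous_intros)
  from this[unfolded continuous_on_def, rule_format, of 0] show ?thesis by simp
qed

text \<open>
  The operator \<open>\<Sum>\<^sub>i (u\<^sub>i \<partial>\<^sub>i)\<^sup>k\<close> conjugated by the Vandermonde product multiplies \<open>f\<close> by the power sum, since
  the alternant is an eigenfunction; its limit at the point with all coordinates \<open>1\<close> is the confluent expansion.
\<close>

theorem power_sum_eq_confluent_expansion:
  assumes f: "laurent_pos N f" "product_span N f"
    and alt: "\<And>u. (\<And>i. i < N \<Longrightarrow> u i \<noteq> 0) \<Longrightarrow> alternant N e u = vandermonde N u * f u"
  shows "(\<Sum>j<N. of_int (e j) ^ k) * f (\<lambda>_. 1) = confluent_expansion N k f"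
proof -
  have good: "confluent_good N f" using f(2) by (rule product_span_confluent_good)
  let ?p = "\<Sum>j<N. of_int (e j) ^ k :: complex"
  let ?u = "\<lambda>t i. 1 + t * complex_of_nat i"
  have "\<forall>\<^sub>F t in at 0. t \<noteq> 0 \<and> (\<forall>i\<in>{..N}. ?u t i \<noteq> 0)"
    using nodes_nonzero[of N] by (auto simp: eventually_at_filter elim: eventually_mono)
  then have "\<forall>\<^sub>F t in at 0. euler_sum N k (\<lambda>u. vandermonde N u * f u) (?u t) / vandermonde N (?u t) = ?p * f (?u t)"
  proof eventually_elim
    case (elim t)
    have "euler_sum N k (\<lambda>u. vandermonde N u * f u) (?u t) = euler_sum N k (alternant N e) (?u t)"
    proof (rule euler_sum_cong[where A = "- {0}"])
      show "(\<lambda>z. vandermonde N ((?u t)(i := z)) * f ((?u t)(i := z))) holomorphic_on - {0}" for i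
        using good elim by (intro holomorphic_on_mult vandermonde_update_holomorphic) (auto simp: confluent_good_def)
      show "vandermonde N ((?u t)(i := z)) * f ((?u t)(i := z)) = alternant N e ((?u t)(i := z))"
        if "z \<in> - {0}" for i z
        using that elim by (intro alt[symmetric]) auto
    qed (use elim in auto)
    also have "\<dots> = ?p * alternant N e (?u t)" using elim by (intro euler_sum_alternant) auto
    also have "alternant N e (?u t) = vandermonde N (?u t) * f (?u t)" using elim by (intro alt) auto
    finally show ?case using vandermonde_nonzero[OF nodes_distinct, of t N] elim by simp
  qed
  moreover have "((\<lambda>t. euler_sum N k (\<lambda>u. vandermonde N u * f u) (?u t) / vandermonde N (?u t)) \<longlongrightarrow>
      confluent_expansion N k f) (at 0)"
    using good by (simp add: confluent_good_def)
  ultimately have "((\<lambda>t. ?p * f (?u t)) \<longlongrightarrow> confluent_expansion N k f) (at 0)"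
    by (simp add: tendsto_cong)
  moreover have "((\<lambda>t. ?p * f (?u t)) \<longlongrightarrow> ?p * f (\<lambda>_. 1)) (at 0)"
  proof (intro tendsto_mult tendsto_const)
    have "(f \<longlongrightarrow> f (\<lambda>_. 1)) (nhds (\<lambda>_. 1))"
      using laurent_pos_tendsto[OF f(1), of "\<lambda>_. 1" UNIV] by (simp add: tendsto_at_iff_tendsto_nhds)
    then show "((\<lambda>t. f (?u t)) \<longlongrightarrow> f (\<lambda>_. 1)) (at 0)"
      using tendsto_nodes by (rule filterlim_compose)
  qed
  ultimately show ?thesis using tendsto_unique[of "at (0 :: complex)"] by simp
qed

section \<open>Uniform limits on polydiscs\<close>

text \<open>
  What is used of analyticity in several variables: holomorphy in each variable, and holomorphy of the
  partial derivatives along the lines.  Both are plain statements about functions of one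
  variable, and both are stable under uniform limits.
\<close>

definition polydisc_analytic :: "nat \<Rightarrow> real \<Rightarrow> ((nat \<Rightarrow> complex) \<Rightarrow> complex) \<Rightarrow> bool" where
  "polydisc_analytic r \<rho> f \<longleftrightarrow>
    (\<forall>i<r. \<forall>u\<in>polydisc1 r \<rho>. (\<lambda>z. f (u(i := z))) holomorphic_on ball 1 \<rho>) \<and>
    (\<forall>i<r. \<forall>s<r. \<forall>a. (\<lambda>t. partial_deriv i a f (line_point s t)) holomorphic_on ball 0 (\<rho> / (2 * real r)))"

lemma polydisc1_update: "u \<in> polydisc1 r \<rho> \<Longrightarrow> i < r \<Longrightarrow> z \<in> ball 1 \<rho> \<Longrightarrow> u(i := z) \<in> polydisc1 r \<rho>"
  by (auto simp: polydisc1_def dist_commute)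

lemma polydisc1_mono: "\<rho>' \<le> \<rho> \<Longrightarrow> r' \<le> r \<Longrightarrow> \<rho> > 0 \<Longrightarrow> polydisc1 r' \<rho>' \<subseteq> polydisc1 r \<rho>"
proof
  fix u assume a: "\<rho>' \<le> \<rho>" "r' \<le> r" "\<rho> > 0" "u \<in> polydisc1 r' \<rho>'"
  have "dist (u i) 1 < \<rho>" for i using a by (cases "i < r'") (auto simp: polydisc1_def intro: less_le_trans)
  then show "u \<in> polydisc1 r \<rho>" using a by (auto simp: polydisc1_def)
qed

lemma line_point_polydisc1:
  assumes "t \<in> ball 0 (\<rho> / (2 * real r))" "s < r" "\<rho> > 0"
  shows "line_point s t \<in> polydisc1 r (\<rho> / 2)"
proof -
  have "\<rho> * real s \<le> \<rho> * real r" using assms by (intro mult_left_mono) auto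
  then have "\<rho> / (2 * real r) * real s \<le> \<rho> / 2" using assms by (simp add: field_simps)
  from line_point_ball[OF assms(1) this] assms show ?thesis
    by (auto simp: polydisc1_def dist_commute) (auto simp: line_point_def)
qed

lemma partial_deriv_bound:
  assumes hol: "(\<lambda>z. f (u(i := z))) holomorphic_on ball 1 \<rho>"
    and u: "u \<in> polydisc1 r (\<rho> / 2)" and i: "i < r" and \<rho>: "\<rho> > 0"
    and bound: "\<And>v. v \<in> polydisc1 r \<rho> \<Longrightarrow> norm (f v) \<le> B"
  shows "norm (partial_deriv i a f u) \<le> fact a * B / (\<rho> / 4) ^ a"
proof -
  have ui: "dist (u i) 1 < \<rho> / 2" using u i by (simp add: polydisc1_def)
  have sub: "cball (u i) (\<rho> / 4) \<subseteq> ball 1 \<rho>"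
  proof
    fix x assume "x \<in> cball (u i) (\<rho> / 4)"
    then show "x \<in> ball 1 \<rho>"
      using ui \<rho> dist_triangle[of x 1 "u i"] by (simp add: dist_commute)
  qed
  have u': "u \<in> polydisc1 r \<rho>" using u polydisc1_mono[of "\<rho> / 2" \<rho> r r] \<rho> by auto
  show ?thesis unfolding partial_deriv_def
  proof (rule Cauchy_inequality)
    show "(\<lambda>z. f (u(i := z))) holomorphic_on ball (u i) (\<rho> / 4)"
      using hol sub by (rule holomorphic_on_subset[OF _ order_trans[OF ball_subset_cball]])
    show "continuous_on (cball (u i) (\<rho> / 4)) (\<lambda>z. f (u(i := z)))"
      using hol sub by (meson continuous_on_subset holomorphic_on_imp_continuous_on)
    fix x assume "norm (u i - x) = \<rho> / 4"
    then have "x \<in> ball 1 \<rho>" using sub by (auto simp: dist_norm)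
    then show "norm (f (u(i := x))) \<le> B" by (intro bound polydisc1_update[OF u' i])
  qed (use \<rho> in auto)
qed

lemma partial_deriv_diff:
  assumes "(\<lambda>z. f (u(i := z))) holomorphic_on A" "(\<lambda>z. g (u(i := z))) holomorphic_on A" "open A" "u i \<in> A"
  shows "partial_deriv i a (\<lambda>v. f v - g v) u = partial_deriv i a f u - partial_deriv i a g u"
  unfolding partial_deriv_def by (intro higher_deriv_diff[OF assms])

text \<open>
  Stated for general filters because sums over the signatures converge along finite subsets.
\<close>

lemma holomorphic_on_uniform_limit:
  assumes "uniform_limit A f g F" "\<forall>\<^sub>F n in F. f n holomorphic_on A" "F \<noteq> bot" "open A"
  shows "g holomorphic_on A"
proof -
  have "\<exists>r>0. g holomorphic_on ball z r" if "z \<in> A" for z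
  proof -
    have "\<exists>r>0. cball z r \<subseteq> A" using open_contains_cball_eq[OF assms(4)] that by simp
    then obtain r where r: "r > 0" "cball z r \<subseteq> A" by blast
    have "\<forall>\<^sub>F n in F. continuous_on (cball z r) (f n) \<and> f n holomorphic_on ball z r"
      using assms(2)
    proof eventually_elim
      case (elim n)
      then show ?case
        using holomorphic_on_subset[OF _ order_trans[OF ball_subset_cball r(2)]]
          continuous_on_subset[OF holomorphic_on_imp_continuous_on r(2)] by blast
    qed
    then have "g holomorphic_on ball z r"
      by (rule holomorphic_uniform_limit[OF _ uniform_limit_on_subset[OF assms(1) r(2)] assms(3)])
    then show ?thesis using r(1) by blast
  qed
  then have "g analytic_on A" by (simp add: analytic_on_def)
  then show ?thesis by (rule analytic_imp_holomorphic)
qed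

lemma uniform_limit_substitute:
  assumes "uniform_limit A f g F" "\<And>x. x \<in> B \<Longrightarrow> h x \<in> A"
  shows "uniform_limit B (\<lambda>n x. f n (h x)) (\<lambda>x. g (h x)) F"
proof (rule uniform_limitI)
  fix e :: real assume "e > 0"
  from uniform_limitD[OF assms(1) this]
  show "\<forall>\<^sub>F n in F. \<forall>x\<in>B. dist (f n (h x)) (g (h x)) < e"
    by eventually_elim (use assms(2) in auto)
qed

text \<open>
  Cauchy's inequality bounds partial derivatives on the half polydisc by the supremum on the polydisc.
\<close>

lemma partial_deriv_uniform_limit:
  assumes hol: "\<forall>\<^sub>F n in F. \<forall>i<r. \<forall>u\<in>polydisc1 r \<rho>. (\<lambda>z. f n (u(i := z))) holomorphic_on ball 1 \<rho>"
    and g: "\<And>i u. i < r \<Longrightarrow> u \<in> polydisc1 r \<rho> \<Longrightarrow> (\<lambda>z. g (u(i := z))) holomorphic_on ball 1 \<rho>"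
    and lim: "uniform_limit (polydisc1 r \<rho>) f g F" and \<rho>: "\<rho> > 0" and i: "i < r"
  shows "uniform_limit (polydisc1 r (\<rho> / 2)) (\<lambda>n. partial_deriv i a (f n)) (partial_deriv i a g) F"
proof (rule uniform_limitI)
  fix e :: real assume e: "e > 0"
  define C where "C = fact a / (\<rho> / 4) ^ a"
  have C: "C > 0" using \<rho> by (simp add: C_def)
  have "\<forall>\<^sub>F n in F. \<forall>u\<in>polydisc1 r \<rho>. dist (f n u) (g u) < e / (2 * C)"
    using lim by (rule uniform_limitD) (use e C in simp)
  with hol show "\<forall>\<^sub>F n in F. \<forall>u\<in>polydisc1 r (\<rho> / 2). dist (partial_deriv i a (f n) u) (partial_deriv i a g u) < e"
  proof eventually_elim
    case (elim n)
    show ?case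
    proof
      fix u assume u: "u \<in> polydisc1 r (\<rho> / 2)"
      then have u': "u \<in> polydisc1 r \<rho>" using polydisc1_mono[of "\<rho> / 2" \<rho> r r] \<rho> by auto
      then have ui: "u i \<in> ball 1 \<rho>" using i by (auto simp: polydisc1_def dist_commute)
      have hols: "(\<lambda>z. f n (u(i := z))) holomorphic_on ball 1 \<rho>" "(\<lambda>z. g (u(i := z))) holomorphic_on ball 1 \<rho>"
        using elim(1) g u' i by auto
      have "norm (partial_deriv i a (\<lambda>v. f n v - g v) u) \<le> fact a * (e / (2 * C)) / (\<rho> / 4) ^ a"
        by (rule partial_deriv_bound[OF _ u i \<rho>])
          (use elim(2) hols in \<open>auto intro!: holomorphic_intros simp: dist_norm less_imp_le\<close>)
      also have "\<dots> = e / 2" using C \<rho> by (simp add: C_def)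
      also have "\<dots> < e" using e by simp
      finally show "dist (partial_deriv i a (f n) u) (partial_deriv i a g u) < e"
        unfolding dist_norm partial_deriv_diff[OF hols open_ball ui] .
    qed
  qed
qed

lemma polydisc_analytic_uniform_limit:
  assumes nice: "\<forall>\<^sub>F n in F. polydisc_analytic r \<rho> (f n)" and lim: "uniform_limit (polydisc1 r \<rho>) f g F"
    and F: "F \<noteq> bot" and \<rho>: "\<rho> > 0"
  shows "polydisc_analytic r \<rho> g"
proof -
  have g: "(\<lambda>z. g (u(i := z))) holomorphic_on ball 1 \<rho>" if "i < r" "u \<in> polydisc1 r \<rho>" for i u
  proof (rule holomorphic_on_uniform_limit[OF _ _ F open_ball])
    show "uniform_limit (ball 1 \<rho>) (\<lambda>n z. f n (u(i := z))) (\<lambda>z. g (u(i := z))) F"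
      using polydisc1_update[OF that(2,1)] by (intro uniform_limit_substitute[OF lim])
    show "\<forall>\<^sub>F n in F. (\<lambda>z. f n (u(i := z))) holomorphic_on ball 1 \<rho>"
      using nice by eventually_elim (use that in \<open>auto simp: polydisc_analytic_def\<close>)
  qed
  moreover have "(\<lambda>t. partial_deriv i a g (line_point s t)) holomorphic_on ball 0 (\<rho> / (2 * real r))"
    if "i < r" "s < r" for i s a
  proof (rule holomorphic_on_uniform_limit[OF _ _ F open_ball])
    have "uniform_limit (polydisc1 r (\<rho> / 2)) (\<lambda>n. partial_deriv i a (f n)) (partial_deriv i a g) F"
      using nice by (intro partial_deriv_uniform_limit[OF _ g lim \<rho> that(1)])
        (auto simp: polydisc_analytic_def elim: eventually_mono)
    then show "uniform_limit (ball 0 (\<rho> / (2 * real r))) (\<lambda>n t. partial_deriv i a (f n) (line_point s t))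
        (\<lambda>t. partial_deriv i a g (line_point s t)) F"
      by (rule uniform_limit_substitute[OF _ line_point_polydisc1[OF _ that(2) \<rho>]])
    show "\<forall>\<^sub>F n in F. (\<lambda>t. partial_deriv i a (f n) (line_point s t)) holomorphic_on ball 0 (\<rho> / (2 * real r))"
      using nice by eventually_elim (use that in \<open>auto simp: polydisc_analytic_def\<close>)
  qed
  ultimately show ?thesis by (auto simp: polydisc_analytic_def)
qed

lemma polydisc_analytic_add:
  assumes "polydisc_analytic r \<rho> f" "polydisc_analytic r \<rho> g" "\<rho> > 0"
  shows "polydisc_analytic r \<rho> (\<lambda>u. f u + g u)"
  unfolding polydisc_analytic_def
proof (intro conjI allI impI ballI)
  fix i u assume "i < r" "u \<in> polydisc1 r \<rho>"
  then show "(\<lambda>z. f (u(i := z)) + g (u(i := z))) holomorphic_on ball 1 \<rho>"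
    using assms by (intro holomorphic_intros) (auto simp: polydisc_analytic_def)
next
  fix i s a assume i: "i < r" "s < r"
  have "(\<lambda>t. partial_deriv i a f (line_point s t) + partial_deriv i a g (line_point s t)) holomorphic_on ball 0 (\<rho> / (2 * real r))"
    using assms i by (intro holomorphic_intros) (auto simp: polydisc_analytic_def)
  then show "(\<lambda>t. partial_deriv i a (\<lambda>u. f u + g u) (line_point s t)) holomorphic_on ball 0 (\<rho> / (2 * real r))"
  proof (rule holomorphic_transform)
    fix t :: complex assume "t \<in> ball 0 (\<rho> / (2 * real r))"
    then have u: "line_point s t \<in> polydisc1 r \<rho>"
      using line_point_polydisc1[OF _ i(2) assms(3)] polydisc1_mono[of "\<rho> / 2" \<rho> r r] assms(3) by auto
    show "partial_deriv i a f (line_point s t) + partial_deriv i a g (line_point s t) =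
        partial_deriv i a (\<lambda>u. f u + g u) (line_point s t)"
      unfolding partial_deriv_def
      by (rule higher_deriv_add[symmetric, where S = "ball 1 \<rho>"])
        (use assms i u in \<open>auto simp: polydisc_analytic_def polydisc1_def dist_commute\<close>)
  qed
qed

lemma polydisc_analytic_cmult:
  assumes "polydisc_analytic r \<rho> f" "\<rho> > 0"
  shows "polydisc_analytic r \<rho> (\<lambda>u. c * f u)"
  unfolding polydisc_analytic_def
proof (intro conjI allI impI ballI)
  fix i u assume "i < r" "u \<in> polydisc1 r \<rho>"
  then show "(\<lambda>z. c * f (u(i := z))) holomorphic_on ball 1 \<rho>"
    using assms by (intro holomorphic_intros) (auto simp: polydisc_analytic_def)
next
  fix i s a assume i: "i < r" "s < r"
  have "(\<lambda>t. c * partial_deriv i a f (line_point s t)) holomorphic_on ball 0 (\<rho> / (2 * real r))"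
    using assms i by (intro holomorphic_intros) (auto simp: polydisc_analytic_def)
  then show "(\<lambda>t. partial_deriv i a (\<lambda>u. c * f u) (line_point s t)) holomorphic_on ball 0 (\<rho> / (2 * real r))"
  proof (rule holomorphic_transform)
    fix t :: complex assume "t \<in> ball 0 (\<rho> / (2 * real r))"
    then have u: "line_point s t \<in> polydisc1 r \<rho>"
      using line_point_polydisc1[OF _ i(2) assms(2)] polydisc1_mono[of "\<rho> / 2" \<rho> r r] assms(2) by auto
    show "c * partial_deriv i a f (line_point s t) = partial_deriv i a (\<lambda>u. c * f u) (line_point s t)"
      unfolding partial_deriv_def
      by (rule higher_deriv_cmult[symmetric, where A = "ball 1 \<rho>"])
        (use assms i u in \<open>auto simp: polydisc_analytic_def polydisc1_def dist_commute\<close>)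
  qed
qed

lemma polydisc_analytic_const0: "polydisc_analytic r \<rho> (\<lambda>_. 0)"
  by (simp add: polydisc_analytic_def partial_deriv_def)

lemma polydisc_analytic_sum:
  assumes "finite X" "\<And>l. l \<in> X \<Longrightarrow> polydisc_analytic r \<rho> (f l)" "\<rho> > 0"
  shows "polydisc_analytic r \<rho> (\<lambda>u. \<Sum>l\<in>X. f l u)"
  using assms(1,2)
  by (induction X rule: finite_induct) (auto intro: polydisc_analytic_const0 polydisc_analytic_add assms(3))

lemma laurent_pos_polydisc_analytic:
  assumes "laurent_pos N f" "0 < \<rho>" "\<rho> \<le> 1" "r \<le> N"
  shows "polydisc_analytic r \<rho> f"
  using assms(1)
proof (induction rule: laurent_pos.induct)
  case (monomial c w)
  have ball0: "0 \<notin> ball (1 :: complex) \<rho>" using assms(3) by (simp add: dist_norm)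
  define D where "D i u = complex_of_real c * (\<Prod>j\<in>{..<N} - {i}. u j powi w j)" for i and u :: "nat \<Rightarrow> complex"
  have D: "complex_of_real c * (\<Prod>j<N. (u(i := z)) j powi w j) = D i u * z powi w i" if "i < r" for i u z
    using that assms(4) unfolding D_def by (subst prod.remove[of _ i]) (auto intro!: prod.cong)
  have pw: "(\<lambda>z. z powi w i) holomorphic_on ball 1 \<rho>" for i
    using ball0 by (intro holomorphic_intros) auto
  show ?case unfolding polydisc_analytic_def
  proof (intro conjI allI impI ballI)
    fix i u assume "i < r" "u \<in> polydisc1 r \<rho>"
    then show "(\<lambda>z. complex_of_real c * (\<Prod>j<N. (u(i := z)) j powi w j)) holomorphic_on ball 1 \<rho>"
      using pw[of i] by (simp only: D) (intro holomorphic_on_mult holomorphic_on_const)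
  next
    fix i s a assume i: "i < r" "s < r"
    let ?B = "ball 0 (\<rho> / (2 * real r))"
    have lp: "line_point s t j \<in> ball 1 \<rho>" if "t \<in> ?B" for t j
      using line_point_polydisc1[OF that i(2) assms(2)] assms(2)
      by (cases "j < r") (auto simp: polydisc1_def dist_commute intro: less_trans)
    have lp_hol: "(\<lambda>t. line_point s t j) holomorphic_on ?B" for j
      by (cases "j \<le> s") (auto simp: line_point_def intro!: holomorphic_intros)
    have "(\<lambda>t. D i (line_point s t) * (deriv ^^ a) (\<lambda>z. z powi w i) (line_point s t i)) holomorphic_on ?B"
    proof (intro holomorphic_on_mult)
      show "(\<lambda>t. D i (line_point s t)) holomorphic_on ?B"
        unfolding D_def using lp ball0 by (intro holomorphic_intros lp_hol) metis
      have "(deriv ^^ a) (\<lambda>z. z powi w i) holomorphic_on ball 1 \<rho>"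
        using pw by (intro holomorphic_higher_deriv) auto
      from holomorphic_on_compose_gen[OF lp_hol[of i] this] lp
      show "(\<lambda>t. (deriv ^^ a) (\<lambda>z. z powi w i) (line_point s t i)) holomorphic_on ?B"
        by (auto simp: comp_def image_subset_iff)
    qed
    then show "(\<lambda>t. partial_deriv i a (\<lambda>u. complex_of_real c * (\<Prod>i<N. u i powi w i)) (line_point s t)) holomorphic_on ?B"
    proof (rule holomorphic_transform)
      fix t :: complex assume "t \<in> ?B"
      then show "D i (line_point s t) * (deriv ^^ a) (\<lambda>z. z powi w i) (line_point s t i) =
          partial_deriv i a (\<lambda>u. complex_of_real c * (\<Prod>i<N. u i powi w i)) (line_point s t)"
        unfolding partial_deriv_def D[OF i(1)] using lp pw
        by (intro higher_deriv_cmult[symmetric, where A = "ball 1 \<rho>"]) auto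
    qed
  qed
qed (use assms in \<open>auto intro: polydisc_analytic_add\<close>)

section \<open>Expected power sums\<close>

lemma uniform_limit_sum:
  fixes f :: "'i \<Rightarrow> 'n \<Rightarrow> 'a \<Rightarrow> 'b :: real_normed_vector"
  assumes "finite I" "\<And>i. i \<in> I \<Longrightarrow> uniform_limit A (f i) (g i) F"
  shows "uniform_limit A (\<lambda>n x. \<Sum>i\<in>I. f i n x) (\<lambda>x. \<Sum>i\<in>I. g i x) F"
  using assms
  by (induction I rule: finite_induct) (auto intro: uniform_limit_add uniform_limit_const)

lemma uniform_limit_bounded_factor:
  fixes c g :: "'a \<Rightarrow> 'b :: real_normed_algebra"
  assumes "bounded (c ` A)" "uniform_limit A f g F"
  shows "uniform_limit A (\<lambda>n x. c x * f n x) (\<lambda>x. c x * g x) F"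
proof -
  obtain C where C: "C > 0" "\<And>x. x \<in> A \<Longrightarrow> norm (c x) \<le> C"
    using assms(1) by (auto simp: bounded_pos)
  show ?thesis
  proof (rule uniform_limitI)
    fix e :: real assume e: "e > 0"
    have "\<forall>\<^sub>F n in F. \<forall>x\<in>A. dist (f n x) (g x) < e / C"
      using uniform_limitD[OF assms(2)] e C by simp
    then show "\<forall>\<^sub>F n in F. \<forall>x\<in>A. dist (c x * f n x) (c x * g x) < e"
    proof eventually_elim
      case (elim n)
      have "norm (c x * (f n x - g x)) < e" if "x \<in> A" for x
        using elim that C order.strict_trans1[OF norm_mult_ineq, of "c x" "f n x - g x" e]
          mult_right_mono[OF C(2)[OF that] norm_ge_zero[of "f n x - g x"]]
        by (force simp: dist_norm field_simps)
      then show ?case by (simp add: dist_norm right_diff_distrib)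
    qed
  qed
qed

lemma confluent_sum_holomorphic:
  assumes f: "polydisc_analytic r \<rho> f" and "s < r" "\<rho> > 0"
  shows "confluent_sum s m f holomorphic_on ball 0 (\<rho> / (2 * real r))"
proof -
  have "(\<lambda>t. line_point s t i) holomorphic_on A" for i A
    by (cases "i \<le> s") (auto simp: line_point_def intro!: holomorphic_intros)
  moreover have "(\<lambda>t. partial_deriv i a f (line_point s t)) holomorphic_on ball 0 (\<rho> / (2 * real r))" if "i \<le> s" for i a
    using f assms(2) that by (auto simp: polydisc_analytic_def)
  ultimately show ?thesis unfolding confluent_sum_def[abs_def]
    by (intro holomorphic_intros) auto
qed

lemma confluent_sum_uniform_limit:
  assumes nice: "\<forall>\<^sub>F n in F. polydisc_analytic r \<rho> (f n)" and lim: "uniform_limit (polydisc1 r \<rho>) f g F"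
    and F: "F \<noteq> bot" and \<rho>: "\<rho> > 0" and s: "s < r"
  shows "uniform_limit (ball 0 (\<rho> / (2 * real r))) (\<lambda>n. confluent_sum s m (f n)) (confluent_sum s m g) F"
proof -
  have g: "polydisc_analytic r \<rho> g" by (rule polydisc_analytic_uniform_limit[OF nice lim F \<rho>])
  let ?B = "ball 0 (\<rho> / (2 * real r)) :: complex set"
  have pd: "uniform_limit ?B (\<lambda>n t. partial_deriv i a (f n) (line_point s t)) (\<lambda>t. partial_deriv i a g (line_point s t)) F"
    if "i \<le> s" for i a
  proof (rule uniform_limit_substitute[OF _ line_point_polydisc1[OF _ s \<rho>]])
    show "uniform_limit (polydisc1 r (\<rho> / 2)) (\<lambda>n. partial_deriv i a (f n)) (partial_deriv i a g) F"
      using nice g s that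
      by (intro partial_deriv_uniform_limit[OF _ _ lim \<rho>]) (auto simp: polydisc_analytic_def elim: eventually_mono)
  qed
  have bdd: "bounded ((\<lambda>t. line_point s t i ^ m / c) ` ?B)" if "i \<le> s" for i c
  proof -
    have "line_point s t i \<in> ball 1 (\<rho> / 2)" if "t \<in> ?B" for t
      using line_point_polydisc1[OF that s \<rho>] \<open>i \<le> s\<close> s by (simp add: polydisc1_def dist_commute)
    moreover have "bounded ((\<lambda>z. z ^ m / c) ` ball 1 (\<rho> / 2))"
      by (intro bounded_subset[OF compact_imp_bounded[OF compact_continuous_image[OF _ compact_cball]] image_mono[OF ball_subset_cball]])
        (cases "c = 0"; auto intro!: continuous_intros)
    ultimately show ?thesis by (rule_tac bounded_subset) auto
  qed
  have "confluent_sum s m f = (\<lambda>t. \<Sum>i\<le>s. line_point s t i ^ m / (\<Prod>j\<in>{..s} - {i}. of_nat i - of_nat j) *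
      partial_deriv i (m - s) f (line_point s t))" for f
    by (simp add: confluent_sum_def fun_eq_iff)
  then show ?thesis
    by (simp only:) (intro uniform_limit_sum uniform_limit_bounded_factor pd bdd, auto)
qed

lemma confluent_sum_cong:
  assumes "\<And>u. u \<in> polydisc1 r \<rho> \<Longrightarrow> f u = g u" and "s < r" "\<rho> > 0" "t \<in> ball 0 (\<rho> / (2 * real r))"
  shows "confluent_sum s m f t = confluent_sum s m g t"
proof -
  let ?u = "line_point s t"
  have u: "?u \<in> polydisc1 r \<rho>"
    using line_point_polydisc1[OF assms(4,2,3)] polydisc1_mono[of "\<rho> / 2" \<rho> r r] assms(3) by auto
  have "partial_deriv i a f ?u = partial_deriv i a g ?u" if "i \<le> s" for i a
    unfolding partial_deriv_def
  proof (rule higher_deriv_cong_ev)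
    have "?u i \<in> ball 1 \<rho>" using u that assms(2) by (auto simp: polydisc1_def dist_commute)
    then have "\<forall>\<^sub>F z in nhds (?u i). z \<in> ball 1 \<rho>" by (intro eventually_nhds_in_open) auto
    then show "\<forall>\<^sub>F z in nhds (?u i). f (?u(i := z)) = g (?u(i := z))"
      by eventually_elim (use polydisc1_update[OF u] that assms(1,2) in auto)
  qed simp
  then show ?thesis by (simp add: confluent_sum_def)
qed

lemma confluent_sum_linear:
  assumes "polydisc_analytic r \<rho> f" and "s < r" "\<rho> > 0" "t \<in> ball 0 (\<rho> / (2 * real r))"
  shows "confluent_sum s m (\<lambda>u. c * f u) t = c * confluent_sum s m f t"
    and "polydisc_analytic r \<rho> g \<Longrightarrow> confluent_sum s m (\<lambda>u. f u + g u) t = confluent_sum s m f t + confluent_sum s m g t"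
proof -
  let ?u = "line_point s t"
  have u: "?u \<in> polydisc1 r \<rho>"
    using line_point_polydisc1[OF assms(4,2,3)] polydisc1_mono[of "\<rho> / 2" \<rho> r r] assms(3) by auto
  have ui: "?u i \<in> ball 1 \<rho>" if "i \<le> s" for i using u that assms(2) by (auto simp: polydisc1_def dist_commute)
  have hol: "(\<lambda>z. f (?u(i := z))) holomorphic_on ball 1 \<rho>" if "i \<le> s" for i
    using that assms u by (auto simp: polydisc_analytic_def)
  have "partial_deriv i a (\<lambda>u. c * f u) ?u = c * partial_deriv i a f ?u" if "i \<le> s" for i a
    unfolding partial_deriv_def using hol[OF that] ui[OF that] by (intro higher_deriv_cmult) auto
  then show "confluent_sum s m (\<lambda>u. c * f u) t = c * confluent_sum s m f t"
    by (simp add: confluent_sum_def sum_distrib_left mult_ac)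
  assume "polydisc_analytic r \<rho> g"
  then have holg: "(\<lambda>z. g (?u(i := z))) holomorphic_on ball 1 \<rho>" if "i \<le> s" for i
    using that assms u by (auto simp: polydisc_analytic_def)
  have "partial_deriv i a (\<lambda>u. f u + g u) ?u = partial_deriv i a f ?u + partial_deriv i a g ?u" if "i \<le> s" for i a
    unfolding partial_deriv_def using hol[OF that] holg[OF that] ui[OF that] by (intro higher_deriv_add) auto
  then show "confluent_sum s m (\<lambda>u. f u + g u) t = confluent_sum s m f t + confluent_sum s m g t"
    by (simp add: confluent_sum_def distrib_left add_divide_distrib sum.distrib)
qed

lemma confluent_sum_sum:
  assumes "finite X" "\<And>l. l \<in> X \<Longrightarrow> polydisc_analytic r \<rho> (f l)" and "s < r" "\<rho> > 0" "t \<in> ball 0 (\<rho> / (2 * real r))"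
  shows "confluent_sum s m (\<lambda>u. \<Sum>l\<in>X. f l u) t = (\<Sum>l\<in>X. confluent_sum s m (f l) t)"
  using assms(1,2)
proof (induction X rule: finite_induct)
  case empty
  then show ?case by (simp add: confluent_sum_def partial_deriv_def)
next
  case (insert l X)
  have "polydisc_analytic r \<rho> (\<lambda>u. \<Sum>l\<in>X. f l u)"
    using insert assms(4) by (intro polydisc_analytic_sum) auto
  then show ?case using insert confluent_sum_linear(2)[OF _ assms(3-5)] by simp
qed

text \<open>
  The partial sums converge uniformly by the Weierstrass test, and derivatives at \<open>t = 0\<close> of the
  confluent sums are continuous under uniform convergence on the polydisc.
\<close>

lemma has_sum_confluent_coeff:
  assumes nice: "\<And>l. l \<in> I \<Longrightarrow> polydisc_analytic r \<rho> (f l)"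
    and dom: "M summable_on I" "\<And>l u. l \<in> I \<Longrightarrow> u \<in> polydisc1 r \<rho> \<Longrightarrow> norm (f l u) \<le> M l"
    and \<rho>: "\<rho> > 0" and r: "r \<ge> 1"
  defines "g \<equiv> (\<lambda>u. \<Sum>\<^sub>\<infinity>l\<in>I. f l u)"
  shows "polydisc_analytic r \<rho> g"
    and "s < r \<Longrightarrow> ((\<lambda>l. (deriv ^^ q) (confluent_sum s m (f l)) 0) has_sum (deriv ^^ q) (confluent_sum s m g) 0) I"
proof -
  let ?F = "finite_subsets_at_top I"
  have lim: "uniform_limit (polydisc1 r \<rho>) (\<lambda>X u. \<Sum>l\<in>X. f l u) g ?F"
    unfolding g_def using dom(2,1) by (rule Weierstrass_m_test_general)
  have ev: "\<forall>\<^sub>F X in ?F. finite X \<and> X \<subseteq> I"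
    by (rule eventually_finite_subsets_at_top_weakI) simp
  then have nice_sum: "\<forall>\<^sub>F X in ?F. polydisc_analytic r \<rho> (\<lambda>u. \<Sum>l\<in>X. f l u)"
    by eventually_elim (auto intro!: polydisc_analytic_sum nice \<rho>)
  show "polydisc_analytic r \<rho> g"
    by (rule polydisc_analytic_uniform_limit[OF nice_sum lim _ \<rho>]) simp
  assume s: "s < r"
  let ?B = "ball 0 (\<rho> / (2 * real r)) :: complex set"
  have 0: "0 \<in> ?B" using \<rho> r by simp
  have "((\<lambda>X. (deriv ^^ q) (confluent_sum s m (\<lambda>u. \<Sum>l\<in>X. f l u)) 0) \<longlongrightarrow> (deriv ^^ q) (confluent_sum s m g) 0) ?F"
  proof (rule higher_deriv_complex_uniform_limit)
    show "uniform_limit ?B (\<lambda>X. confluent_sum s m (\<lambda>u. \<Sum>l\<in>X. f l u)) (confluent_sum s m g) ?F"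
      by (rule confluent_sum_uniform_limit[OF nice_sum lim _ \<rho> s]) simp
    show "\<forall>\<^sub>F X in ?F. confluent_sum s m (\<lambda>u. \<Sum>l\<in>X. f l u) holomorphic_on ?B"
      using nice_sum by eventually_elim (rule confluent_sum_holomorphic[OF _ s \<rho>])
  qed (use 0 in auto)
  moreover have "\<forall>\<^sub>F X in ?F. (deriv ^^ q) (confluent_sum s m (\<lambda>u. \<Sum>l\<in>X. f l u)) 0 =
      (\<Sum>l\<in>X. (deriv ^^ q) (confluent_sum s m (f l)) 0)"
    using ev
  proof eventually_elim
    case (elim X)
    have "(deriv ^^ q) (confluent_sum s m (\<lambda>u. \<Sum>l\<in>X. f l u)) 0 = (deriv ^^ q) (\<lambda>t. \<Sum>l\<in>X. confluent_sum s m (f l) t) 0"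
    proof (rule higher_deriv_cong_ev)
      have "\<forall>\<^sub>F t in nhds 0. t \<in> ?B" using 0 by (intro eventually_nhds_in_open) auto
      then show "\<forall>\<^sub>F t in nhds 0. confluent_sum s m (\<lambda>u. \<Sum>l\<in>X. f l u) t = (\<Sum>l\<in>X. confluent_sum s m (f l) t)"
        by eventually_elim (use elim nice in \<open>auto intro!: confluent_sum_sum[OF _ _ s \<rho>]\<close>)
    qed simp
    also have "\<dots> = (\<Sum>l\<in>X. (deriv ^^ q) (confluent_sum s m (f l)) 0)"
      using elim 0 by (intro higher_deriv_sum[where S = ?B] confluent_sum_holomorphic[OF nice s \<rho>]) auto
    finally show ?case .
  qed
  ultimately show "((\<lambda>l. (deriv ^^ q) (confluent_sum s m (f l)) 0) has_sum (deriv ^^ q) (confluent_sum s m g) 0) I"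
    unfolding has_sum_def by (simp add: tendsto_cong)
qed

text \<open>
  A term of the generating function is a constant multiple of a Schur function, normalized to have
  the value \<open>\<rho>(\<lambda>)\<close> at the point with all coordinates \<open>1\<close>.
\<close>

lemma sgf_term_confluent:
  assumes l: "l \<in> signatures N" and N: "N \<ge> 1" and \<rho>: "0 < \<rho>" "\<rho> \<le> 1"
  shows "r \<le> N \<Longrightarrow> polydisc_analytic r \<rho> (\<lambda>u. sgf_term p u l)"
    and "s < N \<Longrightarrow> q < s \<Longrightarrow> (deriv ^^ q) (confluent_sum s m (\<lambda>u. sgf_term p u l)) 0 = 0"
    and "of_real (pmf p l) * (\<Sum>j<N. of_int (schur_exponent l j) ^ k) =
      confluent_expansion N k (\<lambda>u. sgf_term p u l)"
proof -
  obtain f where f: "laurent_pos N f" "product_span N f"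
    and alt: "\<And>u. (\<And>i. i < N \<Longrightarrow> u i \<noteq> 0) \<Longrightarrow> alternant N (schur_exponent l) u = vandermonde N u * f u"
    and schur: "\<And>u. (\<And>i. i < N \<Longrightarrow> u i \<noteq> 0) \<Longrightarrow> schur l u = f u"
    using schur_laurent[OF l N] by blast
  have f1: "f (\<lambda>_. 1) \<noteq> 0" using laurent_pos_at_1[OF f(1)] by auto
  define c where "c = of_real (pmf p l) / f (\<lambda>_. 1)"
  have nz: "u i \<noteq> 0" if "u \<in> polydisc1 r \<rho>" for u i r
    using that \<rho> by (cases "i < r") (auto simp: polydisc1_def dist_norm dest!: spec[of _ i])
  have eq: "sgf_term p u l = c * f u" if "u \<in> polydisc1 r \<rho>" for u r
    using schur[OF nz[OF that]] schur[of "\<lambda>_. 1"] by (simp add: sgf_term_def c_def)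
  show an: "polydisc_analytic r \<rho> (\<lambda>u. sgf_term p u l)" if "r \<le> N" for r
  proof -
    have cf: "polydisc_analytic r \<rho> (\<lambda>u. c * f u)"
      using laurent_pos_polydisc_analytic[OF f(1) \<rho> that] \<rho>(1) by (rule polydisc_analytic_cmult)
    have lim: "uniform_limit (polydisc1 r \<rho>) (\<lambda>(_ :: nat) u. c * f u) (\<lambda>u. sgf_term p u l) sequentially"
      by (rule uniform_limitI) (simp add: eq)
    show ?thesis
      by (rule polydisc_analytic_uniform_limit[OF always_eventually[OF allI[OF cf]] lim sequentially_bot \<rho>(1)])
  qed
  have fN: "polydisc_analytic N \<rho> f" by (rule laurent_pos_polydisc_analytic[OF f(1) \<rho> order_refl])
  let ?B = "ball 0 (\<rho> / (2 * real N)) :: complex set"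
  have 0: "0 \<in> ?B" using \<rho> N by simp
  have der: "(deriv ^^ q) (confluent_sum s m (\<lambda>u. sgf_term p u l)) 0 = c * (deriv ^^ q) (confluent_sum s m f) 0"
    if s: "s < N" for s q m
  proof -
    have "(deriv ^^ q) (confluent_sum s m (\<lambda>u. sgf_term p u l)) 0 = (deriv ^^ q) (\<lambda>t. c * confluent_sum s m f t) 0"
    proof (rule higher_deriv_cong_ev)
      have "\<forall>\<^sub>F t in nhds 0. t \<in> ?B" using 0 by (intro eventually_nhds_in_open) auto
      then show "\<forall>\<^sub>F t in nhds 0. confluent_sum s m (\<lambda>u. sgf_term p u l) t = c * confluent_sum s m f t"
      proof eventually_elim
        case (elim t)
        have "confluent_sum s m (\<lambda>u. sgf_term p u l) t = confluent_sum s m (\<lambda>u. c * f u) t"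
          using eq s \<rho>(1) elim by (rule confluent_sum_cong)
        then show ?case using confluent_sum_linear(1)[OF fN s \<rho>(1) elim] by simp
      qed
    qed simp
    also have "\<dots> = c * (deriv ^^ q) (confluent_sum s m f) 0"
      using 0 by (intro higher_deriv_cmult[where A = ?B] confluent_sum_holomorphic[OF fN s \<rho>(1)]) auto
    finally show ?thesis .
  qed
  show "(deriv ^^ q) (confluent_sum s m (\<lambda>u. sgf_term p u l)) 0 = 0" if "s < N" "q < s"
    using product_span_confluent_good[OF f(2)] that by (simp add: der confluent_good_def)
  have coeff: "of_nat (N choose Suc s) * confluent_coeff s m (\<lambda>u. sgf_term p u l) =
      c * (of_nat (N choose Suc s) * confluent_coeff s m f)" for s m
    by (cases "s < N") (simp_all add: confluent_coeff_def der binomial_eq_0)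
  have "of_real (pmf p l) * (\<Sum>j<N. of_int (schur_exponent l j) ^ k) =
      c * ((\<Sum>j<N. of_int (schur_exponent l j) ^ k) * f (\<lambda>_. 1))"
    using f1 by (simp add: c_def)
  also have "(\<Sum>j<N. of_int (schur_exponent l j) ^ k) * f (\<lambda>_. 1) = confluent_expansion N k f"
    by (rule power_sum_eq_confluent_expansion[OF f alt])
  also have "c * confluent_expansion N k f = confluent_expansion N k (\<lambda>u. sgf_term p u l)"
    unfolding coeff confluent_expansion_def stirling_sum_cmult ..
  finally show "of_real (pmf p l) * (\<Sum>j<N. of_int (schur_exponent l j) ^ k) =
      confluent_expansion N k (\<lambda>u. sgf_term p u l)" .
qed

text \<open>
  The number \<open>r\<close> of variables on which the series is controlled may be smaller than \<open>N\<close>: confluent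
  coefficients with \<open>s \<ge> N\<close> come with a vanishing binomial coefficient, and those with \<open>s \<le> k\<close>
  involve at most \<open>k + 1\<close> variables.
\<close>

theorem expected_power_sum:
  assumes N: "N \<ge> 1" and \<rho>: "0 < \<rho>" "\<rho> \<le> 1" and r: "1 \<le> r" "r \<le> N" "\<And>s. s \<le> k \<Longrightarrow> s < N \<Longrightarrow> s < r"
    and dom: "M summable_on signatures N"
      "\<And>l u. l \<in> signatures N \<Longrightarrow> u \<in> polydisc1 r \<rho> \<Longrightarrow> norm (sgf_term p u l) \<le> M l"
  shows "((\<lambda>l. of_real (pmf p l) * (\<Sum>j<N. of_int (schur_exponent l j) ^ k)) has_sum
      confluent_expansion N k (sgf N p)) (signatures N)"
    and "polydisc_analytic r \<rho> (sgf N p)"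
    and "s < r \<Longrightarrow> q < s \<Longrightarrow> (deriv ^^ q) (confluent_sum s m (sgf N p)) 0 = 0"
proof -
  have sgf_eq: "sgf N p = (\<lambda>u. \<Sum>\<^sub>\<infinity>l\<in>signatures N. sgf_term p u l)" by (simp add: sgf_def fun_eq_iff)
  have nice: "polydisc_analytic r \<rho> (\<lambda>u. sgf_term p u l)" if "l \<in> signatures N" for l
    by (rule sgf_term_confluent(1)[OF that N \<rho> r(2)])
  have hs: "((\<lambda>l. (deriv ^^ q) (confluent_sum s m (\<lambda>u. sgf_term p u l)) 0) has_sum
      (deriv ^^ q) (confluent_sum s m (sgf N p)) 0) (signatures N)" if "s < r" for q s m
    unfolding sgf_eq using that
    by (intro has_sum_confluent_coeff(2)[where M = M and \<rho> = \<rho> and r = r] nice dom \<rho>(1) r(1))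
  show "polydisc_analytic r \<rho> (sgf N p)" unfolding sgf_eq
    by (intro has_sum_confluent_coeff(1)[where M = M] nice dom \<rho>(1) r(1))
  show "(deriv ^^ q) (confluent_sum s m (sgf N p)) 0 = 0" if "s < r" "q < s"
  proof -
    have "(deriv ^^ q) (confluent_sum s m (\<lambda>u. sgf_term p u l)) 0 = 0" if "l \<in> signatures N" for l
      using \<open>s < r\<close> \<open>q < s\<close> r(2) by (intro sgf_term_confluent(2)[OF that N \<rho>]) auto
    then have "((\<lambda>l. 0) has_sum (deriv ^^ q) (confluent_sum s m (sgf N p)) 0) (signatures N)"
      using hs[OF that(1), of q m] by (simp cong: has_sum_cong)
    then show ?thesis by (metis has_sum_0 has_sum_unique)
  qed
  have "((\<lambda>l. of_nat (N choose Suc s) * confluent_coeff s m (\<lambda>u. sgf_term p u l)) has_sum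
      of_nat (N choose Suc s) * confluent_coeff s m (sgf N p)) (signatures N)"
    if ms: "s \<le> m" "m \<le> k" for m s
  proof (cases "s < N")
    case True
    then have "s < r" using r(3) ms by auto
    then show ?thesis unfolding confluent_coeff_def divide_inverse
      by (intro has_sum_cmult_right has_sum_cmult_left hs)
  qed (simp add: binomial_eq_0)
  then have "((\<lambda>l. confluent_expansion N k (\<lambda>u. sgf_term p u l)) has_sum confluent_expansion N k (sgf N p)) (signatures N)"
    unfolding confluent_expansion_def by (rule has_sum_stirling_sum)
  then show "((\<lambda>l. of_real (pmf p l) * (\<Sum>j<N. of_int (schur_exponent l j) ^ k)) has_sum
      confluent_expansion N k (sgf N p)) (signatures N)"
    by (subst has_sum_cong[OF sgf_term_confluent(3)[OF _ N \<rho>]])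
qed

section \<open>Derivatives of the exponential of a large function\<close>

text \<open>
  On a disc there is a holomorphic logarithm, and two continuous logarithms differ by a constant.
\<close>

lemma continuous_log_holomorphic:
  assumes cont: "continuous_on (ball c \<rho>) g" and hol: "h holomorphic_on ball c \<rho>"
    and exp: "\<And>z. z \<in> ball c \<rho> \<Longrightarrow> exp (g z) = h z"
  shows "g holomorphic_on ball c \<rho>"
proof -
  have "h z \<noteq> 0" if "z \<in> ball c \<rho>" for z using exp[OF that] by auto
  then obtain G where G: "G holomorphic_on ball c \<rho>" "\<And>z. z \<in> ball c \<rho> \<Longrightarrow> h z = exp (G z)"
    using contractible_imp_holomorphic_log[OF hol convex_imp_contractible[OF convex_ball]] by metis
  have int: "\<exists>n. g z - G z = of_real (2 * pi) * \<i> * of_int n" if "z \<in> ball c \<rho>" for z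
  proof -
    have "exp (g z) = exp (G z)" using exp[OF that] G(2)[OF that] by simp
    then obtain n where "g z = G z + (of_int (2 * n) * pi) * \<i>" by (auto simp: exp_eq)
    then show ?thesis by (intro exI[of _ n]) (simp add: algebra_simps)
  qed
  have "(\<lambda>z. g z - G z) constant_on ball c \<rho>"
  proof (rule continuous_discrete_range_constant)
    show "continuous_on (ball c \<rho>) (\<lambda>z. g z - G z)"
      by (intro continuous_on_diff cont holomorphic_on_imp_continuous_on[OF G(1)])
    fix x assume x: "x \<in> ball c \<rho>"
    have "2 * pi \<le> norm (g y - G y - (g x - G x))" if y: "y \<in> ball c \<rho>" "g y - G y \<noteq> g x - G x" for y
    proof -
      obtain m n where mn: "g y - G y = of_real (2 * pi) * \<i> * of_int m" "g x - G x = of_real (2 * pi) * \<i> * of_int n"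
        using int[OF y(1)] int[OF x] by blast
      then have "m \<noteq> n" using y(2) by auto
      then have "1 \<le> \<bar>real_of_int (m - n)\<bar>" by linarith
      then have "2 * pi * 1 \<le> 2 * pi * \<bar>real_of_int (m - n)\<bar>" by (intro mult_left_mono) auto
      moreover have "norm (g y - G y - (g x - G x)) = 2 * pi * \<bar>real_of_int (m - n)\<bar>"
        unfolding mn right_diff_distrib[symmetric] of_int_diff[symmetric] norm_mult norm_of_int by simp
      ultimately show ?thesis by simp
    qed
    then show "\<exists>e>0. \<forall>y. y \<in> ball c \<rho> \<and> g y - G y \<noteq> g x - G x \<longrightarrow> e \<le> norm (g y - G y - (g x - G x))"
      by (intro exI[of _ "2 * pi"]) auto
  qed simp
  then obtain a where "\<And>z. z \<in> ball c \<rho> \<Longrightarrow> g z - G z = a" by (auto simp: constant_on_def)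
  then have "(\<lambda>z. G z + a) holomorphic_on ball c \<rho> \<longleftrightarrow> g holomorphic_on ball c \<rho>"
    by (intro holomorphic_cong) (auto simp: algebra_simps)
  then show ?thesis using G(1) by (auto intro: holomorphic_intros)
qed

lemma holomorphic_bounded_smaller_ball:
  assumes "f holomorphic_on ball c \<rho>" "\<rho>' < \<rho>"
  shows "bounded (f ` ball c \<rho>')"
proof -
  have "compact (f ` cball c \<rho>')"
    using assms by (intro compact_continuous_image continuous_on_subset[OF holomorphic_on_imp_continuous_on[OF assms(1)]]) auto
  then show ?thesis by (rule bounded_subset[OF compact_imp_bounded]) auto
qed

lemma bounded_image_snd: "bounded (f ` B) \<Longrightarrow> bounded ((\<lambda>x. f (snd x)) ` (T \<times> B))"
  by (rule bounded_subset) auto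

text \<open>
  The parameter \<open>p\<close> stands for the remaining variables, in which the convergence is uniform.
\<close>

lemma uniform_limit_deriv:
  fixes X :: "'n \<Rightarrow> 'p \<Rightarrow> complex \<Rightarrow> complex"
  assumes lim: "uniform_limit (T \<times> ball c \<rho>) (\<lambda>n x. X n (fst x) (snd x)) (\<lambda>x. Y (snd x)) F"
    and hol: "\<forall>\<^sub>F n in F. \<forall>p\<in>T. X n p holomorphic_on ball c \<rho>" and Y: "Y holomorphic_on ball c \<rho>"
    and \<rho>: "\<rho>' < \<rho>"
  shows "uniform_limit (T \<times> ball c \<rho>') (\<lambda>n x. deriv (X n (fst x)) (snd x)) (\<lambda>x. deriv Y (snd x)) F"
proof (rule uniform_limitI)
  define d where "d = (\<rho> - \<rho>') / 2"
  have d: "d > 0" using \<rho> by (simp add: d_def)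
  fix e :: real assume e: "e > 0"
  have "\<forall>\<^sub>F n in F. \<forall>x\<in>T \<times> ball c \<rho>. dist (X n (fst x) (snd x)) (Y (snd x)) < e * d / 2"
    using lim by (rule uniform_limitD) (use e d in simp)
  with hol show "\<forall>\<^sub>F n in F. \<forall>x\<in>T \<times> ball c \<rho>'. dist (deriv (X n (fst x)) (snd x)) (deriv Y (snd x)) < e"
  proof eventually_elim
    case (elim n)
    show ?case
    proof
      fix x assume "x \<in> T \<times> ball c \<rho>'"
      then obtain p z where x: "x = (p, z)" "p \<in> T" "z \<in> ball c \<rho>'" by auto
      have sub: "cball z d \<subseteq> ball c \<rho>"
      proof
        fix w assume w: "w \<in> cball z d"
        have "dist c w \<le> dist c z + dist z w" by (rule dist_triangle)
        also have "\<dots> < \<rho>" using w x(3) \<rho> by (simp add: d_def)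
        finally show "w \<in> ball c \<rho>" by simp
      qed
      have Xp: "X n p holomorphic_on ball c \<rho>" using elim(1) x(2) by blast
      have z: "z \<in> ball c \<rho>" using x(3) \<rho> by simp
      have sub': "ball z d \<subseteq> ball c \<rho>" using ball_subset_cball sub by (rule order_trans)
      have "norm ((deriv ^^ 1) (\<lambda>w. X n p w - Y w) z) \<le> fact 1 * (e * d / 2) / d ^ 1"
      proof (rule Cauchy_inequality)
        show "(\<lambda>w. X n p w - Y w) holomorphic_on ball z d"
          by (intro holomorphic_on_diff holomorphic_on_subset[OF Xp sub'] holomorphic_on_subset[OF Y sub'])
        show "continuous_on (cball z d) (\<lambda>w. X n p w - Y w)"
          using sub by (intro continuous_intros continuous_on_subset[OF holomorphic_on_imp_continuous_on[OF Xp]]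
              continuous_on_subset[OF holomorphic_on_imp_continuous_on[OF Y]])
        fix w assume "norm (z - w) = d"
        then have "w \<in> ball c \<rho>" using sub by (auto simp: dist_norm)
        then show "norm (X n p w - Y w) \<le> e * d / 2"
          using elim(2) x(2) by (force simp: dist_norm)
      qed (rule d)
      also have "(deriv ^^ 1) (\<lambda>w. X n p w - Y w) z = deriv (X n p) z - deriv Y z"
        using higher_deriv_diff[OF Xp Y open_ball z, of 1] by simp
      finally have "dist (deriv (X n p) z) (deriv Y z) \<le> e / 2" using d by (simp add: dist_norm)
      then show "dist (deriv (X n (fst x)) (snd x)) (deriv Y (snd x)) < e" using e x by simp
    qed
  qed
qed

text \<open>
  The coefficient of \<open>N\<^sup>a\<^sup>-\<^sup>1\<close> in \<open>exp(- N \<psi> - \<phi>)\<close> times the \<open>a\<close>-th derivative of \<open>exp(N \<psi> + \<phi>)\<close>.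
\<close>

definition log_correction :: "nat \<Rightarrow> (complex \<Rightarrow> complex) \<Rightarrow> (complex \<Rightarrow> complex) \<Rightarrow> complex \<Rightarrow> complex" where
  "log_correction a \<psi> \<phi> z = of_nat a * deriv \<psi> z ^ (a - 1) * deriv \<phi> z +
     of_nat (a choose 2) * deriv \<psi> z ^ (a - 2) * deriv (deriv \<psi>) z"

lemma log_correction_Suc:
  "log_correction (Suc a) \<psi> \<phi> z = of_nat a * deriv \<psi> z ^ (a - 1) * deriv (deriv \<psi>) z +
    deriv \<psi> z * log_correction a \<psi> \<phi> z + deriv \<phi> z * deriv \<psi> z ^ a"
proof -
  have "of_nat (Suc a choose 2) = (of_nat a + of_nat (a choose 2) :: complex)"
    by (simp add: numeral_2_eq_2)
  note step = this
  consider "a = 0" | "a = 1" | b where "a = Suc (Suc b)"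
    by (metis One_nat_def old.nat.exhaust)
  then show ?thesis
  proof cases
    case 3
    then show ?thesis unfolding log_correction_def step by (simp add: algebra_simps)
  qed (simp_all add: log_correction_def numeral_2_eq_2)
qed

lemma log_correction_holomorphic:
  assumes "\<psi> holomorphic_on A" "\<phi> holomorphic_on A" "open A"
  shows "log_correction a \<psi> \<phi> holomorphic_on A"
  unfolding log_correction_def[abs_def] using assms by (intro holomorphic_intros) auto

text \<open>
  With \<open>G a = exp(- L) \<partial>\<^sup>a exp L / N\<^sup>a\<close> one has \<open>G (a + 1) = (G a)' / N + (L' / N) G a\<close>.
  Inserting \<open>L' = N \<psi>' + M'\<close>, where \<open>M = L - N \<psi> - \<kappa>\<close> converges to \<open>\<phi>\<close>, gives a recursion for
  \<open>X a = N (G a - \<psi>'\<^sup>a)\<close>, in which every term has a uniform limit; the limits obey the recursion of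
  \<open>log_correction\<close>.  Each step differentiates, and so costs a little of the disc.
\<close>

lemma uniform_exp_derivative_expansion:
  fixes L :: "nat \<Rightarrow> 'p \<Rightarrow> complex \<Rightarrow> complex"
  assumes \<psi>: "\<psi> holomorphic_on ball c \<rho>" and \<phi>: "\<phi> holomorphic_on ball c \<rho>"
    and L: "\<forall>\<^sub>F N in sequentially. \<forall>p\<in>T. L N p holomorphic_on ball c \<rho>"
    and lim: "uniform_limit (T \<times> ball c \<rho>)
      (\<lambda>N x. L N (fst x) (snd x) - of_nat N * \<psi> (snd x) - \<kappa> N (fst x)) (\<lambda>x. \<phi> (snd x)) sequentially"
    and \<rho>: "\<rho>' < \<rho>"
  shows "uniform_limit (T \<times> ball c \<rho>')
    (\<lambda>N x. of_nat N * (exp (- L N (fst x) (snd x)) * (deriv ^^ a) (\<lambda>z. exp (L N (fst x) z)) (snd x) / of_nat N ^ a -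
      deriv \<psi> (snd x) ^ a)) (\<lambda>x. log_correction a \<psi> \<phi> (snd x)) sequentially"
proof -
  define X where "X a N p z = of_nat N * (exp (- L N p z) * (deriv ^^ a) (\<lambda>z. exp (L N p z)) z / of_nat N ^ a - deriv \<psi> z ^ a)"
    for a N p z
  define M where "M N p z = L N p z - of_nat N * \<psi> z - \<kappa> N p" for N p z
  have \<psi>': "deriv \<psi> holomorphic_on ball c \<rho>" "deriv (deriv \<psi>) holomorphic_on ball c \<rho>"
    and \<phi>': "deriv \<phi> holomorphic_on ball c \<rho>"
    using \<psi> \<phi> by (auto intro!: holomorphic_intros)
  note B = log_correction_holomorphic[OF \<psi> \<phi> open_ball]
  have X_hol: "\<forall>\<^sub>F N in sequentially. \<forall>p\<in>T. X a N p holomorphic_on ball c \<rho>" for a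
    using L
  proof eventually_elim
    case (elim N)
    then show ?case unfolding X_def divide_inverse using \<psi>'
      by (auto intro!: holomorphic_intros holomorphic_higher_deriv)
  qed
  have M_hol: "\<forall>\<^sub>F N in sequentially. \<forall>p\<in>T. M N p holomorphic_on ball c \<rho>"
    using L unfolding M_def by eventually_elim (use \<psi> in \<open>auto intro!: holomorphic_intros\<close>)
  define R where "R a N x = of_nat a * deriv \<psi> (snd x) ^ (a - 1) * deriv (deriv \<psi>) (snd x) +
      (1 / of_nat N) * deriv (X a N (fst x)) (snd x) + deriv \<psi> (snd x) * X a N (fst x) (snd x) +
      deriv (M N (fst x)) (snd x) * deriv \<psi> (snd x) ^ a +
      (1 / of_nat N) * (deriv (M N (fst x)) (snd x) * X a N (fst x) (snd x))" for a N x
  have step: "\<forall>\<^sub>F N in sequentially. \<forall>x\<in>T \<times> ball c \<rho>. R a N x = X (Suc a) N (fst x) (snd x)" for a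
    using L eventually_gt_at_top[of 0]
  proof eventually_elim
    case (elim N)
    show ?case
    proof
      fix x assume "x \<in> T \<times> ball c \<rho>"
      then obtain p z where x: "x = (p, z)" "p \<in> T" and z: "z \<in> ball c \<rho>" by auto
      have N: "of_nat N \<noteq> (0 :: complex)" using elim(2) by simp
      have Lp: "L N p holomorphic_on ball c \<rho>" using elim(1) x by blast
      define D where "D a = (deriv ^^ a) (\<lambda>z. exp (L N p z))" for a
      have D: "D a holomorphic_on ball c \<rho>" for a
        unfolding D_def using Lp by (intro holomorphic_higher_deriv holomorphic_intros) auto
      have dL: "(L N p has_field_derivative deriv (L N p) z) (at z)"
        and d\<psi>: "(\<psi> has_field_derivative deriv \<psi> z) (at z)"
        and d\<psi>': "(deriv \<psi> has_field_derivative deriv (deriv \<psi>) z) (at z)"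
        and dD: "(D a has_field_derivative D (Suc a) z) (at z)"
        using holomorphic_derivI[OF Lp open_ball z] holomorphic_derivI[OF \<psi> open_ball z]
          holomorphic_derivI[OF \<psi>'(1) open_ball z] holomorphic_derivI[OF D[of a] open_ball z] by (auto simp: D_def)
      have dM: "deriv (M N p) z = deriv (L N p) z - of_nat N * deriv \<psi> z"
        unfolding M_def by (rule DERIV_imp_deriv) (auto intro!: derivative_eq_intros dL d\<psi>)
      have "(X a N p has_field_derivative of_nat N * ((exp (- L N p z) * (- deriv (L N p) z) * D a z + exp (- L N p z) * D (Suc a) z) / of_nat N ^ a -
          of_nat a * deriv \<psi> z ^ (a - 1) * deriv (deriv \<psi>) z)) (at z)"
        unfolding X_def D_def[symmetric]
        by (rule derivative_eq_intros dL d\<psi>' dD refl | use N in \<open>simp add: field_simps\<close>)+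
      then have dX: "deriv (X a N p) z = of_nat N * ((exp (- L N p z) * (- deriv (L N p) z) * D a z + exp (- L N p z) * D (Suc a) z) / of_nat N ^ a -
          of_nat a * deriv \<psi> z ^ (a - 1) * deriv (deriv \<psi>) z)"
        by (rule DERIV_imp_deriv)
      define G where "G a = exp (- L N p z) * D a z / of_nat N ^ a" for a
      have X: "X a N p z = of_nat N * (G a - deriv \<psi> z ^ a)" for a by (simp add: X_def G_def D_def)
      have dX': "deriv (X a N p) z = of_nat N * (- deriv (L N p) z * G a + of_nat N * G (Suc a) -
          of_nat a * deriv \<psi> z ^ (a - 1) * deriv (deriv \<psi>) z)"
        unfolding dX G_def using N by (simp add: field_simps)
      show "R a N x = X (Suc a) N (fst x) (snd x)"
        unfolding R_def x(1) fst_conv snd_conv X dX' dM using N by (simp add: field_simps)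
    qed
  qed
  have M_lim: "uniform_limit (T \<times> ball c \<rho>') (\<lambda>N x. deriv (M N (fst x)) (snd x)) (\<lambda>x. deriv \<phi> (snd x)) sequentially"
    if "\<rho>' < \<rho>" for \<rho>'
    using lim by (intro uniform_limit_deriv[OF _ M_hol \<phi> that]) (simp add: M_def)
  have inv_lim: "uniform_limit A (\<lambda>N x. 1 / of_nat N) (\<lambda>x. 0 :: complex) sequentially" for A :: "('p \<times> complex) set"
  proof (rule uniform_limitI)
    fix e :: real assume "e > 0"
    from tendstoD[OF lim_1_over_n[where 'a = complex] this]
    show "\<forall>\<^sub>F N in sequentially. \<forall>x\<in>A. dist (1 / of_nat N :: complex) 0 < e"
      by (auto elim: eventually_mono)
  qed
  have "uniform_limit (T \<times> ball c \<rho>') (\<lambda>N x. X a N (fst x) (snd x)) (\<lambda>x. log_correction a \<psi> \<phi> (snd x)) sequentially"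
    if "\<rho>' < \<rho>" for \<rho>'
    using that
  proof (induction a arbitrary: \<rho>')
    case 0
    have "X 0 N p z = 0" for N p z by (simp add: X_def exp_minus)
    moreover have "log_correction 0 \<psi> \<phi> z = 0" for z by (simp add: log_correction_def)
    ultimately show ?case by (simp add: uniform_limit_const)
  next
    case (Suc a)
    define \<rho>'' where "\<rho>'' = (\<rho>' + \<rho>) / 2"
    have \<rho>'': "\<rho>' < \<rho>''" "\<rho>'' < \<rho>" using Suc.prems by (auto simp: \<rho>''_def)
    let ?A = "T \<times> ball c \<rho>'"
    note bdd = bounded_image_snd[OF holomorphic_bounded_smaller_ball[OF _ Suc.prems]]
    have IH: "uniform_limit ?A (\<lambda>N x. X a N (fst x) (snd x)) (\<lambda>x. log_correction a \<psi> \<phi> (snd x)) sequentially"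
      by (rule Suc.IH[OF Suc.prems])
    have dX: "uniform_limit ?A (\<lambda>N x. deriv (X a N (fst x)) (snd x)) (\<lambda>x. deriv (log_correction a \<psi> \<phi>) (snd x)) sequentially"
    proof (rule uniform_limit_deriv[OF Suc.IH[OF \<rho>''(2)] _ _ \<rho>''(1)])
      show "\<forall>\<^sub>F N in sequentially. \<forall>p\<in>T. X a N p holomorphic_on ball c \<rho>''"
        using X_hol[of a] by eventually_elim (use \<rho>'' in \<open>auto intro: holomorphic_on_subset\<close>)
      show "log_correction a \<psi> \<phi> holomorphic_on ball c \<rho>''"
        using B by (rule holomorphic_on_subset) (use \<rho>'' in auto)
    qed
    have dB: "deriv (log_correction a \<psi> \<phi>) holomorphic_on ball c \<rho>" using B by (auto intro: holomorphic_intros)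
    have "uniform_limit ?A (R a)
      (\<lambda>x. of_nat a * deriv \<psi> (snd x) ^ (a - 1) * deriv (deriv \<psi>) (snd x) + 0 * deriv (log_correction a \<psi> \<phi>) (snd x) +
      deriv \<psi> (snd x) * log_correction a \<psi> \<phi> (snd x) + deriv \<phi> (snd x) * deriv \<psi> (snd x) ^ a +
      0 * (deriv \<phi> (snd x) * log_correction a \<psi> \<phi> (snd x))) sequentially"
      unfolding R_def by (intro uniform_limit_add uniform_lim_mult uniform_limit_const inv_lim IH dX M_lim Suc.prems bdd)
        (use \<psi>' \<phi>' B dB in \<open>auto intro!: holomorphic_intros bounded_image_snd[OF holomorphic_bounded_smaller_ball[OF _ Suc.prems]]\<close>)
    also have "?this \<longleftrightarrow> uniform_limit ?A (\<lambda>N x. X (Suc a) N (fst x) (snd x)) (\<lambda>x. log_correction (Suc a) \<psi> \<phi> (snd x)) sequentially"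
    proof (rule uniform_limit_cong)
      show "\<forall>\<^sub>F N in sequentially. \<forall>x\<in>?A. R a N x = X (Suc a) N (fst x) (snd x)"
        using step[of a] by eventually_elim (use Suc.prems in auto)
    qed (simp add: log_correction_Suc)
    finally show ?case .
  qed
  from this[OF \<rho>] show ?thesis by (simp add: X_def)
qed

section \<open>Asymptotics of the confluent coefficients\<close>

text \<open>
  Because the confluent sum vanishes to order \<open>s\<close> at \<open>t = 0\<close> and \<open>S = 1\<close> there, dividing it by \<open>S\<close> does
  not change its coefficient of \<open>t\<^sup>s\<close>.  The quotient, unlike the sum itself, is of controlled size on a
  fixed disc: its summands are the quantities \<open>exp(- L) \<partial>\<^sub>i\<^sup>a exp L\<close>.
\<close>

lemma confluent_coeff_asymptotics:
  fixes S L :: "nat \<Rightarrow> (nat \<Rightarrow> complex) \<Rightarrow> complex" and \<Psi> \<Phi> :: "complex \<Rightarrow> complex"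
  assumes \<rho>: "\<rho> > 0" and s: "s < r"
    and \<Psi>: "\<Psi> holomorphic_on ball 1 \<rho>" and \<Phi>: "\<Phi> holomorphic_on ball 1 \<rho>"
    and S: "\<forall>\<^sub>F N in sequentially. polydisc_analytic r \<rho> (S N) \<and>
      (\<forall>q<s. (deriv ^^ q) (confluent_sum s m (S N)) 0 = 0) \<and> log_branch (polydisc1 r \<rho>) (S N) (L N)"
    and lim: "uniform_limit (polydisc1 r \<rho>)
      (\<lambda>N u. of_nat N * (1 / of_nat N * L N u - (\<Sum>i<r. \<Psi> (u i)))) (\<lambda>u. \<Sum>i<r. \<Phi> (u i)) sequentially"
  shows "(\<lambda>N. of_nat N * (fact s * confluent_coeff s m (S N) / of_nat N ^ (m - s) -
      (deriv ^^ s) (\<lambda>z. z ^ m * deriv \<Psi> z ^ (m - s)) 1)) \<longlonglongrightarrow>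
    (deriv ^^ s) (\<lambda>z. z ^ m * log_correction (m - s) \<Psi> \<Phi> z) 1"
proof -
  define a where "a = m - s"
  define T where "T = (ball 0 (\<rho> / (2 * real r)) :: complex set)"
  have r: "r \<ge> 1" using s by simp
  have T0: "0 \<in> T" "open T" using \<rho> r by (auto simp: T_def)
  have lp: "line_point s t \<in> polydisc1 r (\<rho> / 2)" "line_point s t \<in> polydisc1 r \<rho>" if "t \<in> T" for t
    using line_point_polydisc1[OF that[unfolded T_def] s \<rho>] polydisc1_mono[of "\<rho> / 2" \<rho> r r] \<rho> by auto
  have lpi: "line_point s t i \<in> ball 1 (\<rho> / 2)" "line_point s t i \<in> ball 1 \<rho>" if "t \<in> T" "i < r" for t i
    using lp[OF that(1)] that(2) by (auto simp: polydisc1_def dist_commute)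
  have upd: "(line_point s t)(i := z) \<in> polydisc1 r \<rho>" if "t \<in> T" "i < r" "z \<in> ball 1 \<rho>" for t i z
    by (rule polydisc1_update[OF lp(2)[OF that(1)] that(2,3)])
  define l where "l i N t z = L N ((line_point s t)(i := z))" for i N t z
  define h where "h = (\<lambda>z. z ^ m * deriv \<Psi> z ^ a)"
  define B where "B = (\<lambda>z. z ^ m * log_correction a \<Psi> \<Phi> z)"
  have h_hol: "h holomorphic_on ball 1 \<rho>" unfolding h_def using \<Psi> by (intro holomorphic_intros) auto
  have B_hol: "B holomorphic_on ball 1 \<rho>" unfolding B_def
    by (intro holomorphic_intros log_correction_holomorphic \<Psi> \<Phi>) auto
  have l_hol: "\<forall>\<^sub>F N in sequentially. \<forall>t\<in>T. l i N t holomorphic_on ball 1 \<rho>" if i: "i < r" for i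
    using S
  proof eventually_elim
    case (elim N)
    show ?case
    proof
      fix t assume t: "t \<in> T"
      show "l i N t holomorphic_on ball 1 \<rho>"
      proof (rule continuous_log_holomorphic)
        show "(\<lambda>z. S N ((line_point s t)(i := z))) holomorphic_on ball 1 \<rho>"
          using elim i lp(2)[OF t] by (auto simp: polydisc_analytic_def)
        show "exp (l i N t z) = S N ((line_point s t)(i := z))" if "z \<in> ball 1 \<rho>" for z
          using elim upd[OF t i that] by (auto simp: l_def log_branch_def)
        have "continuous_on (ball 1 \<rho>) (\<lambda>z. (line_point s t)(i := z))"
        proof (rule continuous_on_coordinatewise_then_product)
          show "continuous_on (ball 1 \<rho>) (\<lambda>z. ((line_point s t)(i := z)) j)" for j
            by (cases "j = i") auto
        qed
        moreover have "continuous_on (polydisc1 r \<rho>) (L N)" using elim by (simp add: log_branch_def)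
        ultimately show "continuous_on (ball 1 \<rho>) (l i N t)"
          unfolding l_def[abs_def] using upd[OF t i] by (rule_tac continuous_on_compose2[where g = "L N"]) auto
      qed
    qed
  qed
  \<comment> \<open>the contribution of the coordinates other than the one with index \<open>i\<close>\<close>
  define \<kappa> where "\<kappa> i N t = of_nat N * (\<Sum>j\<in>{..<r} - {i}. \<Psi> (line_point s t j)) +
    (\<Sum>j\<in>{..<r} - {i}. \<Phi> (line_point s t j))" for i N t
  have l_lim: "uniform_limit (T \<times> ball 1 \<rho>)
      (\<lambda>N x. l i N (fst x) (snd x) - of_nat N * \<Psi> (snd x) - \<kappa> i N (fst x)) (\<lambda>x. \<Phi> (snd x)) sequentially"
    if i: "i < r" for i
  proof (rule uniform_limitI)
    fix e :: real assume "e > 0"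
    from uniform_limitD[OF lim this] eventually_gt_at_top[of 0]
    show "\<forall>\<^sub>F N in sequentially. \<forall>x\<in>T \<times> ball 1 \<rho>. dist (l i N (fst x) (snd x) - of_nat N * \<Psi> (snd x) - \<kappa> i N (fst x)) (\<Phi> (snd x)) < e"
    proof eventually_elim
      case (elim N)
      show ?case
      proof
        fix x :: "complex \<times> complex" assume "x \<in> T \<times> ball 1 \<rho>"
        then obtain t z where x: "x = (t, z)" "t \<in> T" "z \<in> ball 1 \<rho>" by auto
        let ?u = "(line_point s t)(i := z)"
        have split: "(\<Sum>j<r. f (?u j)) = f z + (\<Sum>j\<in>{..<r} - {i}. f (line_point s t j))" for f :: "complex \<Rightarrow> complex"
          using i by (subst sum.remove[of _ i]) auto
        have "dist (of_nat N * (1 / of_nat N * L N ?u - (\<Sum>j<r. \<Psi> (?u j)))) (\<Sum>j<r. \<Phi> (?u j)) < e"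
          using elim(1) upd[OF x(2) i x(3)] by blast
        moreover have "of_nat N * (1 / of_nat N * L N ?u - (\<Sum>j<r. \<Psi> (?u j))) - (\<Sum>j<r. \<Phi> (?u j)) =
            l i N t z - of_nat N * \<Psi> z - \<kappa> i N t - \<Phi> z"
          using elim(2) unfolding split by (simp add: l_def \<kappa>_def algebra_simps)
        ultimately show "dist (l i N (fst x) (snd x) - of_nat N * \<Psi> (snd x) - \<kappa> i N (fst x)) (\<Phi> (snd x)) < e"
          by (simp add: x dist_norm)
      qed
    qed
  qed
  define X where "X i N t = of_nat N * (exp (- l i N t (line_point s t i)) *
     (deriv ^^ a) (\<lambda>z. exp (l i N t z)) (line_point s t i) / of_nat N ^ a - deriv \<Psi> (line_point s t i) ^ a)" for i N t
  have X_lim: "uniform_limit T (X i) (\<lambda>t. log_correction a \<Psi> \<Phi> (line_point s t i)) sequentially" if i: "i \<le> s" for i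
  proof -
    have "i < r" using i s by simp
    from uniform_exp_derivative_expansion[OF \<Psi> \<Phi> l_hol[OF this] l_lim[OF this], of "\<rho> / 2" a] \<rho>
    have "uniform_limit (T \<times> ball 1 (\<rho> / 2)) (\<lambda>N x. of_nat N * (exp (- l i N (fst x) (snd x)) *
        (deriv ^^ a) (\<lambda>z. exp (l i N (fst x) z)) (snd x) / of_nat N ^ a - deriv \<Psi> (snd x) ^ a))
        (\<lambda>x. log_correction a \<Psi> \<Phi> (snd x)) sequentially" by simp
    from uniform_limit_substitute[OF this, of T "\<lambda>t. (t, line_point s t i)"]
    show ?thesis unfolding X_def[abs_def] using lpi(1) \<open>i < r\<close> by simp
  qed
  define P where "P i = (\<Prod>j\<in>{..s} - {i}. complex_of_nat i - of_nat j)" for i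
  define c where "c N t = of_nat N * (confluent_sum s m (S N) t * inverse (S N (line_point s t)) / of_nat N ^ a - node_sum {..s} h t)" for N t
  have c_eq: "\<forall>\<^sub>F N in sequentially. \<forall>t\<in>T. (\<Sum>i\<le>s. line_point s t i ^ m / P i * X i N t) = c N t"
    using S
  proof eventually_elim
    case (elim N)
    show ?case
    proof
      fix t assume t: "t \<in> T"
      let ?u = "line_point s t"
      have SL: "S N u = exp (L N u)" if "u \<in> polydisc1 r \<rho>" for u
        using elim that by (simp add: log_branch_def)
      have Su: "inverse (S N ?u) = exp (- l i N t (?u i))" for i
        using SL[OF lp(2)[OF t]] by (simp add: l_def exp_minus)
      have pd: "partial_deriv i a (S N) ?u = (deriv ^^ a) (\<lambda>z. exp (l i N t z)) (?u i)" if "i < r" for i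
        unfolding partial_deriv_def
      proof (rule higher_deriv_cong_ev)
        have "\<forall>\<^sub>F z in nhds (?u i). z \<in> ball 1 \<rho>"
          using lpi(2)[OF t that] by (intro eventually_nhds_in_open) auto
        then show "\<forall>\<^sub>F z in nhds (?u i). S N (?u(i := z)) = exp (l i N t z)"
          by eventually_elim (use SL upd[OF t that] in \<open>auto simp: l_def\<close>)
      qed simp
      have node: "node_sum {..s} h t = (\<Sum>i\<le>s. ?u i ^ m * deriv \<Psi> (?u i) ^ a / P i)"
        unfolding node_sum_def by (intro sum.cong refl) (simp add: P_def h_def line_point_def)
      have conf: "confluent_sum s m (S N) t * inverse (S N ?u) =
          (\<Sum>i\<le>s. ?u i ^ m * (exp (- l i N t (?u i)) * (deriv ^^ a) (\<lambda>z. exp (l i N t z)) (?u i)) / P i)"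
        unfolding confluent_sum_def sum_distrib_right
        using s by (intro sum.cong refl) (simp add: P_def a_def[symmetric] pd Su[symmetric])
      show "(\<Sum>i\<le>s. ?u i ^ m / P i * X i N t) = c N t"
        unfolding c_def conf node X_def sum_divide_distrib sum_subtractf[symmetric] sum_distrib_left
        by (intro sum.cong refl) (simp add: algebra_simps diff_divide_distrib)
    qed
  qed
  have "uniform_limit T (\<lambda>N t. \<Sum>i\<le>s. line_point s t i ^ m / P i * X i N t)
      (\<lambda>t. \<Sum>i\<le>s. line_point s t i ^ m / P i * log_correction a \<Psi> \<Phi> (line_point s t i)) sequentially"
  proof (intro uniform_limit_sum uniform_lim_mult uniform_limit_const X_lim)
    fix i assume i: "i \<in> {..s}"
    have bdd: "bounded ((\<lambda>t. f (line_point s t i)) ` T)" if "f holomorphic_on ball 1 \<rho>" for f :: "complex \<Rightarrow> complex"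
      using holomorphic_bounded_smaller_ball[OF that, of "\<rho> / 2"] \<rho> lpi(1) i s
      by (rule_tac bounded_subset) auto
    show "bounded ((\<lambda>t. line_point s t i ^ m / P i) ` T)"
      by (rule bdd[of "\<lambda>z. z ^ m / P i"]) (intro holomorphic_intros, simp add: P_def)
    show "bounded ((\<lambda>t. log_correction a \<Psi> \<Phi> (line_point s t i)) ` T)"
      by (intro bdd log_correction_holomorphic \<Psi> \<Phi>) auto
  qed auto
  also have "?this \<longleftrightarrow> uniform_limit T c (node_sum {..s} B) sequentially"
    by (rule uniform_limit_cong[OF c_eq], unfold node_sum_def B_def P_def, intro sum.cong refl)
      (simp add: line_point_def)
  finally have c_lim: "uniform_limit T c (node_sum {..s} B) sequentially" .
  have "\<rho> * real s \<le> \<rho> * real r" using s \<rho> by (intro mult_left_mono) auto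
  then have rad: "\<rho> / (2 * real r) * real s \<le> \<rho>" using r \<rho> by (simp add: field_simps)
  have conf_hol: "\<forall>\<^sub>F N in sequentially. confluent_sum s m (S N) holomorphic_on T \<and>
      (\<lambda>t. inverse (S N (line_point s t))) holomorphic_on T \<and> S N (\<lambda>_. 1) = 1"
    using S
  proof eventually_elim
    case (elim N)
    have "(\<lambda>t. partial_deriv 0 0 (S N) (line_point s t)) holomorphic_on T"
      using elim s by (auto simp: polydisc_analytic_def T_def)
    then have "(\<lambda>t. S N (line_point s t)) holomorphic_on T" by (simp add: partial_deriv_def)
    moreover have "S N (line_point s t) \<noteq> 0" if "t \<in> T" for t
      using elim lp(2)[OF that] by (metis exp_not_eq_zero log_branch_def)
    moreover have "(\<lambda>_. 1) \<in> polydisc1 r \<rho>" using \<rho> by (simp add: polydisc1_def)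
    then have "S N (\<lambda>_. 1) = 1" using elim by (metis exp_zero log_branch_def)
    ultimately show ?case
      using elim confluent_sum_holomorphic[of r \<rho> "S N" s m] s \<rho>
      by (auto simp: T_def intro!: holomorphic_intros)
  qed
  have node_hol: "node_sum {..s} h holomorphic_on T"
    unfolding T_def by (rule node_sum_holomorphic[OF h_hol _ rad \<rho>]) simp
  have "(\<lambda>N. (deriv ^^ s) (c N) 0) \<longlonglongrightarrow> (deriv ^^ s) (node_sum {..s} B) 0"
  proof (rule higher_deriv_complex_uniform_limit[OF c_lim])
    show "\<forall>\<^sub>F N in sequentially. c N holomorphic_on T"
      using conf_hol unfolding c_def divide_inverse
      by eventually_elim (use node_hol in \<open>auto intro!: holomorphic_intros\<close>)
  qed (use T0 in auto)
  also have "(deriv ^^ s) (node_sum {..s} B) 0 = (deriv ^^ s) B 1"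
    using node_sum_deriv[OF B_hol \<rho>, of "{..s}" s s] by simp
  finally have "(\<lambda>N. (deriv ^^ s) (c N) 0) \<longlonglongrightarrow> (deriv ^^ s) B 1" .
  moreover have "\<forall>\<^sub>F N in sequentially. (deriv ^^ s) (c N) 0 =
      of_nat N * (fact s * confluent_coeff s m (S N) / of_nat N ^ a - (deriv ^^ s) h 1)"
    using conf_hol S
  proof eventually_elim
    case (elim N)
    let ?C = "confluent_sum s m (S N)"
    define I where "I t = inverse (S N (line_point s t))" for t
    have hol: "?C holomorphic_on T" "I holomorphic_on T" using elim by (auto simp: I_def[abs_def])
    have I0: "I 0 = 1" using elim by (simp add: I_def)
    have Leib: "(deriv ^^ s) (\<lambda>t. ?C t * I t) 0 = fact s * confluent_coeff s m (S N)"
    proof -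
      have "(deriv ^^ s) (\<lambda>t. ?C t * I t) 0 =
        (\<Sum>i = 0..s. of_nat (s choose i) * (deriv ^^ i) ?C 0 * (deriv ^^ (s - i)) I 0)"
        by (rule higher_deriv_mult[OF hol T0(2,1)])
      also have "\<dots> = (\<Sum>i = 0..s. if i = s then (deriv ^^ s) ?C 0 else 0)"
        using elim I0 by (intro sum.cong refl) auto
      finally show ?thesis by (simp add: confluent_coeff_def)
    qed
    have "(deriv ^^ s) (c N) 0 = (deriv ^^ s) (\<lambda>t. of_nat N * (inverse (of_nat N ^ a) * (?C t * I t) - node_sum {..s} h t)) 0"
      unfolding c_def I_def by (simp add: divide_inverse mult_ac)
    also have "\<dots> = of_nat N * ((deriv ^^ s) (\<lambda>t. inverse (of_nat N ^ a) * (?C t * I t) - node_sum {..s} h t) 0)"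
      using T0 hol node_hol by (intro higher_deriv_cmult[where A = T] holomorphic_intros) auto
    also have "(deriv ^^ s) (\<lambda>t. inverse (of_nat N ^ a) * (?C t * I t) - node_sum {..s} h t) 0 =
        (deriv ^^ s) (\<lambda>t. inverse (of_nat N ^ a) * (?C t * I t)) 0 - (deriv ^^ s) (node_sum {..s} h) 0"
      using T0 hol node_hol by (intro higher_deriv_diff[where S = T] holomorphic_intros) auto
    also have "(deriv ^^ s) (\<lambda>t. inverse (of_nat N ^ a) * (?C t * I t)) 0 =
        inverse (of_nat N ^ a) * (fact s * confluent_coeff s m (S N))"
      unfolding Leib[symmetric] using T0 hol by (intro higher_deriv_cmult[where A = T] holomorphic_intros) auto
    also have "(deriv ^^ s) (node_sum {..s} h) 0 = (deriv ^^ s) h 1"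
      using node_sum_deriv[OF h_hol \<rho>, of "{..s}" s s] by simp
    finally show ?case by (simp add: divide_inverse mult_ac)
  qed
  ultimately show ?thesis
    unfolding a_def[symmetric] h_def B_def by (simp add: tendsto_cong)
qed

section \<open>The two leading orders\<close>

lemma Suc_times_choose_Suc: "Suc k * (n choose Suc k) = (n - k) * (n choose k)"
proof (cases "k \<le> n")
  case True
  then show ?thesis
    by (metis Suc_times_binomial_eq binomial_absorb_comp binomial_absorption mult.commute)
qed (simp add: binomial_eq_0)

text \<open>
  The binomial coefficient divided by its leading term \<open>N\<^sup>s\<^sup>+\<^sup>1 / (s + 1)!\<close>.
\<close>

definition binomial_ratio :: "nat \<Rightarrow> nat \<Rightarrow> complex" where
  "binomial_ratio s N = of_nat (N choose Suc s) * fact (Suc s) / of_nat N ^ Suc s"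

lemma binomial_ratio_asymptotics:
  "(\<lambda>N. of_nat N * (binomial_ratio s N - 1)) \<longlonglongrightarrow> - of_nat (s * Suc s) / 2"
  "binomial_ratio s \<longlonglongrightarrow> 1"
proof -
  have to_1: "f \<longlonglongrightarrow> 1" if "(\<lambda>N. of_nat N * (f N - 1)) \<longlonglongrightarrow> c" for f :: "nat \<Rightarrow> complex" and c
  proof -
    have "(\<lambda>N. (1 / of_nat N) * (of_nat N * (f N - 1)) + 1) \<longlonglongrightarrow> 0 * c + 1"
      by (intro tendsto_intros that lim_1_over_n)
    moreover have "\<forall>\<^sub>F N in sequentially. (1 / of_nat N) * (of_nat N * (f N - 1)) + 1 = f N"
      using eventually_gt_at_top[of 0] by eventually_elim simp
    ultimately show ?thesis by (simp add: tendsto_cong)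
  qed
  show lim: "(\<lambda>N. of_nat N * (binomial_ratio s N - 1)) \<longlonglongrightarrow> - of_nat (s * Suc s) / 2" for s
  proof (induction s)
    case 0
    have "\<forall>\<^sub>F N in sequentially. of_nat N * (binomial_ratio 0 N - 1) = 0"
      using eventually_gt_at_top[of 0] by eventually_elim (simp add: binomial_ratio_def)
    then show ?case by (simp add: tendsto_eventually)
  next
    case (Suc s)
    have "(\<lambda>N. of_nat N * (binomial_ratio s N - 1) - of_nat (Suc s) * binomial_ratio s N) \<longlonglongrightarrow>
        - of_nat (s * Suc s) / 2 - of_nat (Suc s) * 1"
      by (intro tendsto_intros Suc.IH to_1[OF Suc.IH])
    moreover have "\<forall>\<^sub>F N in sequentially. of_nat N * (binomial_ratio s N - 1) - of_nat (Suc s) * binomial_ratio s N =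
        of_nat N * (binomial_ratio (Suc s) N - 1)"
      using eventually_gt_at_top[of "Suc s"]
    proof eventually_elim
      case (elim N)
      have "of_nat (Suc (Suc s) * (N choose Suc (Suc s))) = (of_nat ((N - Suc s) * (N choose Suc s)) :: complex)"
        by (simp only: Suc_times_choose_Suc)
      then have "of_nat (N choose Suc (Suc s)) * fact (Suc (Suc s)) =
          (of_nat N - of_nat (Suc s)) * (of_nat (N choose Suc s) * fact (Suc s) :: complex)"
        using elim unfolding of_nat_mult fact_Suc[of "Suc s"] by (simp add: of_nat_diff mult_ac)
      then have "binomial_ratio (Suc s) N = (of_nat N - of_nat (Suc s)) * binomial_ratio s N / of_nat N"
        unfolding binomial_ratio_def by (simp add: mult_ac)
      then show ?case using elim by (simp add: field_simps)
    qed
    ultimately have "(\<lambda>N. of_nat N * (binomial_ratio (Suc s) N - 1)) \<longlonglongrightarrow> - of_nat (s * Suc s) / 2 - of_nat (Suc s) * 1"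
      by (simp add: tendsto_cong)
    also have "- of_nat (s * Suc s) / 2 - of_nat (Suc s) * 1 = (- of_nat (Suc s * Suc (Suc s)) / 2 :: complex)"
      by (simp add: field_simps)
    finally show ?case .
  qed
  show "binomial_ratio s \<longlonglongrightarrow> 1" by (rule to_1[OF lim])
qed

lemma confluent_term_asymptotics:
  fixes C :: "nat \<Rightarrow> complex"
  assumes lim: "(\<lambda>N. of_nat N * (fact s * C N / of_nat N ^ (m - s) - \<alpha>)) \<longlonglongrightarrow> \<beta>" and s: "s \<le> m"
  defines "w \<equiv> fact s * fact (Suc s) :: complex"
  shows "(\<lambda>N. of_nat (N choose Suc s) * C N / of_nat N ^ m - of_nat N * (\<alpha> / w)) \<longlonglongrightarrow>
      (\<beta> - of_nat (s * Suc s) / 2 * \<alpha>) / w"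
    and "(\<lambda>N. of_nat (N choose Suc s) * C N / of_nat N ^ Suc m) \<longlonglongrightarrow> \<alpha> / w"
    and "Suc (Suc m) \<le> k \<Longrightarrow> (\<lambda>N. of_nat (N choose Suc s) * C N / of_nat N ^ k) \<longlonglongrightarrow> 0"
proof -
  define Y where "Y N = of_nat N * (fact s * C N / of_nat N ^ (m - s) - \<alpha>)" for N
  have Y: "Y \<longlonglongrightarrow> \<beta>" unfolding Y_def[abs_def] by (rule lim)
  have w: "w \<noteq> 0" unfolding w_def by (simp del: fact_Suc)
  have cancel: "n * (K * F / n ^ Suc s) * (f * c / q) / (f * F) = K * c / (q * n ^ s)"
    if "n \<noteq> 0" "f \<noteq> 0" "F \<noteq> 0" "q \<noteq> 0" for n K F f c q :: complex
    using that by (simp add: field_simps)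
  have eq: "of_nat (N choose Suc s) * C N / of_nat N ^ m = of_nat N * binomial_ratio s N * (\<alpha> + Y N / of_nat N) / w"
    if "N > 0" for N
  proof -
    have N: "of_nat N \<noteq> (0 :: complex)" using that by simp
    have "\<alpha> + Y N / of_nat N = fact s * C N / of_nat N ^ (m - s)" using N by (simp add: Y_def)
    moreover have "(of_nat N :: complex) ^ m = of_nat N ^ (m - s) * of_nat N ^ s"
      using s by (simp flip: power_add)
    ultimately show ?thesis using N unfolding binomial_ratio_def w_def
      by (simp only: cancel[OF N] fact_nonzero power_not_zero not_False_eq_True)
  qed
  have "(\<lambda>N. (of_nat N * (binomial_ratio s N - 1) * \<alpha> + binomial_ratio s N * Y N) / w) \<longlonglongrightarrow>
      (- of_nat (s * Suc s) / 2 * \<alpha> + 1 * \<beta>) / w"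
    by (intro tendsto_intros binomial_ratio_asymptotics Y w)
  moreover have "\<forall>\<^sub>F N in sequentially. (of_nat N * (binomial_ratio s N - 1) * \<alpha> + binomial_ratio s N * Y N) / w =
      of_nat (N choose Suc s) * C N / of_nat N ^ m - of_nat N * (\<alpha> / w)"
    using eventually_gt_at_top[of 0]
  proof eventually_elim
    case (elim N)
    then show ?case unfolding eq[OF elim] using w by (simp add: field_simps)
  qed
  moreover have "(- of_nat (s * Suc s) / 2 * \<alpha> + 1 * \<beta>) / w = (\<beta> - of_nat (s * Suc s) / 2 * \<alpha>) / w"
    by (simp only: mult_1 minus_divide_left[symmetric] mult_minus_left uminus_add_conv_diff)
  ultimately show "(\<lambda>N. of_nat (N choose Suc s) * C N / of_nat N ^ m - of_nat N * (\<alpha> / w)) \<longlonglongrightarrow>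
      (\<beta> - of_nat (s * Suc s) / 2 * \<alpha>) / w"
    by (simp only: tendsto_cong)
  have "(\<lambda>N. binomial_ratio s N * (\<alpha> + Y N * (1 / of_nat N)) / w) \<longlonglongrightarrow> 1 * (\<alpha> + \<beta> * 0) / w"
    by (intro tendsto_intros binomial_ratio_asymptotics Y w lim_1_over_n)
  moreover have "\<forall>\<^sub>F N in sequentially. binomial_ratio s N * (\<alpha> + Y N * (1 / of_nat N)) / w =
      of_nat (N choose Suc s) * C N / of_nat N ^ Suc m"
    using eventually_gt_at_top[of 0]
  proof eventually_elim
    case (elim N)
    have "of_nat (N choose Suc s) * C N / of_nat N ^ Suc m = of_nat (N choose Suc s) * C N / of_nat N ^ m / of_nat N"
      by (simp add: field_simps)
    then show ?case using eq[OF elim] elim by simp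
  qed
  ultimately show lim2: "(\<lambda>N. of_nat (N choose Suc s) * C N / of_nat N ^ Suc m) \<longlonglongrightarrow> \<alpha> / w"
    by (simp add: tendsto_cong)
  assume k: "Suc (Suc m) \<le> k"
  have "(\<lambda>N. of_nat (N choose Suc s) * C N / of_nat N ^ Suc m * (1 / of_nat N) ^ (k - Suc m)) \<longlonglongrightarrow> \<alpha> / w * 0 ^ (k - Suc m)"
    by (intro tendsto_intros lim2 lim_1_over_n)
  moreover have "of_nat (N choose Suc s) * C N / of_nat N ^ Suc m * (1 / of_nat N) ^ (k - Suc m) =
      of_nat (N choose Suc s) * C N / of_nat N ^ k" for N
  proof -
    have "(of_nat N :: complex) ^ k = of_nat N ^ Suc m * of_nat N ^ (k - Suc m)"
      using k by (subst power_add[symmetric]) simp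
    then show ?thesis by (simp add: power_one_over)
  qed
  ultimately show "(\<lambda>N. of_nat (N choose Suc s) * C N / of_nat N ^ k) \<longlonglongrightarrow> 0"
    using k by (simp add: power_0_left)
qed

lemma of_nat_choose_two: "of_nat (Suc b choose 2) = (of_nat (Suc b) * of_nat b / 2 :: complex)"
proof (induction b)
  case (Suc b)
  have "Suc (Suc b) choose 2 = Suc b + (Suc b choose 2)" by (simp add: numeral_2_eq_2)
  then show ?case using Suc by (simp add: field_simps)
qed (simp add: binomial_eq_0)

text \<open>
  Abbreviate \<open>b = k - s - 1\<close>.  The term with \<open>\<Psi>''\<close> is \<open>(b + 1) / 2\<close> times \<open>z\<^sup>k (\<Psi>'\<^sup>b)'\<close>, and the
  latter is the derivative of \<open>z\<^sup>k \<Psi>'\<^sup>b\<close> minus \<open>k z\<^sup>k\<^sup>-\<^sup>1 \<Psi>'\<^sup>b\<close>.  The derivatives turn the index \<open>s\<close> into \<open>s + 1\<close> and cancel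
  against the binomial corrections.  Of the rest, \<open>- k / 2\<close> from here and \<open>(k - 1) / 2\<close> from the terms with
  \<open>m = k - 1\<close> leave the factor \<open>- 1 / 2\<close> of \<open>z\<^sup>k\<^sup>-\<^sup>1 \<Psi>'\<^sup>b\<close>.
\<close>

lemma moment'_identity:
  fixes \<Psi> \<Phi> :: "complex \<Rightarrow> complex"
  assumes \<rho>: "0 < \<rho>" "\<rho> \<le> 1" and \<Psi>: "\<Psi> holomorphic_on ball 1 \<rho>" and \<Phi>: "\<Phi> holomorphic_on ball 1 \<rho>" and k: "k \<ge> 1"
  defines "\<alpha> \<equiv> \<lambda>m s. (deriv ^^ s) (\<lambda>z. z ^ m * deriv \<Psi> z ^ (m - s)) 1"
    and "\<beta> \<equiv> \<lambda>m s. (deriv ^^ s) (\<lambda>z. z ^ m * log_correction (m - s) \<Psi> \<Phi> z) 1"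
    and "w \<equiv> \<lambda>s. fact s * fact (Suc s) :: complex"
  shows "(\<Sum>s\<le>k. fact k / fact (k - s) * ((\<beta> k s - of_nat (s * Suc s) / 2 * \<alpha> k s) / w s)) +
      of_nat (k choose 2) * (\<Sum>s\<le>k - 1. fact (k - 1) / fact (k - 1 - s) * (\<alpha> (k - 1) s / w s)) = moment' \<Psi> \<Phi> k"
proof -
  let ?A = "ball (1 :: complex) \<rho>"
  obtain n where n: "k = Suc n" using k by (cases k) auto
  have one: "1 \<in> ?A" using \<rho> by simp
  have nz: "z \<noteq> 0" if "z \<in> ?A" for z using that \<rho> by (auto simp: dist_norm)
  have \<Psi>': "deriv \<Psi> holomorphic_on ?A" and \<Phi>': "deriv \<Phi> holomorphic_on ?A"
    using \<Psi> \<Phi> by (auto intro!: holomorphic_intros)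
  define P where "P s = (deriv ^^ s) (\<lambda>z. z ^ k * (deriv \<Psi> z ^ (n - s) * deriv \<Phi> z)) 1" for s
  define v where "v s = fact k / (fact s * fact (Suc s) * fact (n - s) :: complex)" for s
  have \<beta>_top: "\<beta> k k = 0" by (simp add: \<beta>_def log_correction_def binomial_eq_0)
  have \<beta>_eq: "\<beta> k s = of_nat (k - s) * P s + of_nat (k - s) / 2 * (\<alpha> k (Suc s) - of_nat k * \<alpha> n s)" if s: "s \<le> n" for s
  proof -
    define b where "b = n - s"
    have b: "k - s = Suc b" "k - Suc s = b" "n - s = b" using s by (auto simp: n b_def)
    let ?c = "of_nat (Suc b) :: complex"
    let ?f = "\<lambda>z. z ^ k * deriv \<Psi> z ^ b" and ?g = "\<lambda>z. z ^ n * deriv \<Psi> z ^ b"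
    let ?p = "\<lambda>z. z ^ k * (deriv \<Psi> z ^ b * deriv \<Phi> z)"
    have hol: "?f holomorphic_on ?A" "?g holomorphic_on ?A" "?p holomorphic_on ?A" "deriv ?f holomorphic_on ?A"
      using \<Psi>' \<Phi>' by (auto intro!: holomorphic_intros)
    have eq: "z ^ k * log_correction (Suc b) \<Psi> \<Phi> z = ?c * ?p z + ?c / 2 * (deriv ?f z - of_nat k * ?g z)" if z: "z \<in> ?A" for z
    proof -
      have "(deriv \<Psi> has_field_derivative deriv (deriv \<Psi>) z) (at z)"
        by (rule holomorphic_derivI[OF \<Psi>' open_ball z])
      then have "(?f has_field_derivative of_nat k * z ^ n * deriv \<Psi> z ^ b +
          z ^ k * (of_nat b * deriv \<Psi> z ^ (b - 1) * deriv (deriv \<Psi>) z)) (at z)"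
        by (rule DERIV_cong[OF DERIV_mult[OF DERIV_power[OF DERIV_ident] DERIV_power]]) (simp add: n mult_ac)
      then have df: "deriv ?f z = of_nat k * z ^ n * deriv \<Psi> z ^ b +
          z ^ k * (of_nat b * deriv \<Psi> z ^ (b - 1) * deriv (deriv \<Psi>) z)"
        by (rule DERIV_imp_deriv)
      note ch = of_nat_choose_two[of b]
      show ?thesis unfolding log_correction_def df ch by (simp add: field_simps del: of_nat_Suc)
    qed
    have "\<beta> k s = (deriv ^^ s) (\<lambda>z. ?c * ?p z + ?c / 2 * (deriv ?f z - of_nat k * ?g z)) 1"
      unfolding \<beta>_def b
    proof (rule higher_deriv_cong_ev)
      have "\<forall>\<^sub>F z in nhds 1. z \<in> ?A" using one by (intro eventually_nhds_in_open) auto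
      then show "\<forall>\<^sub>F z in nhds 1. z ^ k * log_correction (Suc b) \<Psi> \<Phi> z = ?c * ?p z + ?c / 2 * (deriv ?f z - of_nat k * ?g z)"
        by eventually_elim (rule eq)
    qed simp
    also have "\<dots> = (deriv ^^ s) (\<lambda>z. ?c * ?p z) 1 + (deriv ^^ s) (\<lambda>z. ?c / 2 * (deriv ?f z - of_nat k * ?g z)) 1"
      by (intro higher_deriv_add[where S = ?A] holomorphic_on_mult holomorphic_on_diff holomorphic_on_const hol open_ball one)
    also have "(deriv ^^ s) (\<lambda>z. ?c * ?p z) 1 = ?c * (deriv ^^ s) ?p 1"
      by (intro higher_deriv_cmult[where A = ?A] hol open_ball one)
    also have "(deriv ^^ s) (\<lambda>z. ?c / 2 * (deriv ?f z - of_nat k * ?g z)) 1 = ?c / 2 * (deriv ^^ s) (\<lambda>z. deriv ?f z - of_nat k * ?g z) 1"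
      by (intro higher_deriv_cmult[where A = ?A] holomorphic_on_mult holomorphic_on_diff holomorphic_on_const hol open_ball one)
    also have "(deriv ^^ s) (\<lambda>z. deriv ?f z - of_nat k * ?g z) 1 = (deriv ^^ s) (deriv ?f) 1 - (deriv ^^ s) (\<lambda>z. of_nat k * ?g z) 1"
      by (intro higher_deriv_diff[where S = ?A] holomorphic_on_mult holomorphic_on_const hol open_ball one)
    also have "(deriv ^^ s) (\<lambda>z. of_nat k * ?g z) 1 = of_nat k * (deriv ^^ s) ?g 1"
      by (intro higher_deriv_cmult[where A = ?A] hol open_ball one)
    also have "(deriv ^^ s) (deriv ?f) 1 = (deriv ^^ Suc s) ?f 1" by (simp add: funpow_Suc_right del: funpow.simps)
    finally show ?thesis unfolding P_def \<alpha>_def b .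
  qed
  have m': "moment' \<Psi> \<Phi> k = (\<Sum>s\<le>n. v s * (P s - \<alpha> n s / 2))"
    unfolding moment'_def n atLeast0AtMost diff_Suc_1
  proof (intro sum.cong refl)
    fix s assume "s \<in> {..n}"
    have hol: "(\<lambda>z. z ^ k * (deriv \<Psi> z ^ (n - s) * deriv \<Phi> z)) holomorphic_on ?A" "(\<lambda>z. z ^ n * deriv \<Psi> z ^ (n - s)) holomorphic_on ?A"
      using \<Psi>' \<Phi>' by (auto intro!: holomorphic_intros)
    have "(deriv ^^ s) (\<lambda>x. x ^ Suc n * (deriv \<Phi> x - 1 / (2 * x)) * deriv \<Psi> x ^ (Suc n - s - 1)) 1 =
        (deriv ^^ s) (\<lambda>z. z ^ k * (deriv \<Psi> z ^ (n - s) * deriv \<Phi> z) - 1 / 2 * (z ^ n * deriv \<Psi> z ^ (n - s))) 1"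
    proof (rule higher_deriv_cong_ev)
      have "\<forall>\<^sub>F z in nhds 1. z \<in> ?A" using one by (intro eventually_nhds_in_open) auto
      then show "\<forall>\<^sub>F z in nhds 1. z ^ Suc n * (deriv \<Phi> z - 1 / (2 * z)) * deriv \<Psi> z ^ (Suc n - s - 1) =
          z ^ k * (deriv \<Psi> z ^ (n - s) * deriv \<Phi> z) - 1 / 2 * (z ^ n * deriv \<Psi> z ^ (n - s))"
        by eventually_elim (use nz in \<open>simp add: n field_simps\<close>)
    qed simp
    also have "\<dots> = (deriv ^^ s) (\<lambda>z. z ^ k * (deriv \<Psi> z ^ (n - s) * deriv \<Phi> z)) 1 - (deriv ^^ s) (\<lambda>z. 1 / 2 * (z ^ n * deriv \<Psi> z ^ (n - s))) 1"
      by (intro higher_deriv_diff[where S = ?A] holomorphic_on_mult[OF holomorphic_on_const] hol open_ball one)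
    also have "(deriv ^^ s) (\<lambda>z. 1 / 2 * (z ^ n * deriv \<Psi> z ^ (n - s))) 1 = 1 / 2 * (deriv ^^ s) (\<lambda>z. z ^ n * deriv \<Psi> z ^ (n - s)) 1"
      by (intro higher_deriv_cmult[where A = ?A] hol open_ball one)
    finally show "fact (Suc n) / (fact s * fact (s + 1) * fact (Suc n - s - 1)) *
        (deriv ^^ s) (\<lambda>x. x ^ Suc n * (deriv \<Phi> x - 1 / (2 * x)) * deriv \<Psi> x ^ (Suc n - s - 1)) 1 =
        v s * (P s - \<alpha> n s / 2)"
      by (simp add: v_def P_def \<alpha>_def n)
  qed
  \<comment> \<open>the three identities between the weights on which the cancellation rests\<close>
  have w1: "fact k / fact (k - s) / w s * of_nat (k - s) = v s" if "s \<le> n" for s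
  proof -
    have ks: "k - s = Suc (n - s)" using that by (simp add: n Suc_diff_le)
    have "F / (d * f) / g * d = F / (g * f)" if "d \<noteq> 0" for F d f g :: complex using that by simp
    then show ?thesis unfolding ks fact_Suc[of "n - s"] v_def w_def
      by (simp only: of_nat_neq_0 not_False_eq_True)
  qed
  have w2: "fact k / fact (k - Suc s) / w (Suc s) * of_nat (Suc s * Suc (Suc s)) = v s" for s
  proof -
    have "F / f / ((a * g) * (b * (a * g))) * (a * b) = F / (g * (a * g) * f)"
      if "a \<noteq> 0" "b \<noteq> 0" "g \<noteq> 0" for F f a b g :: complex using that by (simp add: field_simps)
    then show ?thesis unfolding v_def w_def n diff_Suc_Suc fact_Suc[of "Suc s"] fact_Suc[of s] of_nat_mult
      by (simp only: of_nat_neq_0 fact_nonzero not_False_eq_True)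
  qed
  have w3: "of_nat (k choose 2) * (fact n / fact (n - s) / w s) = of_nat n / 2 * v s" for s
  proof -
    have "K * M / 2 * (F / f / g) = M / 2 * (K * F / (g * f))" for K M F f g :: complex
      by (simp add: mult_ac)
    then show ?thesis unfolding v_def w_def n of_nat_choose_two fact_Suc[of n] by (simp only:)
  qed
  have top: "fact k / fact (k - s) * ((\<beta> k s - of_nat (s * Suc s) / 2 * \<alpha> k s) / w s) =
      fact k / fact (k - s) / w s * \<beta> k s - fact k / fact (k - s) / w s * of_nat (s * Suc s) * (\<alpha> k s / 2)" for s
    by (simp only: divide_inverse algebra_simps)
  have "(\<Sum>s\<le>k. fact k / fact (k - s) / w s * \<beta> k s) = (\<Sum>s\<le>n. v s * (P s + (\<alpha> k (Suc s) - of_nat k * \<alpha> n s) / 2))"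
  proof -
    have "x * (d * p + d / 2 * c) = x * d * (p + c / 2)" for x d p c :: complex by (simp add: field_simps)
    then have "fact k / fact (k - s) / w s * \<beta> k s = v s * (P s + (\<alpha> k (Suc s) - of_nat k * \<alpha> n s) / 2)" if "s \<le> n" for s
      unfolding w1[OF that, symmetric] \<beta>_eq[OF that] by (simp only:)
    moreover have "(\<Sum>s\<le>k. fact k / fact (k - s) / w s * \<beta> k s) = (\<Sum>s\<le>n. fact k / fact (k - s) / w s * \<beta> k s)"
      using \<beta>_top by (simp add: n)
    ultimately show ?thesis by simp
  qed
  moreover have "(\<Sum>s\<le>k. fact k / fact (k - s) / w s * of_nat (s * Suc s) * (\<alpha> k s / 2)) = (\<Sum>s\<le>n. v s * (\<alpha> k (Suc s) / 2))"
    unfolding w2[symmetric] unfolding n sum.atMost_Suc_shift by simp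
  moreover have "of_nat (k choose 2) * (\<Sum>s\<le>k - 1. fact (k - 1) / fact (k - 1 - s) * (\<alpha> (k - 1) s / w s)) =
      (\<Sum>s\<le>n. v s * (of_nat n * \<alpha> n s / 2))"
  proof -
    have "of_nat (k choose 2) * (\<Sum>s\<le>k - 1. fact (k - 1) / fact (k - 1 - s) * (\<alpha> (k - 1) s / w s)) =
        (\<Sum>s\<le>n. of_nat (k choose 2) * (fact n / fact (n - s) / w s) * \<alpha> n s)"
      by (simp add: n sum_distrib_left mult_ac)
    then show ?thesis unfolding w3 by (simp add: mult_ac)
  qed
  ultimately show ?thesis
    unfolding top sum_subtractf m' by (simp only: sum.distrib[symmetric] sum_subtractf[symmetric])
      (intro sum.cong refl, simp add: n field_simps)
qed

section \<open>The limit theorem\<close>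

lemma power_sum_schur_exponent:
  assumes "l \<in> signatures N"
  shows "of_real (power_sum N k l) = (\<Sum>j<N. of_int (schur_exponent l j) ^ k) / (of_nat N ^ k :: complex)"
proof -
  have "length l = N" using assms by (simp add: signatures_def)
  then have "power_sum N k l = (\<Sum>j<N. of_int (schur_exponent l j) ^ k / real N ^ k)"
    unfolding power_sum_def by (intro sum.cong refl) (simp add: schur_exponent_def power_divide)
  then show ?thesis by (simp add: sum_divide_distrib)
qed

lemma expected_power_sum_real:
  fixes E :: complex
  assumes hs: "((\<lambda>l. of_real (pmf p l) * (\<Sum>j<N. of_int (schur_exponent l j) ^ k)) has_sum E) (signatures N)"
  shows "(\<lambda>l. pmf p l * power_sum N k l) summable_on signatures N"
    and "of_real (\<Sum>\<^sub>\<infinity>l\<in>signatures N. pmf p l * power_sum N k l) = E / of_nat N ^ k"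
proof -
  have "((\<lambda>l. of_real (pmf p l) * (\<Sum>j<N. of_int (schur_exponent l j) ^ k) * (1 / of_nat N ^ k)) has_sum
      E * (1 / of_nat N ^ k)) (signatures N)"
    by (rule has_sum_cmult_left[OF hs])
  also have "?this \<longleftrightarrow> ((\<lambda>l. complex_of_real (pmf p l * power_sum N k l)) has_sum E / of_nat N ^ k) (signatures N)"
    by (subst has_sum_cong[where g = "\<lambda>l. complex_of_real (pmf p l * power_sum N k l)"])
      (simp_all add: power_sum_schur_exponent del: of_int_power)
  finally have c: "((\<lambda>l. complex_of_real (pmf p l * power_sum N k l)) has_sum E / of_nat N ^ k) (signatures N)" .
  from has_sum_Re[OF this] show summ: "(\<lambda>l. pmf p l * power_sum N k l) summable_on signatures N"
    by (auto simp: summable_on_def)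
  from has_sum_of_real[OF has_sum_infsum[OF this], where 'a = complex] c
  show "of_real (\<Sum>\<^sub>\<infinity>l\<in>signatures N. pmf p l * power_sum N k l) = E / of_nat N ^ k"
    by (rule has_sum_unique)
qed

lemma sgf_term_dominated_polydisc:
  assumes "r \<le> N" "N \<ge> 1" "e > 0" "\<And>u. u \<in> polydisc1 r e \<Longrightarrow> sgf_term p u summable_on signatures N"
    and "0 < \<rho>" "\<rho> \<le> e / (2 + e)"
  obtains M where "M summable_on signatures N"
    "\<And>l u. l \<in> signatures N \<Longrightarrow> u \<in> polydisc1 r \<rho> \<Longrightarrow> norm (sgf_term p u l) \<le> M l"
  using sgf_term_dominated[OF assms(1-4)] polydisc1_mono[OF assms(6) order_refl, of r] assms(3) that
  by (metis add_pos_pos divide_pos_pos subsetD zero_less_numeral)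

text \<open>
  The sum over \<open>m\<close> is split into \<open>m = k\<close>, \<open>m = k - 1\<close> and the negligible rest; the Stirling numbers
  of the first two are \<open>1\<close> and \<open>k choose 2\<close>.
\<close>

lemma confluent_expansion_asymptotics:
  fixes S L :: "nat \<Rightarrow> (nat \<Rightarrow> complex) \<Rightarrow> complex" and \<Psi> \<Phi> :: "complex \<Rightarrow> complex"
  assumes \<rho>: "0 < \<rho>" "\<rho> \<le> 1" and k: "k \<ge> 1"
    and \<Psi>: "\<Psi> holomorphic_on ball 1 \<rho>" and \<Phi>: "\<Phi> holomorphic_on ball 1 \<rho>"
    and S: "\<forall>\<^sub>F N in sequentially. polydisc_analytic (Suc k) \<rho> (S N) \<and>
      (\<forall>s<Suc k. \<forall>q<s. \<forall>m. (deriv ^^ q) (confluent_sum s m (S N)) 0 = 0) \<and> log_branch (polydisc1 (Suc k) \<rho>) (S N) (L N)"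
    and lim: "uniform_limit (polydisc1 (Suc k) \<rho>)
      (\<lambda>N u. of_nat N * (1 / of_nat N * L N u - (\<Sum>i<Suc k. \<Psi> (u i)))) (\<lambda>u. \<Sum>i<Suc k. \<Phi> (u i)) sequentially"
  shows "(\<lambda>N. confluent_expansion N k (S N) / of_nat N ^ k - of_nat N * moment \<Psi> k) \<longlonglongrightarrow> moment' \<Psi> \<Phi> k"
proof -
  obtain n where n: "k = Suc n" using k by (cases k) auto
  define \<alpha> where "\<alpha> m s = (deriv ^^ s) (\<lambda>z. z ^ m * deriv \<Psi> z ^ (m - s)) 1" for m s
  define \<beta> where "\<beta> m s = (deriv ^^ s) (\<lambda>z. z ^ m * log_correction (m - s) \<Psi> \<Phi> z) 1" for m s
  define w where "w s = (fact s * fact (Suc s) :: complex)" for s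
  define b where "b m s = (fact m / fact (m - s) :: complex)" for m s
  define X where "X m s N = of_nat (N choose Suc s) * confluent_coeff s m (S N)" for m s N
  have lim_coeff: "(\<lambda>N. of_nat N * (fact s * confluent_coeff s m (S N) / of_nat N ^ (m - s) - \<alpha> m s)) \<longlonglongrightarrow> \<beta> m s"
    if "s \<le> m" "m \<le> k" for s m
    unfolding \<alpha>_def \<beta>_def
  proof (rule confluent_coeff_asymptotics[OF \<rho>(1) _ \<Psi> \<Phi> _ lim])
    show "s < Suc k" using that by simp
    then show "\<forall>\<^sub>F N in sequentially. polydisc_analytic (Suc k) \<rho> (S N) \<and>
      (\<forall>q<s. (deriv ^^ q) (confluent_sum s m (S N)) 0 = 0) \<and> log_branch (polydisc1 (Suc k) \<rho>) (S N) (L N)"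
      using S by (auto elim: eventually_mono)
  qed
  have top: "(\<lambda>N. X k s N / of_nat N ^ k - of_nat N * (\<alpha> k s / w s)) \<longlonglongrightarrow> (\<beta> k s - of_nat (s * Suc s) / 2 * \<alpha> k s) / w s"
    if "s \<le> k" for s
    unfolding X_def w_def using confluent_term_asymptotics(1)[OF lim_coeff[OF that order_refl] that] .
  have mid: "(\<lambda>N. X n s N / of_nat N ^ k) \<longlonglongrightarrow> \<alpha> n s / w s" if "s \<le> n" for s
    unfolding X_def w_def n using confluent_term_asymptotics(2)[OF lim_coeff[OF that] that] n by simp
  have low: "(\<lambda>N. X m s N / of_nat N ^ k) \<longlonglongrightarrow> 0" if "s \<le> m" "m < n" for s m
    unfolding X_def by (rule confluent_term_asymptotics(3)[OF lim_coeff[OF that(1)] that(1)]) (use that n in auto)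
  have mom: "moment \<Psi> k = (\<Sum>s\<le>k. b k s * (\<alpha> k s / w s))"
    unfolding moment_def atLeast0AtMost by (intro sum.cong refl) (simp add: b_def w_def \<alpha>_def del: fact_Suc)
  have exp: "confluent_expansion N k (S N) / of_nat N ^ k - of_nat N * moment \<Psi> k =
      (\<Sum>s\<le>k. b k s * (X k s N / of_nat N ^ k - of_nat N * (\<alpha> k s / w s))) +
      of_nat (k choose 2) * (\<Sum>s\<le>n. b n s * (X n s N / of_nat N ^ k)) +
      (\<Sum>m<n. of_nat (Stirling k m) * (\<Sum>s\<le>m. b m s * (X m s N / of_nat N ^ k)))" for N
  proof -
    have "confluent_expansion N k (S N) / of_nat N ^ k =
        (\<Sum>m\<le>k. of_nat (Stirling k m) * (\<Sum>s\<le>m. b m s * (X m s N / of_nat N ^ k)))"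
      unfolding confluent_expansion_def stirling_sum_def b_def X_def by (simp add: sum_divide_distrib sum_distrib_left)
    also have "{..k} = insert k (insert n {..<n})" by (auto simp: n)
    finally have "confluent_expansion N k (S N) / of_nat N ^ k =
        (\<Sum>s\<le>k. b k s * (X k s N / of_nat N ^ k)) +
        (of_nat (k choose 2) * (\<Sum>s\<le>n. b n s * (X n s N / of_nat N ^ k)) +
        (\<Sum>m<n. of_nat (Stirling k m) * (\<Sum>s\<le>m. b m s * (X m s N / of_nat N ^ k))))"
      by (simp add: n Stirling_Suc_self)
    moreover have "(\<Sum>s\<le>k. b k s * (X k s N / of_nat N ^ k - of_nat N * (\<alpha> k s / w s))) =
        (\<Sum>s\<le>k. b k s * (X k s N / of_nat N ^ k)) - of_nat N * moment \<Psi> k"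
      unfolding mom sum_distrib_left sum_subtractf[symmetric] by (intro sum.cong refl) (simp add: right_diff_distrib)
    ultimately show ?thesis by simp
  qed
  have "(\<Sum>s\<le>k. b k s * ((\<beta> k s - of_nat (s * Suc s) / 2 * \<alpha> k s) / w s)) +
      of_nat (k choose 2) * (\<Sum>s\<le>n. b n s * (\<alpha> n s / w s)) = moment' \<Psi> \<Phi> k"
    using moment'_identity[OF \<rho> \<Psi> \<Phi> k] unfolding \<alpha>_def \<beta>_def w_def b_def n diff_Suc_1 .
  then have "moment' \<Psi> \<Phi> k = (\<Sum>s\<le>k. b k s * ((\<beta> k s - of_nat (s * Suc s) / 2 * \<alpha> k s) / w s)) +
      of_nat (k choose 2) * (\<Sum>s\<le>n. b n s * (\<alpha> n s / w s)) +
      (\<Sum>m<n. of_nat (Stirling k m) * (\<Sum>s\<le>m. b m s * 0))"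
    by simp
  then show ?thesis unfolding exp
    by (simp only:) (intro tendsto_add tendsto_sum tendsto_mult tendsto_const top mid low, auto)
qed

theorem theorem3:
  fixes \<rho> :: "nat \<Rightarrow> int list pmf" and \<Psi> \<Phi> :: "complex \<Rightarrow> complex" and k :: nat
  assumes "\<And>N. N \<ge> 1 \<Longrightarrow> set_pmf (\<rho> N) \<subseteq> signatures N"
    and "\<And>N. N \<ge> 1 \<Longrightarrow>
      \<exists>e>0. \<forall>u\<in>polydisc1 N e. sgf_term (\<rho> N) u summable_on signatures N"
    and "\<Psi> analytic_on {1}" and "\<Phi> analytic_on {1}"
    and "\<And>r::nat. r \<ge> 1 \<Longrightarrow>
      \<exists>e>0. \<exists>L :: nat \<Rightarrow> (nat \<Rightarrow> complex) \<Rightarrow> complex.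
        (\<forall>\<^sub>F N in sequentially. log_branch (polydisc1 r e) (sgf N (\<rho> N)) (L N)) \<and>
        uniform_limit (polydisc1 r e)
          (\<lambda>N u. of_nat N * (1 / of_nat N * L N u - (\<Sum>i<r. \<Psi> (u i))))
          (\<lambda>u. \<Sum>i<r. \<Phi> (u i)) sequentially"
    and "k \<ge> 1"
  shows "(\<forall>N\<ge>1. (\<lambda>l. pmf (\<rho> N) l * power_sum N k l) summable_on signatures N) \<and>
    (\<lambda>N. of_nat N * (1 / of_nat N *
        of_real (\<Sum>\<^sub>\<infinity>l\<in>signatures N. pmf (\<rho> N) l * power_sum N k l) - moment \<Psi> k))
      \<longlonglongrightarrow> moment' \<Psi> \<Phi> k"
proof -
  note summ = assms(2) and \<Psi>an = assms(3) and \<Phi>an = assms(4) and hyp = assms(5) and k = assms(6)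
  have summable: "(\<lambda>l. pmf (\<rho> N) l * power_sum N k l) summable_on signatures N" if N: "N \<ge> 1" for N
  proof -
    obtain e where e: "e > 0" "\<And>u. u \<in> polydisc1 N e \<Longrightarrow> sgf_term (\<rho> N) u summable_on signatures N"
      using summ[OF N] by blast
    define d where "d = e / (2 + e)"
    have d: "0 < d" "d \<le> 1" using e(1) by (auto simp: d_def)
    obtain M where M: "M summable_on signatures N"
      "\<And>l u. l \<in> signatures N \<Longrightarrow> u \<in> polydisc1 N d \<Longrightarrow> norm (sgf_term (\<rho> N) u l) \<le> M l"
      by (rule sgf_term_dominated_polydisc[OF order_refl N e d(1)]) (auto simp: d_def)
    from expected_power_sum(1)[OF N d N order_refl _ M]
    have "((\<lambda>l. of_real (pmf (\<rho> N) l) * (\<Sum>j<N. of_int (schur_exponent l j) ^ k)) has_sum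
        confluent_expansion N k (sgf N (\<rho> N))) (signatures N)" by blast
    from expected_power_sum_real(1)[OF this] show ?thesis .
  qed
  \<comment> \<open>\<open>k + 1\<close> variables suffice, because confluent coefficients with \<open>s \<le> k\<close> see no more\<close>
  obtain e L where e: "e > 0"
    and log: "\<forall>\<^sub>F N in sequentially. log_branch (polydisc1 (Suc k) e) (sgf N (\<rho> N)) (L N)"
    and lim: "uniform_limit (polydisc1 (Suc k) e)
          (\<lambda>N u. of_nat N * (1 / of_nat N * L N u - (\<Sum>i<Suc k. \<Psi> (u i))))
          (\<lambda>u. \<Sum>i<Suc k. \<Phi> (u i)) sequentially"
    using hyp[of "Suc k"] by auto
  obtain e1 e2 where e12: "e1 > 0" "\<Psi> holomorphic_on ball 1 e1" "e2 > 0" "\<Phi> holomorphic_on ball 1 e2"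
    using \<Psi>an \<Phi>an by (auto simp: analytic_on_def)
  define d where "d = min (e / (2 + e)) (min e1 e2)"
  have de: "e / (2 + e) \<le> 1" "e / (2 + e) \<le> e" using e by (simp_all add: divide_le_eq)
  have d: "0 < d" "d \<le> 1" "d \<le> e / (2 + e)" "d \<le> e" using e e12 de(2) by (auto simp: d_def intro: min.coboundedI1[OF de(1)])
  have hol: "\<Psi> holomorphic_on ball 1 d" "\<Phi> holomorphic_on ball 1 d"
    by (rule holomorphic_on_subset[OF e12(2)] holomorphic_on_subset[OF e12(4)], simp add: d_def subset_ball)+
  have sub: "polydisc1 (Suc k) d \<subseteq> polydisc1 (Suc k) e" using d(4) e by (intro polydisc1_mono) auto
  have good: "\<forall>\<^sub>F N in sequentially. polydisc_analytic (Suc k) d (sgf N (\<rho> N)) \<and>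
      (\<forall>s<Suc k. \<forall>q<s. \<forall>m. (deriv ^^ q) (confluent_sum s m (sgf N (\<rho> N))) 0 = 0) \<and>
      log_branch (polydisc1 (Suc k) d) (sgf N (\<rho> N)) (L N) \<and>
      of_real (\<Sum>\<^sub>\<infinity>l\<in>signatures N. pmf (\<rho> N) l * power_sum N k l) =
        confluent_expansion N k (sgf N (\<rho> N)) / of_nat N ^ k"
    using log eventually_ge_at_top[of "Suc k"]
  proof eventually_elim
    case (elim N)
    have N: "N \<ge> 1" using elim by simp
    have "sgf_term (\<rho> N) u summable_on signatures N" if "u \<in> polydisc1 (Suc k) e" for u
    proof (rule ccontr)
      assume "\<not> sgf_term (\<rho> N) u summable_on signatures N"
      \<comment> \<open>a divergent series has the value \<open>0\<close>, which is not an exponential\<close>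
      then have "sgf N (\<rho> N) u = 0" unfolding sgf_def by (rule infsum_not_exists)
      moreover have "sgf N (\<rho> N) u = exp (L N u)" using elim(1) that by (simp add: log_branch_def)
      ultimately show False by simp
    qed
    note summ_e = this
    obtain M where M: "M summable_on signatures N"
      "\<And>l u. l \<in> signatures N \<Longrightarrow> u \<in> polydisc1 (Suc k) d \<Longrightarrow> norm (sgf_term (\<rho> N) u l) \<le> M l"
      using sgf_term_dominated_polydisc[OF elim(2) N e summ_e d(1,3)] by blast
    have r: "1 \<le> Suc k" "\<And>s. s \<le> k \<Longrightarrow> s < N \<Longrightarrow> s < Suc k" by auto
    note ex = expected_power_sum[OF N d(1,2) r(1) elim(2) r(2) M]
    have "log_branch (polydisc1 (Suc k) d) (sgf N (\<rho> N)) (L N)"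
      using elim(1) sub unfolding log_branch_def by (auto intro: continuous_on_subset)
    then show ?case using ex(2,3) expected_power_sum_real(2)[OF ex(1)] by blast
  qed
  have "(\<lambda>N. confluent_expansion N k (sgf N (\<rho> N)) / of_nat N ^ k - of_nat N * moment \<Psi> k) \<longlonglongrightarrow> moment' \<Psi> \<Phi> k"
  proof (rule confluent_expansion_asymptotics[OF d(1,2) k hol])
    show "\<forall>\<^sub>F N in sequentially. polydisc_analytic (Suc k) d (sgf N (\<rho> N)) \<and>
      (\<forall>s<Suc k. \<forall>q<s. \<forall>m. (deriv ^^ q) (confluent_sum s m (sgf N (\<rho> N))) 0 = 0) \<and>
      log_branch (polydisc1 (Suc k) d) (sgf N (\<rho> N)) (L N)"
      using good by eventually_elim blast
  qed (rule uniform_limit_on_subset[OF lim sub])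
  moreover have "\<forall>\<^sub>F N in sequentially. of_nat N * (1 / of_nat N *
        of_real (\<Sum>\<^sub>\<infinity>l\<in>signatures N. pmf (\<rho> N) l * power_sum N k l) - moment \<Psi> k) =
      confluent_expansion N k (sgf N (\<rho> N)) / of_nat N ^ k - of_nat N * moment \<Psi> k"
    using good eventually_gt_at_top[of 0] by eventually_elim (simp add: right_diff_distrib)
  ultimately show ?thesis using summable by (simp only: tendsto_cong) blast
qed

end
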